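(* Let $n\ge1$ and let $h\geq 3$ be finite. The following hold: (1) If $h$ is odd, then $\mathcal H_n(q)$ is not semisimple in the case $h=n$. If $h$ is even, then $\mathcal H_n(q)$ is not semisimple in the case $h=2n$. (2) If $h>n$ in the case $h$ is odd, and $h>2n$ in the case $h$ is even, then $\mathcal H_n(q)$ is semisimple.
   Context: Standing assumptions: $\mathbb F$ is an algebraically closed field with $\operatorname{char}\mathbb F\neq 2$; $q\in\mathbb F^*$, $q\neq\pm1$; $\varepsilon=q-q^{-1}$. Either $q$ is a primitive $k$-th root of unity with $k$ odd, and then $h=k$ (odd), or $q$ is a primitive $k$-th root of unity with $k=4\ell$, and then $h=k/2=2\ell$ (even); in both cases $q^2$ is a primitive $h$-th root of unity. The finite Hecke-Clifford superalgebra $\mathcal H_n(q)$ is the $\mathbb F$-superalgebra generated by even elements $T_1,\dots,T_{n-1}$ and odd elements $C_1,\dots,C_n$ subject to: $T_i^2=\varepsilon T_i+1$; $T_iT_j=T_jT_i$ for $|i-j|>1$; $T_iT_{i+1}T_i=T_{i+1}T_iT_{i+1}$; $C_i^2=1$; $C_iC_j=-C_jC_i$ for $i\ne j$; $T_iC_i=C_{i+1}T_i$; $T_iC_{i+1}=C_iT_i-\varepsilon(C_i-C_{i+1})$; $T_iC_j=C_jT_i$ for $j\neq i,i+1$. It has dimension $2^n n!$. A superalgebra is called semisimple if it is semisimple as an ordinary (ungraded) algebra. *)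

theory Defs
  imports
    "HOL-Algebra.QuotRing"
    "HOL-Library.Poly_Mapping"
    "HOL-Computational_Algebra.Polynomial"
begin

section \<open>Free associative algebras\<close>

text \<open>
  Words form a monoid under concatenation, so the convolution product of
  \<open>Poly_Mapping\<close> turns \<open>'g word \<Rightarrow>\<^sub>0 'a\<close> into the free associative unital algebra over \<open>'a\<close> on all
  of \<open>'g\<close>. The wrapper avoids global class instances for lists.
\<close>

datatype 'g word = Word (letters: "'g list")

instantiation word :: (type) monoid_add
begin

definition zero_word :: "'a word" where
  "0 = Word []"

definition plus_word :: "'a word \<Rightarrow> 'a word \<Rightarrow> 'a word" where
  "u + v = Word (letters u @ letters v)"

instance
  by standard (simp_all add: zero_word_def plus_word_def)

end

definition free_algebra :: "'g set \<Rightarrow> ('g word \<Rightarrow>\<^sub>0 'a::ring_1) ring" where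
  "free_algebra G = \<lparr>carrier = {p. \<forall>w\<in>Poly_Mapping.keys p. set (letters w) \<subseteq> G},
     monoid.mult = (*), one = 1, zero = 0, add = (+)\<rparr>"

definition generator :: "'g \<Rightarrow> ('g word \<Rightarrow>\<^sub>0 'a::ring_1)" where
  "generator g = Poly_Mapping.single (Word [g]) 1"

definition scalar :: "'a::ring_1 \<Rightarrow> ('g word \<Rightarrow>\<^sub>0 'a)" where
  "scalar a = Poly_Mapping.single 0 a"

lemma generator_in_carrier:
  "g \<in> G \<Longrightarrow> generator g \<in> carrier (free_algebra G :: ('g word \<Rightarrow>\<^sub>0 'a::ring_1) ring)"
  by (simp add: generator_def free_algebra_def)

lemma scalar_in_carrier:
  "scalar a \<in> carrier (free_algebra G :: ('g word \<Rightarrow>\<^sub>0 'a::ring_1) ring)"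
  by (simp add: scalar_def free_algebra_def zero_word_def)

lemma free_algebra_one_closed:
  "1 \<in> carrier (free_algebra G :: ('g word \<Rightarrow>\<^sub>0 'a::ring_1) ring)"
  using scalar_in_carrier[of 1 G] by (simp add: scalar_def)

lemma free_algebra_add_closed:
  fixes p r :: "'g word \<Rightarrow>\<^sub>0 'a::ring_1"
  assumes "p \<in> carrier (free_algebra G)" "r \<in> carrier (free_algebra G)"
  shows "p + r \<in> carrier (free_algebra G)"
  using assms Poly_Mapping.keys_add[of p r] by (auto simp: free_algebra_def)

lemma free_algebra_uminus_closed:
  fixes p :: "'g word \<Rightarrow>\<^sub>0 'a::ring_1"
  assumes "p \<in> carrier (free_algebra G)"
  shows "- p \<in> carrier (free_algebra G)"
  using assms by (simp add: free_algebra_def)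

lemma free_algebra_diff_closed:
  fixes p r :: "'g word \<Rightarrow>\<^sub>0 'a::ring_1"
  assumes "p \<in> carrier (free_algebra G)" "r \<in> carrier (free_algebra G)"
  shows "p - r \<in> carrier (free_algebra G)"
  using free_algebra_add_closed[OF assms(1) free_algebra_uminus_closed[OF assms(2)]] by simp

lemma free_algebra_mult_closed:
  fixes p r :: "'g word \<Rightarrow>\<^sub>0 'a::ring_1"
  assumes "p \<in> carrier (free_algebra G)" "r \<in> carrier (free_algebra G)"
  shows "p * r \<in> carrier (free_algebra G)"
  using assms Poly_Mapping.keys_mult[of p r] by (fastforce simp: free_algebra_def plus_word_def)

lemma ring_free_algebra: "ring (free_algebra G :: ('g word \<Rightarrow>\<^sub>0 'a::ring_1) ring)"
proof (rule ringI)
  show "abelian_group (free_algebra G :: ('g word \<Rightarrow>\<^sub>0 'a) ring)"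
  proof (rule abelian_groupI)
    fix x :: "'g word \<Rightarrow>\<^sub>0 'a"
    assume x: "x \<in> carrier (free_algebra G)"
    show "\<exists>y\<in>carrier (free_algebra G). y \<oplus>\<^bsub>free_algebra G\<^esub> x = \<zero>\<^bsub>free_algebra G\<^esub>"
      by (rule bexI[OF _ free_algebra_uminus_closed[OF x]]) (simp add: free_algebra_def)
  next
    fix x y :: "'g word \<Rightarrow>\<^sub>0 'a"
    assume "x \<in> carrier (free_algebra G)" "y \<in> carrier (free_algebra G)"
    then show "x \<oplus>\<^bsub>free_algebra G\<^esub> y \<in> carrier (free_algebra G)"
      using free_algebra_add_closed by (simp add: free_algebra_def)
  qed (simp_all add: free_algebra_def algebra_simps)
  show "Group.monoid (free_algebra G :: ('g word \<Rightarrow>\<^sub>0 'a) ring)"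
  proof (rule monoidI)
    fix x y :: "'g word \<Rightarrow>\<^sub>0 'a"
    assume "x \<in> carrier (free_algebra G)" "y \<in> carrier (free_algebra G)"
    then show "x \<otimes>\<^bsub>free_algebra G\<^esub> y \<in> carrier (free_algebra G)"
      using free_algebra_mult_closed by (simp add: free_algebra_def)
  next
    show "\<one>\<^bsub>free_algebra G\<^esub> \<in> carrier (free_algebra G :: ('g word \<Rightarrow>\<^sub>0 'a) ring)"
      using free_algebra_one_closed[of G] by (simp add: free_algebra_def)
  qed (simp_all add: free_algebra_def mult.assoc)
qed (simp_all add: free_algebra_def algebra_simps)

section \<open>The finite Hecke-Clifford algebra\<close>

datatype hc_generator = HC_T nat | HC_C nat

definition hc_generators :: "nat \<Rightarrow> hc_generator set" where
  "hc_generators n = HC_T ` {1..<n} \<union> HC_C ` {1..n}"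

text \<open>Each defining relation \<open>l = r\<close> is recorded as the element \<open>l - r\<close> of the free algebra.\<close>

definition hc_relations :: "nat \<Rightarrow> 'a::field \<Rightarrow> (hc_generator word \<Rightarrow>\<^sub>0 'a) set" where
  "hc_relations n q =
    (let \<epsilon> = scalar (q - inverse q);
         T = (\<lambda>i. generator (HC_T i));
         C = (\<lambda>i. generator (HC_C i))
     in {T i * T i - (\<epsilon> * T i + 1) | i. i \<in> {1..<n}}
      \<union> {T i * T j - T j * T i | i j.
           i \<in> {1..<n} \<and> j \<in> {1..<n} \<and> \<bar>int i - int j\<bar> > 1}
      \<union> {T i * T (i + 1) * T i - T (i + 1) * T i * T (i + 1) | i.
           i \<in> {1..<n} \<and> i + 1 \<in> {1..<n}}
      \<union> {C i * C i - 1 | i. i \<in> {1..n}}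
      \<union> {C i * C j - (- (C j * C i)) | i j. i \<in> {1..n} \<and> j \<in> {1..n} \<and> i \<noteq> j}
      \<union> {T i * C i - C (i + 1) * T i | i. i \<in> {1..<n}}
      \<union> {T i * C (i + 1) - (C i * T i - \<epsilon> * (C i - C (i + 1))) | i. i \<in> {1..<n}}
      \<union> {T i * C j - C j * T i | i j.
           i \<in> {1..<n} \<and> j \<in> {1..n} \<and> j \<noteq> i \<and> j \<noteq> i + 1})"

text \<open>
  Only the underlying ungraded ring is constructed: the generators \<open>T\<close> are even, the generators
  \<open>C\<close> are odd and all relations are homogeneous, so the superalgebra presentation and the
  ungraded presentation give the same algebra.
\<close>

definition hecke_clifford :: "nat \<Rightarrow> 'a::field \<Rightarrow> (hc_generator word \<Rightarrow>\<^sub>0 'a) set ring" where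
  "hecke_clifford n q =
     free_algebra (hc_generators n) Quot
       (Idl\<^bsub>free_algebra (hc_generators n)\<^esub> (hc_relations n q))"

lemma hc_relations_subset_carrier:
  "hc_relations n q \<subseteq> carrier (free_algebra (hc_generators n))"
  unfolding hc_relations_def Let_def
  by (auto simp: hc_generators_def
      intro!: free_algebra_add_closed free_algebra_diff_closed free_algebra_mult_closed
        free_algebra_uminus_closed free_algebra_one_closed scalar_in_carrier generator_in_carrier)

lemma ring_hecke_clifford: "ring (hecke_clifford n q)"
  unfolding hecke_clifford_def
  by (intro ideal.quotient_is_ring ring.genideal_ideal ring_free_algebra
      hc_relations_subset_carrier)

section \<open>Semisimple rings\<close>

definition left_ideal :: "'r set \<Rightarrow> ('r, 'm) ring_scheme \<Rightarrow> bool" where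
  "left_ideal L R \<longleftrightarrow>
     additive_subgroup L R \<and> (\<forall>a\<in>carrier R. \<forall>x\<in>L. a \<otimes>\<^bsub>R\<^esub> x \<in> L)"

definition simple_left_ideal :: "'r set \<Rightarrow> ('r, 'm) ring_scheme \<Rightarrow> bool" where
  "simple_left_ideal L R \<longleftrightarrow>
     left_ideal L R \<and> L \<noteq> {\<zero>\<^bsub>R\<^esub>} \<and>
     (\<forall>J. left_ideal J R \<and> J \<subseteq> L \<longrightarrow> J = {\<zero>\<^bsub>R\<^esub>} \<or> J = L)"

text \<open>
  The regular left module is the internal direct sum of a family of simple submodules: every
  element is in a unique way the sum of a finitely supported family with \<open>f L \<in> L\<close>.
  For a unital algebra over a field, left ideals are automatically subspaces, so this is also
  semisimplicity as an algebra.
\<close>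

definition semisimple_ring :: "('r, 'm) ring_scheme \<Rightarrow> bool" where
  "semisimple_ring R \<longleftrightarrow> ring R \<and>
     (\<exists>\<L>. (\<forall>L\<in>\<L>. simple_left_ideal L R) \<and>
       (\<forall>x\<in>carrier R. \<exists>!f. f \<in> (\<Pi>\<^sub>E L\<in>\<L>. L) \<and> finite {L\<in>\<L>. f L \<noteq> \<zero>\<^bsub>R\<^esub>} \<and>
          x = (\<Oplus>\<^bsub>R\<^esub>L\<in>{L\<in>\<L>. f L \<noteq> \<zero>\<^bsub>R\<^esub>}. f L)))"

section \<open>Roots of unity\<close>

definition primitive_root_of_unity :: "nat \<Rightarrow> 'a::field \<Rightarrow> bool" where
  "primitive_root_of_unity k q \<longleftrightarrow> k > 0 \<and> q ^ k = 1 \<and> (\<forall>j. 0 < j \<and> j < k \<longrightarrow> q ^ j \<noteq> 1)"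

end

theory Submission
  imports Defs "HOL-Library.Function_Algebras"
begin

text \<open>
  Put \<open>D\<^sub>1 = C\<^sub>1\<close>, \<open>D\<^sub>m\<^sub>+\<^sub>1 = T\<^sub>m\<inverse> D\<^sub>m T\<^sub>m\<close> and \<open>y\<^sub>m = C\<^sub>m D\<^sub>m + D\<^sub>m C\<^sub>m\<close>; the \<open>y\<^sub>m\<close> commute.
  A linear projection onto a submodule is averaged along the chain \<open>H\<^sub>1 \<subset> H\<^sub>2 \<subset> \<dots>\<close>, using the relative
  Casimir sum \<open>\<Sum>\<^sub>j T\<^sub>j \<cdots> T\<^sub>m\<^sub>-\<^sub>1 z T\<^sub>m\<^sub>-\<^sub>1 \<cdots> T\<^sub>j\<close> with \<open>z\<close> twisted by the resolvent \<open>(s - y\<^sub>m)\<inverse>\<close>.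
  This averaging multiplies the identity by a central element \<open>\<Gamma>\<^sub>m(s)\<close> with
  \<open>1 - \<epsilon>\<^sup>2 \<Gamma>\<^sub>m(s) = \<Prod>\<^sub>k (1 - \<epsilon>\<^sup>2 (s y\<^sub>k - 4) / (s - y\<^sub>k)\<^sup>2)\<close>, so it is invertible for generic \<open>s\<close> unless
  the product is identically 1 for some eigenvalues \<open>\<eta>\<^sub>k\<close> of the \<open>y\<^sub>k\<close>. Writing \<open>\<eta>\<^sub>k = u (z\<^sub>k + z\<^sub>k\<inverse>)\<close> with
  \<open>u = 2 / (q + q\<inverse>)\<close>, that identity says that the multiplicity function of the points \<open>z\<^sub>k\<^sup>\<plusminus>\<close> is
  harmonic along the orbits of multiplication by \<open>q\<^sup>2\<close>; being periodic it is constant along them,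
  which needs \<open>2m \<ge> h\<close>, and \<open>m \<ge> h\<close> if \<open>h\<close> is odd. Otherwise Maschke's argument gives semisimplicity.

  For the converse consider the module induced from \<open>T\<^sub>i \<mapsto> q\<close>, which is the Clifford algebra. Its
  \<open>T\<close>-eigenvectors of eigenvalue \<open>q\<close> are spanned by \<open>1\<close> and \<open>d = \<Sum>\<^sub>j q\<^sup>2\<^sup>j C\<^sub>j\<close>, and right multiplication by
  \<open>d\<close> is an endomorphism. If \<open>d\<^sup>2 = \<Sum>\<^sub>j q\<^sup>4\<^sup>j = 0\<close>, this endomorphism is a nonzero nilpotent one in a
  two-dimensional endomorphism ring, so the submodule generated by \<open>d\<close> has no complement.
\<close>

section \<open>Two adjacent sites\<close>

text \<open>What dictates the second family \<open>D\<close> is an asymmetry of the relations. In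
  \<open>T m * z * T m\<close> the right factor carries \<open>C m\<close> to
  \<open>C (Suc m)\<close> without correction, whereas moving the left factor past
  \<open>C (Suc m)\<close> costs an \<open>eps\<close>-term; the \<open>D m\<close> are made so that
  this left passage is exact. A seed with \<open>z * C m = D m * z\<close> therefore keeps such a
  relation at every lower level, and as \<open>D 1 = C 1\<close> it ends as genuine commutation with
  \<open>C 1\<close>. Such seeds are the symmetrisations \<open>x + D m * x * C m\<close>. The
  resolvent inside \<open>x\<close> adds a parameter: for a single \<open>s\<close> the averaged
  identity may be singular by accident, but singularity for generic \<open>s\<close> forces a
  polynomial identity in \<open>s\<close>, hence an equality of multisets of roots. The constant
  \<open>u\<close> is the one for which the quadratic
  \<open>(s - \<eta>)^2 - eps^2 (s \<eta> - 4)\<close> has as roots the values obtained from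
  \<open>\<eta>\<close> by replacing \<open>z\<close> with \<open>q^2 z\<close> and
  \<open>z / q^2\<close>. The parity of \<open>h\<close> matters because \<open>z\<close> and its
  inverse give the same \<open>\<eta>\<close>: an orbit of odd size that meets its own inverse
  contains a self-inverse point, and there multiplicities are even.\<close>

lemma mult_left_absorb: assumes "x * y = (z::'e::semigroup_mult)" shows "x * (y * w) = z * w"
  using assms by (simp add: mult.assoc[symmetric])

lemma commute_mult_of_anticommute: assumes "x * u = - (u * x)" "x * v = - (v * x)" shows "x * (u * v) = u * v * (x::'e::ring)"
proof -
  have "x * (u * v) = (x * u) * v" by (simp add: mult.assoc)
  also have "\<dots> = - (u * (x * v))" by (simp add: assms mult.assoc)
  finally show ?thesis by (simp add: assms(2) mult.assoc)
qed

lemma commute_mult: assumes "x * u = u * x" "x * v = v * x" shows "x * (u * v) = u * v * (x::'e::semigroup_mult)"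
  by (metis assms mult.assoc)

text \<open>The letters stand for \<open>T = T\<^sub>m\<close>, \<open>c = C\<^sub>m\<close>, \<open>d = C\<^sub>m\<^sub>+\<^sub>1\<close>, \<open>D = D\<^sub>m\<close>, \<open>G = D\<^sub>m\<^sub>+\<^sub>1\<close>; \<open>Ra\<close> and \<open>Rb\<close> are the
  resolvents of \<open>y\<^sub>m\<close> and \<open>y\<^sub>m\<^sub>+\<^sub>1\<close> at \<open>s\<close>.\<close>

locale hc_step =
  fixes e eps s T c d D G Ra Rb :: "'e::ring_1"
  assumes unit: "\<And>x. x \<in> {e, T, c, d, D, G, Ra, Rb} \<Longrightarrow> e * x = x"
               "\<And>x. x \<in> {e, T, c, d, D, G, Ra, Rb} \<Longrightarrow> x * e = x"
    and eps: "\<And>x. x \<in> {e, T, c, d, D, G, Ra, Rb} \<Longrightarrow> x * eps = eps * x" "s * eps = eps * s"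
    and s: "\<And>x. x \<in> {e, T, c, d, D, G, Ra, Rb} \<Longrightarrow> x * s = s * x"
    and T_sq: "T * T = eps * T + e"
    and sq: "c * c = e" "d * d = e" "D * D = e" "G * G = e"
    and anti: "d * c = - (c * d)" "d * D = - (D * d)" "G * c = - (c * G)" "G * D = - (D * G)"
    and Tc: "T * c = d * T" and Td: "T * d = c * T - eps * (c - d)"
    and TG: "T * G = D * T" and TD: "T * D = G * T + eps * (D - G)"
    and R_comm: "\<And>x. x \<in> {c, d, D, G, Rb} \<Longrightarrow> x * Ra = Ra * x"
       "\<And>x. x \<in> {c, d, D, G} \<Longrightarrow> x * Rb = Rb * x"
    and Ra: "(s * e - (c * D + D * c)) * Ra = e" and Rb: "(s * e - (d * G + G * d)) * Rb = e"
begin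

text \<open>Oriented as rewrite rules: \<open>e\<close> is absorbed, \<open>eps\<close>,
  \<open>s\<close> and the resolvents move left, \<open>T\<close> moves right past the Clifford
  letters, and the letters \<open>c\<close>, \<open>D\<close> of the lower site come before
  \<open>d\<close>, \<open>G\<close> of the upper one. The second copy of each rule in
  \<open>norm\<close> lets it fire inside right-nested products.\<close>

lemmas norm0 = unit[simplified] eps[simplified] s[simplified] T_sq sq anti Tc Td TG TD R_comm[simplified]
lemmas norm = norm0 norm0[THEN mult_left_absorb] algebra_simps

text \<open>The defect with which \<open>T\<close> fails to intertwine \<open>y (m + 1)\<close> and
  \<open>y m\<close>. It comes from the correction term of \<open>Td\<close>, once for each of the
  two products in \<open>y (m + 1)\<close>; the passage of \<open>T\<close> past \<open>G\<close> is
  exact.\<close>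

definition "Er = d * G - D * c + D * d - c * G"
definition "w = s * T + T - D * c * T - G * d * T - D * c * G * d * T"

lemma y_T: "T * (d * G + G * d) = (c * D + D * c) * T + eps * Er"
  by (simp add: norm Er_def)

text \<open>A resolvent identity: multiplying the intertwining relation for \<open>s * e - y\<close>
  by \<open>Ra\<close> on the left and \<open>Rb\<close> on the right turns the defect of the
  \<open>y\<close> into a defect of the inverses.\<close>

lemma Rb_T: "T * Rb = Ra * T + eps * Ra * Rb * Er"
proof -
  have "(s * e - (c * D + D * c)) * T = T * (s * e - (d * G + G * d)) + eps * Er"
    by (simp add: right_diff_distrib left_diff_distrib y_T) (simp add: norm)
  then have *: "Ra * ((s * e - (c * D + D * c)) * T) * Rb = Ra * (T * (s * e - (d * G + G * d)) + eps * Er) * Rb"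
    by simp
  have Ra': "Ra * (s * e - (c * D + D * c)) = e"
    using Ra by (simp add: norm)
  have "T * Rb = (Ra * (s * e - (c * D + D * c))) * (T * Rb)"
    unfolding Ra' by (simp add: norm)
  also have "\<dots> = Ra * T * ((s * e - (d * G + G * d)) * Rb) + eps * Ra * Er * Rb"
    using * by (simp only: mult.assoc distrib_left distrib_right) (simp add: norm)
  also have "\<dots> = Ra * T + eps * Ra * Rb * Er"
    unfolding Rb by (simp add: norm Er_def)
  finally show ?thesis .
qed

lemma T_even_T: "T * (e + G * d) * T = (e + D * c) + eps * ((e + D * d) * T)"
  by (simp add: norm)

lemma even_numerator: "(s * e - (d * G + G * d)) * (e + D * d) * T + Er * (e + G * d) * T = w + D * w * c"
  by (simp add: norm Er_def w_def)

text \<open>Splits the symmetrised defect into the level-\<open>m\<close> seeds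
  \<open>e + D * c\<close> and \<open>c - D\<close>, with left coefficients in \<open>d\<close> and
  \<open>G\<close> only. These coefficients commute with the lower \<open>T i\<close>, so they can
  be pulled out of the Casimir sum, and the sums over the two seeds are known.\<close>

lemma Er_even: "Er + D * Er * c = (d * G - e) * (e + D * c) + (d + G) * (c - D)"
  by (simp add: norm Er_def w_def)

lemma D_c_T: "D * c * T = T * G * d + eps * D * (c - d)"
  by (simp add: norm Er_def w_def)

definition "w' = d * (s * T - T - d * G * T - D * c * T + D * c * d * G * T)"

lemma T_odd_T: "T * (d - G) * T = (c - D) - eps * (D * T) + eps * (d * T)"
  by (simp add: norm Er_def w_def)

lemma odd_numerator: "(s * e - (d * G + G * d)) * (d - D) * T + Er * (d - G) * T = w' - D * w' * c"
  by (simp add: norm Er_def w'_def)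

text \<open>Brings a term with denominator \<open>Ra\<close> to the common denominator
  \<open>Ra * Rb\<close>.\<close>

lemma Ra_expand: "Ra * z = Ra * Rb * ((s * e - (d * G + G * d)) * z)" if "e * z = z"
proof -
  have "Rb * (s * e - (d * G + G * d)) = e"
    using Rb by (simp add: norm)
  then have "Ra * Rb * ((s * e - (d * G + G * d)) * z) = Ra * e * z"
    by (simp add: mult.assoc[symmetric]) (simp add: mult.assoc)
  then show ?thesis using that by (simp add: mult.assoc)
qed

text \<open>Conjugation by \<open>T\<close> turns the seed of level \<open>m + 1\<close> into that
  of level \<open>m\<close> plus an \<open>eps\<close>-multiple which, up to resolvents, is again a
  symmetrisation \<open>x + D * x * c\<close>. This shape is what makes the correction summable one
  level below.\<close>

lemma trace_even: "T * (Rb * (e + G * d)) * T = Ra * (e + D * c) + eps * Ra * Rb * (w + D * w * c)"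
proof -
  have "T * (Rb * (e + G * d)) * T = (Ra * T + eps * Ra * Rb * Er) * (e + G * d) * T"
    by (simp add: Rb_T mult.assoc[symmetric])
  also have "\<dots> = Ra * (T * (e + G * d) * T) + eps * Ra * Rb * (Er * (e + G * d) * T)"
    by (simp add: mult.assoc distrib_left distrib_right)
  also have "\<dots> = Ra * (e + D * c) + eps * (Ra * ((e + D * d) * T)) + eps * Ra * Rb * (Er * (e + G * d) * T)"
    unfolding T_even_T by (simp add: norm)
  also have "Ra * ((e + D * d) * T) = Ra * Rb * ((s * e - (d * G + G * d)) * ((e + D * d) * T))"
    by (rule Ra_expand) (simp add: norm)
  finally show ?thesis
    unfolding even_numerator[symmetric] by (simp add: mult.assoc distrib_left distrib_right)
qed

text \<open>The same reduction for the parity-changing seed, which has to be followed as well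
  because \<open>Er_even\<close> produces it.\<close>

lemma trace_odd: "T * (Rb * (d - G)) * T = Ra * (c - D) + eps * Ra * Rb * (w' - D * w' * c)"
proof -
  have "T * (Rb * (d - G)) * T = (Ra * T + eps * Ra * Rb * Er) * (d - G) * T"
    by (simp add: Rb_T mult.assoc[symmetric])
  also have "\<dots> = Ra * (T * (d - G) * T) + eps * Ra * Rb * (Er * (d - G) * T)"
    by (simp add: mult.assoc distrib_left distrib_right)
  also have "\<dots> = Ra * (c - D) + eps * (Ra * ((d - D) * T)) + eps * Ra * Rb * (Er * (d - G) * T)"
    unfolding T_odd_T by (simp add: norm)
  also have "Ra * ((d - D) * T) = Ra * Rb * ((s * e - (d * G + G * d)) * ((d - D) * T))"
    by (rule Ra_expand) (simp add: norm)
  finally show ?thesis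
    unfolding odd_numerator[symmetric] by (simp add: mult.assoc distrib_left distrib_right)
qed

end

section \<open>Representations of the Hecke-Clifford relations\<close>

text \<open>The unit is a local one, \<open>e\<close>: the quotient algebra is represented on a vector space complement
  of the ideal inside the free algebra, with \<open>e\<close> the projection onto that complement.\<close>

locale hc_rep =
  fixes SC :: "'a::field \<Rightarrow> 'e::ring_1" and e :: 'e and T C :: "nat \<Rightarrow> 'e" and q :: 'a and N :: nat
  assumes SC_add: "SC (a + b) = SC a + SC b" and SC_mult: "SC (a * b) = SC a * SC b" and SC_1: "SC 1 = 1"
    and SC_e: "SC a * e = e * SC a"
    and SC_T: "\<lbrakk>0 < i; i < N\<rbrakk> \<Longrightarrow> SC a * T i = T i * SC a"
    and SC_C: "\<lbrakk>0 < i; i \<le> N\<rbrakk> \<Longrightarrow> SC a * C i = C i * SC a"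
    and ee: "e * e = e"
    and eT: "\<lbrakk>0 < i; i < N\<rbrakk> \<Longrightarrow> e * T i = T i" and Te: "\<lbrakk>0 < i; i < N\<rbrakk> \<Longrightarrow> T i * e = T i"
    and eC: "\<lbrakk>0 < i; i \<le> N\<rbrakk> \<Longrightarrow> e * C i = C i" and Ce: "\<lbrakk>0 < i; i \<le> N\<rbrakk> \<Longrightarrow> C i * e = C i"
    and TT: "\<lbrakk>0 < i; i < N\<rbrakk> \<Longrightarrow> T i * T i = SC (q - inverse q) * T i + e"
    and T_far: "\<lbrakk>0 < i; i < N; 0 < j; j < N; Suc i < j\<rbrakk> \<Longrightarrow> T i * T j = T j * T i"
    and braid: "\<lbrakk>0 < i; Suc i < N\<rbrakk> \<Longrightarrow> T i * T (Suc i) * T i = T (Suc i) * T i * T (Suc i)"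
    and CC: "\<lbrakk>0 < i; i \<le> N\<rbrakk> \<Longrightarrow> C i * C i = e"
    and C_anti: "\<lbrakk>0 < i; i \<le> N; 0 < j; j \<le> N; i \<noteq> j\<rbrakk> \<Longrightarrow> C i * C j = - (C j * C i)"
    and TC: "\<lbrakk>0 < i; i < N\<rbrakk> \<Longrightarrow> T i * C i = C (Suc i) * T i"
    and TC': "\<lbrakk>0 < i; i < N\<rbrakk> \<Longrightarrow> T i * C (Suc i) = C i * T i - SC (q - inverse q) * (C i - C (Suc i))"
    and TC_far: "\<lbrakk>0 < i; i < N; 0 < j; j \<le> N; j \<noteq> i; j \<noteq> Suc i\<rbrakk> \<Longrightarrow> T i * C j = C j * T i"
begin

abbreviation "eps \<equiv> SC (q - inverse q)"

lemma SC_comm: "SC a * SC b = SC b * SC a"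
  by (metis SC_mult mult.commute)

lemma SC_0: "SC 0 = 0"
  using SC_add[of 0 0] by simp

section \<open>The subalgebras \<open>A m\<close> and the second Clifford family\<close>

inductive_set A :: "nat \<Rightarrow> 'e set" for m where
  A_e: "e \<in> A m"
| A_T: "\<lbrakk>0 < i; i < m\<rbrakk> \<Longrightarrow> T i \<in> A m"
| A_C: "\<lbrakk>0 < i; i \<le> m\<rbrakk> \<Longrightarrow> C i \<in> A m"
| A_add: "\<lbrakk>x \<in> A m; y \<in> A m\<rbrakk> \<Longrightarrow> x + y \<in> A m"
| A_mult: "\<lbrakk>x \<in> A m; y \<in> A m\<rbrakk> \<Longrightarrow> x * y \<in> A m"
| A_SC: "x \<in> A m \<Longrightarrow> SC a * x \<in> A m"

lemma A_uminus: "x \<in> A m \<Longrightarrow> - x \<in> A m"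
proof -
  assume "x \<in> A m"
  moreover have "SC (-1) = - 1"
    using SC_add[of 1 "-1"] by (simp add: SC_0 SC_1 eq_neg_iff_add_eq_0 add.commute)
  ultimately show ?thesis using A_SC[of x m "-1"] by simp
qed

lemma A_diff: "\<lbrakk>x \<in> A m; y \<in> A m\<rbrakk> \<Longrightarrow> x - y \<in> A m"
  using A_add[OF _ A_uminus, of x m y] by simp

lemma A_mono: "\<lbrakk>x \<in> A m; m \<le> n\<rbrakk> \<Longrightarrow> x \<in> A n"
  by (induction rule: A.induct) (auto intro: A.intros)

lemma A_unit: "\<lbrakk>x \<in> A m; m \<le> N\<rbrakk> \<Longrightarrow> e * x = x \<and> x * e = x"
proof (induction rule: A.induct)
  case (A_mult x y)
  then show ?case by (metis mult.assoc)
next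
  case (A_SC x a)
  then show ?case by (metis mult.assoc SC_e)
qed (auto simp: ee eT Te eC Ce distrib_left distrib_right)

lemma A_SC_comm: "\<lbrakk>x \<in> A m; m \<le> N\<rbrakk> \<Longrightarrow> x * SC a = SC a * x"
proof (induction rule: A.induct)
  case (A_mult x y)
  then show ?case by (metis mult.assoc)
next
  case (A_SC x b)
  then show ?case by (metis mult.assoc SC_comm)
qed (auto simp: SC_e SC_T SC_C distrib_left distrib_right)

lemma A_comm:
  assumes "x \<in> A m" "m \<le> N" "e * z = z * e" "\<And>a. SC a * z = z * SC a"
    "\<And>i. \<lbrakk>0 < i; i < m\<rbrakk> \<Longrightarrow> T i * z = z * T i" "\<And>i. \<lbrakk>0 < i; i \<le> m\<rbrakk> \<Longrightarrow> C i * z = z * C i"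
  shows "x * z = z * x"
  using assms(1)
proof (induction rule: A.induct)
  case (A_mult x y)
  then show ?case by (metis mult.assoc)
next
  case (A_SC x b)
  then show ?case by (metis mult.assoc assms(4))
qed (auto simp: assms distrib_left distrib_right)

definition "Ti i = T i - eps * e"

lemma T_Ti: "\<lbrakk>0 < i; i < N\<rbrakk> \<Longrightarrow> T i * Ti i = e" "\<lbrakk>0 < i; i < N\<rbrakk> \<Longrightarrow> Ti i * T i = e"
proof -
  assume i: "0 < i" "i < N"
  have "T i * (eps * e) = eps * T i"
    by (metis SC_T Te i mult.assoc)
  then show "T i * Ti i = e" using TT[OF i] by (simp add: Ti_def right_diff_distrib)
  show "Ti i * T i = e" using TT[OF i] by (simp add: Ti_def left_diff_distrib i mult.assoc eT)
qed

text \<open>The value at 0 is a filler, so that the recursion proper starts at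
  \<open>D 1 = C 1\<close>.\<close>

primrec D :: "nat \<Rightarrow> 'e" where
  "D 0 = C 1"
| "D (Suc m) = (if m = 0 then C 1 else Ti m * D m * T m)"

lemma D_Suc: "0 < m \<Longrightarrow> D (Suc m) = Ti m * D m * T m"
  by simp

declare D.simps(2)[simp del]
lemma D_1: "D (Suc 0) = C 1" by (simp add: D.simps)

lemma Ti_A: "\<lbrakk>0 < i; i < m\<rbrakk> \<Longrightarrow> Ti i \<in> A m"
  by (auto simp: Ti_def intro: A.intros A_diff)

lemma D_A: "0 < m \<Longrightarrow> D m \<in> A m"
proof (induction m rule: nat_induct_non_zero)
  case 1
  then show ?case using A_C[of 1 1] D_1 by simp
next
  case (Suc n)
  then show ?case using A_mono[of "D n" n "Suc n"] by (auto simp: D_Suc intro!: A_mult Ti_A A_T)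
qed

lemma Ti_comm: assumes "T i * z = z * T i" "e * z = z * e" "SC (q - inverse q) * z = z * SC (q - inverse q)"
  shows "Ti i * z = z * Ti i"
  using assms by (simp add: Ti_def algebra_simps) (metis mult.assoc)

lemma DD: "\<lbrakk>0 < m; m \<le> N\<rbrakk> \<Longrightarrow> D m * D m = e"
proof (induction m rule: nat_induct_non_zero)
  case 1
  then show ?case using CC[of 1] D_1 by simp
next
  case (Suc n)
  have "D (Suc n) * D (Suc n) = Ti n * (D n * (T n * Ti n) * D n) * T n"
    using Suc by (simp add: D_Suc mult.assoc)
  also have "\<dots> = e"
    using Suc A_unit[OF D_A[of n]] by (simp add: T_Ti eT mult.assoc)
  finally show ?case .
qed

text \<open>The purpose of the inverse in the definition of \<open>D\<close>: moving
  \<open>T m\<close> from left to right lowers the index of \<open>D\<close> with no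
  \<open>eps\<close>-term. For \<open>C\<close> the exact passage \<open>TC\<close> raises the index
  instead.\<close>

lemma T_D: "\<lbrakk>0 < m; m < N\<rbrakk> \<Longrightarrow> T m * D (Suc m) = D m * T m"
  using A_unit[OF D_A[of m]] by (simp add: D_Suc mult.assoc[symmetric] T_Ti)

lemma T_D': assumes m: "0 < m" "m < N"
  shows "T m * D m = D (Suc m) * T m + eps * (D m - D (Suc m))"
proof -
  have u: "e * D m = D m" "D m * e = D m" "D m * eps = eps * D m" "D m * (eps * x) = eps * (D m * x)" for x
    using A_unit[OF D_A[of m]] A_SC_comm[OF D_A[of m]] m by (auto simp: mult.assoc[symmetric])
  have u': "T m * eps = eps * T m" "T m * (eps * x) = eps * (T m * x)" "e * eps = eps * e" for x
    using SC_T[of m] m SC_e by (auto simp: mult.assoc[symmetric])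
  show ?thesis
    using m by (simp add: D_Suc Ti_def algebra_simps u u' TT Te eT)
qed

lemma D_T_later: "\<lbrakk>0 < m; m < j; j < N\<rbrakk> \<Longrightarrow> T j * D m = D m * T j"
proof (induction m rule: nat_induct_non_zero)
  case 1
  then show ?case using D_1 TC_far[of j 1] by simp
next
  case (Suc n)
  have 1: "T j * T n = T n * T j" using T_far[of n j] Suc by simp
  have 2: "T j * Ti n = Ti n * T j"
    using Ti_comm[of n "T j"] 1 SC_T[of j] eT[of j] Te[of j] Suc by simp
  have 3: "T j * D n = D n * T j" using Suc by simp
  show ?case using commute_mult[OF commute_mult[OF 2 3] 1] Suc(1) by (simp add: D_Suc)
qed

lemma D_C_later: "\<lbrakk>0 < m; m < j; j \<le> N\<rbrakk> \<Longrightarrow> C j * D m = - (D m * C j)"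
proof (induction m rule: nat_induct_non_zero)
  case 1
  then show ?case using D_1 C_anti[of j 1] by simp
next
  case (Suc n)
  have 1: "C j * T n = T n * C j" using TC_far[of n j] Suc by simp
  have 2: "C j * Ti n = Ti n * C j"
    using Ti_comm[of n "C j"] 1 SC_C[of j] eC[of j] Ce[of j] Suc by simp
  have IH: "C j * D n = - (D n * C j)" using Suc by simp
  have "C j * D (Suc n) = Ti n * (C j * D n) * T n"
    using Suc(1) by (simp add: D_Suc 2 mult.assoc[symmetric])
  also have "\<dots> = - (Ti n * D n * (C j * T n))" by (simp add: IH mult.assoc)
  also have "\<dots> = - (D (Suc n) * C j)" using Suc(1) by (simp add: D_Suc 1 mult.assoc)
  finally show ?case .
qed

lemma D_T: "\<lbrakk>0 < m; m \<le> N; 0 < j; Suc j < m\<rbrakk> \<Longrightarrow> T j * D m = D m * T j"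
proof (induction m arbitrary: j rule: nat_induct_non_zero)
  case 1
  then show ?case by simp
next
  case (Suc n)
  show ?case
  proof (cases "Suc j < n")
    case True
    have 1: "T j * T n = T n * T j" using T_far[of j n] Suc True by simp
    have 2: "T j * Ti n = Ti n * T j"
      using Ti_comm[of n "T j"] 1 SC_T[of j] eT[of j] Te[of j] Suc by simp
    have "T j * D n = D n * T j" using Suc True by simp
    from commute_mult[OF commute_mult[OF 2 this] 1] Suc(1) show ?thesis by (simp add: D_Suc)
  next
    case False
    then have n: "n = Suc j" using Suc by simp
    have j: "0 < j" "Suc j < N" using Suc n by auto
    have br: "T j * T (Suc j) * T j = T (Suc j) * T j * T (Suc j)" using braid[of j] j by simp
    have comm: "T (Suc j) * D j = D j * T (Suc j)" using D_T_later[of j "Suc j"] j by simp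
    note u = T_Ti[of j] T_Ti[of "Suc j"] eT[of j] eT[of "Suc j"] Te[of j] Te[of "Suc j"]
    have uTi: "e * Ti j = Ti j" "Ti j * e = Ti j" "e * Ti (Suc j) = Ti (Suc j)" "Ti (Suc j) * e = Ti (Suc j)"
      using A_unit[OF Ti_A[of j N]] A_unit[OF Ti_A[of "Suc j" N]] j by auto
    \<comment> \<open>At the critical index \<open>n = Suc j\<close> the braid relation is needed in
      this inverted form: \<open>T j\<close> passes the two inverses as \<open>T (Suc j)\<close>,
      commutes with \<open>D j\<close>, and is turned back into \<open>T j\<close> by the braid
      relation on the right.\<close>
    have inv: "T j * Ti (Suc j) * Ti j = Ti (Suc j) * Ti j * T (Suc j)"
    proof -
      have "T j * (T (Suc j) * (T j * (Ti (Suc j) * Ti j))) = T j * T (Suc j) * T j * Ti (Suc j) * Ti j"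
        by (simp add: mult.assoc)
      also have "\<dots> = T (Suc j) * T j * (T (Suc j) * Ti (Suc j)) * Ti j"
        unfolding br by (simp add: mult.assoc)
      finally have a: "T j * (T (Suc j) * (T j * (Ti (Suc j) * Ti j))) = T (Suc j)"
        using u j by (simp add: mult.assoc uTi)
      have "T j * Ti (Suc j) * Ti j = Ti (Suc j) * Ti j * (T j * (T (Suc j) * (T j * (Ti (Suc j) * Ti j))))"
      proof -
        have "Ti (Suc j) * Ti j * (T j * (T (Suc j) * (T j * (Ti (Suc j) * Ti j)))) =
          Ti (Suc j) * (Ti j * T j) * (T (Suc j) * (T j * (Ti (Suc j) * Ti j)))" by (simp add: mult.assoc)
        also have "\<dots> = (Ti (Suc j) * T (Suc j)) * (T j * (Ti (Suc j) * Ti j))"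
          using u j by (simp add: uTi mult.assoc mult_left_absorb[OF T_Ti(2)])
        also have "\<dots> = T j * Ti (Suc j) * Ti j" using u j by (simp add: mult.assoc[symmetric])
        finally show ?thesis by simp
      qed
      then show ?thesis unfolding a .
    qed
    have Dn: "D (Suc n) = Ti (Suc j) * Ti j * D j * T j * T (Suc j)"
      using j by (simp add: n D_Suc mult.assoc)
    have "T j * D (Suc n) = (T j * Ti (Suc j) * Ti j) * D j * T j * T (Suc j)"
      by (simp add: Dn mult.assoc)
    also have "\<dots> = Ti (Suc j) * Ti j * (T (Suc j) * D j) * T j * T (Suc j)"
      unfolding inv by (simp add: mult.assoc)
    also have "\<dots> = Ti (Suc j) * Ti j * D j * (T (Suc j) * T j * T (Suc j))"
      unfolding comm by (simp add: mult.assoc)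
    also have "\<dots> = D (Suc n) * T j"
      unfolding br[symmetric] by (simp add: Dn mult.assoc)
    finally show ?thesis .
  qed
qed

lemma C_Ti: assumes "0 < i" "i < N" shows "C i * Ti i = Ti i * C (Suc i)"
proof -
  have u: "C (Suc i) * eps = eps * C (Suc i)" "C i * eps = eps * C i" "C i * (eps * x) = eps * (C i * x)" for x
    using SC_C[of "Suc i" "q - inverse q"] SC_C[of i "q - inverse q"] assms by (auto simp: mult.assoc[symmetric])
  show ?thesis using TC'[of i] assms u
    by (simp add: Ti_def algebra_simps eC Ce)
qed

lemma D_C: "\<lbrakk>0 < m; m \<le> N; 0 < j; j < m\<rbrakk> \<Longrightarrow> C j * D m = - (D m * C j)"
proof (induction m arbitrary: j rule: nat_induct_non_zero)
  case 1
  then show ?case by simp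
next
  case (Suc n)
  show ?case
  proof (cases "j = n")
    case True
    have "C n * D (Suc n) = Ti n * (C (Suc n) * D n) * T n"
      using Suc C_Ti[of n] by (simp add: D_Suc mult.assoc[symmetric])
    also have "\<dots> = - (Ti n * D n * (C (Suc n) * T n))"
      using D_C_later[of n "Suc n"] Suc by (simp add: mult.assoc)
    also have "C (Suc n) * T n = T n * C n" using TC[of n] Suc by simp
    finally show ?thesis using Suc True by (simp add: D_Suc mult.assoc)
  next
    case False
    have 1: "C j * T n = T n * C j" using TC_far[of n j] Suc False by simp
    have 2: "C j * Ti n = Ti n * C j"
      using Ti_comm[of n "C j"] 1 SC_C[of j] eC[of j] Ce[of j] Suc by simp
    have IH: "C j * D n = - (D n * C j)" using Suc False by simp
    have "C j * D (Suc n) = Ti n * (C j * D n) * T n"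
      using Suc(1) by (simp add: D_Suc 2 mult.assoc[symmetric])
    also have "\<dots> = - (Ti n * D n * (C j * T n))" by (simp add: IH mult.assoc)
    also have "\<dots> = - (D (Suc n) * C j)" using Suc(1) by (simp add: D_Suc 1 mult.assoc)
    finally show ?thesis .
  qed
qed

text \<open>Conjugation lowers the smaller index to 1, where \<open>D 1 = C 1\<close> and
  \<open>D_C\<close> applies; the larger \<open>D m\<close> commutes with every \<open>T\<close>
  used on the way.\<close>

lemma D_D: "\<lbrakk>0 < j; j < m; m \<le> N\<rbrakk> \<Longrightarrow> D j * D m = - (D m * D j)"
proof (induction j rule: nat_induct_non_zero)
  case 1
  then show ?case using D_C[of m 1] D_1 by simp
next
  case (Suc n)
  have 1: "D m * T n = T n * D m" using D_T[of m n] Suc by simp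
  have 2: "Ti n * D m = D m * Ti n"
    using Ti_comm[of n "D m"] 1 A_SC_comm[OF D_A[of m]] A_unit[OF D_A[of m]] Suc by simp
  have IH: "D n * D m = - (D m * D n)" using Suc by simp
  have "D (Suc n) * D m = Ti n * (D n * D m) * T n"
    using Suc(1) by (simp add: D_Suc 1 mult.assoc)
  also have "\<dots> = - ((Ti n * D m) * D n * T n)" by (simp add: IH mult.assoc)
  also have "\<dots> = - (D m * D (Suc n))" using Suc(1) by (simp add: D_Suc 2 mult.assoc)
  finally show ?case by simp
qed

section \<open>The elements \<open>y m\<close> and what they commute with\<close>

definition "y m = C m * D m + D m * C m"

lemma y_A: "0 < m \<Longrightarrow> y m \<in> A m"
  by (auto simp: y_def intro: A_add A_mult A_C D_A)

lemma y_C: "\<lbrakk>0 < m; m \<le> N; 0 < j; j \<le> N\<rbrakk> \<Longrightarrow> C j * y m = y m * C j"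
proof -
  assume a: "0 < m" "m \<le> N" "0 < j" "j \<le> N"
  show ?thesis
  proof (cases "j = m")
    case True
    then show ?thesis using A_unit[OF D_A[of m]] a
      by (simp add: y_def algebra_simps CC) (simp add: CC mult.assoc[symmetric])
  next
    case False
    have 1: "C j * C m = - (C m * C j)" using C_anti[of j m] a False by simp
    have 2: "C j * D m = - (D m * C j)" using D_C[of m j] D_C_later[of m j] a False by (cases "j < m") auto
    show ?thesis using commute_mult_of_anticommute[OF 1 2] commute_mult_of_anticommute[OF 2 1] by (simp add: y_def distrib_left distrib_right)
  qed
qed

lemma y_D: "\<lbrakk>0 < m; m \<le> N\<rbrakk> \<Longrightarrow> D m * y m = y m * D m"
  using A_unit[OF A_C[of m m]]
  by (simp add: y_def algebra_simps DD) (simp add: DD mult.assoc[symmetric])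

lemma y_T: "\<lbrakk>0 < m; m \<le> N; 0 < j; j < N; m \<noteq> j; m \<noteq> Suc j\<rbrakk> \<Longrightarrow> T j * y m = y m * T j"
proof -
  assume a: "0 < m" "m \<le> N" "0 < j" "j < N" "m \<noteq> j" "m \<noteq> Suc j"
  have 1: "T j * C m = C m * T j" using TC_far[of j m] a by simp
  have 2: "T j * D m = D m * T j" using D_T[of m j] D_T_later[of m j] a by (cases "j < m") auto
  show ?thesis using commute_mult[OF 1 2] commute_mult[OF 2 1] by (simp add: y_def distrib_left distrib_right)
qed

section \<open>Relative Casimir sums\<close>

primrec Q :: "nat \<Rightarrow> 'e \<Rightarrow> 'e" where
  "Q 0 z = 0"
| "Q (Suc m) z = z + Q m (T m * z * T m)"

lemma Q_add: "Q m (x + z) = Q m x + Q m z"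
  by (induction m arbitrary: x z) (simp_all add: algebra_simps)

lemma Q_uminus: "Q m (- z) = - Q m z"
  by (induction m arbitrary: z) (simp_all add: algebra_simps)

lemma Q_diff: "Q m (x - z) = Q m x - Q m z"
  using Q_add[of m x "- z"] by (simp add: Q_uminus)

lemma Q_left: "(\<And>i. \<lbrakk>0 < i; i < m\<rbrakk> \<Longrightarrow> T i * x = x * T i) \<Longrightarrow> Q m (x * z) = x * Q m z"
proof (induction m arbitrary: z)
  case (Suc m)
  show ?case
  proof (cases "m = 0")
    case False
    then have "T m * (x * z) * T m = x * (T m * z * T m)"
      using Suc.prems[of m] by (simp add: mult.assoc[symmetric])
    then show ?thesis using Suc by (simp add: distrib_left)
  qed simp
qed simp

lemma Q_right: "(\<And>i. \<lbrakk>0 < i; i < m\<rbrakk> \<Longrightarrow> T i * x = x * T i) \<Longrightarrow> Q m (z * x) = Q m z * x"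
proof (induction m arbitrary: z)
  case (Suc m)
  show ?case
  proof (cases "m = 0")
    case False
    then have "T m * (z * x) * T m = (T m * z * T m) * x"
      using Suc.prems[of m] by (simp add: mult.assoc)
    then show ?thesis using Suc by (simp add: distrib_right)
  qed simp
qed simp

lemma Q_A: "z \<in> A m \<Longrightarrow> 0 < m \<Longrightarrow> Q m z \<in> A m"
proof -
  have "k \<le> m \<Longrightarrow> 0 < k \<Longrightarrow> z \<in> A m \<Longrightarrow> Q k z \<in> A m" for k
  proof (induction k arbitrary: z)
    case (Suc k)
    show ?case
    proof (cases "k = 0")
      case False
      then have "T k * z * T k \<in> A m" using Suc.prems by (simp add: A_mult A_T)
      then show ?thesis using Suc False by (simp add: A_add)
    qed (use Suc in simp)
  qed simp
  then show "z \<in> A m \<Longrightarrow> 0 < m \<Longrightarrow> Q m z \<in> A m" by simp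
qed

text \<open>In the step to \<open>Suc m\<close> only \<open>i = m\<close> is not settled by
  induction. There \<open>z + T m * z * T m\<close> commutes with \<open>T m\<close> by the
  quadratic relation, and the remaining summands are built from \<open>z2\<close>, a double
  conjugate of \<open>z\<close>, which commutes with \<open>T m\<close> by the braid
  relation.\<close>

lemma T_Q:
  assumes "m \<le> N" "e * z = z" "z * e = z" "eps * z = z * eps"
    "\<And>i. \<lbrakk>0 < i; Suc i < m\<rbrakk> \<Longrightarrow> T i * z = z * T i"
  shows "\<lbrakk>0 < i; i < m\<rbrakk> \<Longrightarrow> T i * Q m z = Q m z * T i"
  using assms
proof (induction m arbitrary: z i)
  case (Suc m)
  note m = Suc.prems
  show ?case
  proof (cases "m = 0")
    case True
    then show ?thesis using m by simp
  next
    case False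
    then have m0: "0 < m" "m < N" using m by auto
    define z' where "z' = T m * z * T m"
    have z': "e * z' = z'" "z' * e = z'"
      using eT[OF m0] Te[OF m0] by (simp_all add: z'_def mult.assoc[symmetric]) (simp add: mult.assoc)
    have z'': "eps * z' = z' * eps"
      unfolding z'_def using SC_T[OF m0] m(6) by (intro commute_mult) auto
    have z3: "T k * z' = z' * T k" if "0 < k" "Suc k < m" for k
    proof -
      have "T k * T m = T m * T k" using T_far[of k m] that m0 by simp
      moreover have "T k * z = z * T k" using m(7)[of k] that by simp
      ultimately show ?thesis unfolding z'_def by (intro commute_mult) auto
    qed
    show ?thesis
    proof (cases "i = m")
      case False
      then have "T i * Q m z' = Q m z' * T i"
        using Suc.IH[of i z'] m m0 z' z'' z3 by simp
      moreover have "T i * z = z * T i" using m(7)[of i] m False by simp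
      ultimately show ?thesis by (simp add: z'_def distrib_left distrib_right)
    next
      case True
      have TTz: "T m * (T m * x) = eps * (T m * x) + e * x" for x
        using mult_left_absorb[OF TT[OF m0], of x] by (simp add: distrib_right mult.assoc)
      have ze: "z * (eps * T m) = eps * (z * T m)" "T m * (eps * x) = eps * (T m * x)" for x
        using mult_left_absorb[OF m(6)[symmetric]] mult_left_absorb[OF SC_T[OF m0, of "q - inverse q", symmetric]]
        by (simp_all add: mult.assoc)
      have a: "T m * (z + z') = (z + z') * T m"
        using m(4,5) by (simp add: z'_def distrib_left distrib_right mult.assoc TTz TT[OF m0] ze)
           (simp add: mult.assoc[symmetric])
      show ?thesis
      proof (cases m)
        case 0 then show ?thesis using m0 by simp
      next
        case (Suc k)
        show ?thesis
        proof (cases "k = 0")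
          case True
          then show ?thesis using a Suc \<open>i = m\<close> by (simp add: z'_def)
        next
          case False
          then have k: "0 < k" "Suc k < N" using m0 Suc by auto
          define z2 where "z2 = T k * z' * T k"
          have kz: "T k * z = z * T k" using m(7)[of k] k Suc by simp
          have "T m * z2 = (T (Suc k) * T k * T (Suc k)) * z * (T (Suc k) * T k)"
            by (simp add: z2_def z'_def Suc mult.assoc)
          also have "\<dots> = T k * T (Suc k) * (T k * z) * (T (Suc k) * T k)"
            unfolding braid[OF k, symmetric] by (simp add: mult.assoc)
          also have "\<dots> = T k * T (Suc k) * z * (T k * T (Suc k) * T k)"
            using kz by (simp add: mult.assoc)
          also have "\<dots> = z2 * T m"
            unfolding braid[OF k] by (simp add: z2_def z'_def Suc mult.assoc)
          finally have b: "T m * z2 = z2 * T m" .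
          have c: "T m * Q k z2 = Q k z2 * T m"
          proof -
            have "T j * T m = T m * T j" if "0 < j" "j < k" for j
              using T_far[of j m] that Suc m0 by simp
            then show ?thesis using Q_left[of k "T m" z2] Q_right[of k "T m" z2] b by simp
          qed
          have "Q (Suc m) z = (z + z') + Q k z2" by (simp add: Suc z'_def z2_def)
          with a c show ?thesis using \<open>i = m\<close> by (simp add: distrib_left distrib_right)
        qed
      qed
    qed
  qed
qed simp

text \<open>The twisted relation descends through each conjugation and becomes commutation with
  \<open>C 1\<close> at the bottom. The last hypothesis takes care of the top summand, for which
  \<open>C 1\<close> is a generator of lower level unless \<open>m = 1\<close>.\<close>

lemma C1_Q:
  assumes "0 < m" "m \<le> N" "z * C m = D m * z" "1 < m \<Longrightarrow> z * C 1 = C 1 * z"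
  shows "Q m z * C 1 = C 1 * Q m z"
  using assms
proof (induction m arbitrary: z rule: nat_induct_non_zero)
  case 1
  then show ?case by (simp add: D_1)
next
  case (Suc m)
  define w where "w = T m * z * T m"
  have w: "w * C m = D m * w"
  proof -
    have "w * C m = T m * (z * C (Suc m)) * T m" using TC[of m] Suc(1,3) by (simp add: w_def mult.assoc)
    also have "\<dots> = T m * (D (Suc m) * z) * T m" using Suc by simp
    also have "\<dots> = (T m * D (Suc m)) * z * T m" using Suc by (simp add: mult.assoc)
    also have "\<dots> = D m * w" using T_D[of m] Suc by (simp add: w_def mult.assoc)
    finally show ?thesis .
  qed
  have z1: "z * C 1 = C 1 * z" using Suc by simp
  have "w * C 1 = C 1 * w" if "1 < m"
  proof -
    have "T m * C 1 = C 1 * T m" using TC_far[of m 1] that Suc by simp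
    then have "C 1 * w = w * C 1" unfolding w_def using z1 by (intro commute_mult) simp_all
    then show ?thesis by simp
  qed
  with w have "Q m w * C 1 = C 1 * Q m w" using Suc by simp
  with z1 show ?case by (simp add: w_def[symmetric] distrib_left distrib_right)
qed

lemma Casimir:
  assumes m: "0 < m" "m \<le> N" and z: "e * z = z" "z * e = z" "\<And>a. SC a * z = z * SC a"
    "\<And>i. \<lbrakk>0 < i; Suc i < m\<rbrakk> \<Longrightarrow> T i * z = z * T i"
    "\<And>i. \<lbrakk>0 < i; i < m\<rbrakk> \<Longrightarrow> C i * z = z * C i" "z * C m = D m * z" and x: "x \<in> A m"
  shows "x * Q m z = Q m z * x" "e * Q m z = Q m z" "Q m z * e = Q m z" "SC a * Q m z = Q m z * SC a"
proof -
  have gen: "e * Q k z = Q k z \<and> Q k z * e = Q k z \<and> (\<forall>a. SC a * Q k z = Q k z * SC a)"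
    if "k \<le> m" "e * z = z" "z * e = z" "\<forall>a. SC a * z = z * SC a" for k z
    using that
  proof (induction k arbitrary: z)
    case (Suc k)
    show ?case
    proof (cases "k = 0")
      case False
      then have k: "0 < k" "k < N" using Suc m by auto
      define w where "w = T k * z * T k"
      have "e * w = w" "w * e = w" unfolding w_def
        using eT[OF k] Te[OF k] by (simp add: mult.assoc[symmetric], simp add: mult.assoc)
      moreover have "\<forall>a. SC a * w = w * SC a"
        unfolding w_def using SC_T[OF k] Suc.prems(4) by (intro allI commute_mult) auto
      ultimately have "e * Q k w = Q k w \<and> Q k w * e = Q k w \<and> (\<forall>a. SC a * Q k w = Q k w * SC a)"
        using Suc by simp
      then show ?thesis using Suc.prems by (simp add: w_def[symmetric] distrib_left distrib_right)
    qed (use Suc in simp)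
  qed simp
  show e: "e * Q m z = Q m z" "Q m z * e = Q m z" and s: "SC a * Q m z = Q m z * SC a" for a
    using gen[of m z] z by auto
  have T: "T i * Q m z = Q m z * T i" if "0 < i" "i < m" for i
    using T_Q[of m z i] m z that by simp
  have C1: "C 1 * Q m z = Q m z * C 1"
    using C1_Q[of m z] m z(5)[of 1] z(6) by simp
  have C: "C i * Q m z = Q m z * C i" if "0 < i" "i \<le> m" for i
    using that
  proof (induction i rule: nat_induct_non_zero)
    case 1 then show ?case using C1 by simp
  next
    case (Suc i)
    then have i: "0 < i" "i < N" "i < m" using m by auto
    \<comment> \<open>Every \<open>C i\<close> arises from \<open>C 1\<close> by conjugation with
      the \<open>T i\<close>, so \<open>C 1\<close> is the only Clifford generator to be
      checked.\<close>
    have CS: "C (Suc i) = T i * C i * Ti i"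
      using TC[of i] i A_unit[OF A_C[of "Suc i" N]] by (simp add: mult.assoc T_Ti)
    have "Ti i * Q m z = Q m z * Ti i" using Ti_comm[of i "Q m z"] T[of i] i e s by simp
    moreover have "C i * Q m z = Q m z * C i" using Suc i by simp
    ultimately show ?case unfolding CS using T[of i] i
      by (intro commute_mult[symmetric] commute_mult) (simp_all)
  qed
  show "x * Q m z = Q m z * x"
    by (rule A_comm[OF x m(2)]) (use e s T C in auto)
qed

text \<open>The braid relation turns the once conjugated seed of level \<open>m + 1\<close> into the
  seed of level \<open>m\<close> conjugated by \<open>T (Suc m)\<close>, so the sum telescopes. In
  the trace formula this evaluates the sum called \<open>Q' t\<close>.\<close>

lemma D_Q: "\<lbrakk>0 < m; m < N\<rbrakk> \<Longrightarrow> eps * Q m ((C (Suc m) - D m) * T m) = D (Suc m) - C (Suc m)"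
proof (induction m rule: nat_induct_non_zero)
  case 1
  define t c d where "t = T 1" and "c = C 1" and "d = C 2"
  have "t * c * t = d * (eps * t + e)"
    using TC[of 1] TT[of 1] 1 by (simp add: t_def c_def d_def numeral_2_eq_2 mult.assoc)
  also have "\<dots> = eps * (d * t) + d"
    using SC_C[of 2 "q - inverse q"] Ce[of 2] 1 by (simp add: d_def distrib_left mult.assoc[symmetric])
  finally have tct: "t * c * t = eps * (d * t) + d" .
  have "D 2 = (t - eps * e) * c * t" by (simp add: numeral_2_eq_2 D_Suc D_1 Ti_def t_def c_def)
  also have "\<dots> = t * c * t - eps * (c * t)"
    using mult_left_absorb[OF eC[of 1]] 1 by (simp add: left_diff_distrib mult.assoc c_def)
  finally have "D 2 - d = eps * ((d - c) * t)"
    unfolding tct by (simp add: left_diff_distrib right_diff_distrib)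
  then show ?case by (simp add: D_1 numeral_2_eq_2 t_def c_def d_def)
next
  case (Suc m)
  then have m: "0 < m" "m < N" "0 < Suc m" "Suc m < N" "0 < Suc (Suc m)" by auto
  define t c d Dm Dn where "t = T (Suc m)" and "c = C (Suc m)" and "d = C (Suc (Suc m))"
    and "Dm = D m" and "Dn = D (Suc m)"
  have IH: "eps * Q m ((c - Dm) * T m) = Dn - c" using Suc m by (simp add: c_def Dm_def Dn_def)
  have far: "T i * t = t * T i" if "0 < i" "i < m" for i using T_far[of i "Suc m"] that m by (simp add: t_def)
  have br: "T m * t * T m = t * T m * t" using braid[of m] m by (simp add: t_def)
  have tc: "t * c = d * t" using TC[of "Suc m"] m by (simp add: t_def c_def d_def)
  have tD: "t * Dm = Dm * t" using D_T_later[of m "Suc m"] m by (simp add: t_def Dm_def)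
  have Td: "T m * d = d * T m" using TC_far[of m "Suc (Suc m)"] m by (simp add: d_def)
  have TDn: "T m * Dn = Dm * T m" using T_D[of m] m by (simp add: Dm_def Dn_def)
  have "T m * ((d - Dn) * t) * T m = (d - Dm) * (T m * t * T m)"
    by (simp add: left_diff_distrib right_diff_distrib mult.assoc[symmetric] Td TDn)
  also have "\<dots> = t * ((c - Dm) * T m) * t"
    unfolding br by (simp add: left_diff_distrib right_diff_distrib mult.assoc[symmetric] tc tD)
  finally have "eps * Q (Suc m) ((d - Dn) * t) = eps * ((d - Dn) * t) + eps * (t * Q m ((c - Dm) * T m) * t)"
    by (simp add: distrib_left Q_left[OF far] Q_right[OF far])
  also have "eps * (t * Q m ((c - Dm) * T m) * t) = t * (Dn - c) * t"
    unfolding IH[symmetric] using mult_left_absorb[OF SC_T[of "Suc m" "q - inverse q"]] m by (simp add: t_def mult.assoc)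
  also have "t * (Dn - c) * t = D (Suc (Suc m)) + eps * (Dn * t) - (eps * (d * t) + d)"
  proof -
    have "t * c * t = eps * (d * t) + d"
    proof -
      have "t * c * t = d * (eps * t + e)" using tc TT[of "Suc m"] m by (simp add: t_def mult.assoc)
      also have "\<dots> = eps * (d * t) + d"
        using SC_C[of "Suc (Suc m)" "q - inverse q"] Ce[of "Suc (Suc m)"] m
        by (simp add: d_def distrib_left mult.assoc[symmetric])
      finally show ?thesis .
    qed
    moreover have "t * Dn * t = D (Suc (Suc m)) + eps * (Dn * t)"
    proof -
      have "D (Suc (Suc m)) = (t - eps * e) * Dn * t"
        using m by (simp add: D_Suc t_def Dn_def Ti_def)
      also have "\<dots> = t * Dn * t - eps * (Dn * t)"
        using A_unit[OF D_A[of "Suc m"]] m by (simp add: left_diff_distrib mult.assoc[symmetric] Dn_def) (simp add: mult.assoc)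
      finally show ?thesis by simp
    qed
    ultimately show ?thesis by (simp add: left_diff_distrib right_diff_distrib)
  qed
  finally show ?case unfolding t_def[symmetric] d_def[symmetric] Dn_def[symmetric]
    by (simp add: algebra_simps)
qed

end

section \<open>The trace formula\<close>

text \<open>The resolvents are taken as data, which keeps the trace formula purely algebraic;
  \<open>good_resolvent\<close> supplies them later. Membership of \<open>R k\<close> in
  \<open>A k\<close> lets it inherit the commutation relations of \<open>y k\<close>.\<close>

locale hc_resolvent = hc_rep SC e T C q N
  for SC :: "'a::field \<Rightarrow> 'e::ring_1" and e T C q N +
  fixes s :: 'a and R :: "nat \<Rightarrow> 'e"
  assumes R_A: "\<lbrakk>0 < k; k \<le> N\<rbrakk> \<Longrightarrow> R k \<in> A k"
    and R_inv: "\<lbrakk>0 < k; k \<le> N\<rbrakk> \<Longrightarrow> (SC s * e - y k) * R k = e"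
      "\<lbrakk>0 < k; k \<le> N\<rbrakk> \<Longrightarrow> R k * (SC s * e - y k) = e"
begin

lemma R_comm:
  assumes k: "0 < k" "k \<le> N" and x: "x \<in> A N" "x * y k = y k * x"
  shows "x * R k = R k * x"
proof -
  let ?z = "SC s * e - y k"
  have "x * ?z = ?z * x"
    using x(2) A_unit[OF x(1)] A_SC_comm[OF x(1)] mult_left_absorb[OF A_SC_comm[OF x(1)]]
    by (simp add: left_diff_distrib right_diff_distrib mult.assoc)
  have "e * x = x" "x * e = x" using A_unit[OF x(1)] by auto
  have "R k * x = R k * x * (?z * R k)"
    using R_inv[OF k] \<open>x * e = x\<close> by (simp add: mult.assoc)
  also have "\<dots> = (R k * ?z) * x * R k"
    using \<open>x * ?z = ?z * x\<close> by (metis mult.assoc)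
  finally show ?thesis using R_inv[OF k] \<open>e * x = x\<close> by simp
qed

lemma hc_step:
  assumes m: "0 < m" "Suc m \<le> N"
  shows "hc_step e eps (SC s) (T m) (C m) (C (Suc m)) (D m) (D (Suc m)) (R m) (R (Suc m))"
proof -
  have inN: "e \<in> A N" "T m \<in> A N" "C m \<in> A N" "C (Suc m) \<in> A N" "D m \<in> A N" "D (Suc m) \<in> A N"
     "R m \<in> A N" "R (Suc m) \<in> A N" "y m \<in> A N" "y (Suc m) \<in> A N"
    using m by (auto intro: A_e A_T A_C intro!: A_mono[OF D_A] A_mono[OF R_A] A_mono[OF y_A])
  have DyS: "D m * y (Suc m) = y (Suc m) * D m"
    by (rule A_comm[OF D_A[of m]])
      (use m inN A_unit A_SC_comm in \<open>auto intro!: y_C y_T\<close>)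
  have yy: "y m * y (Suc m) = y (Suc m) * y m"
    by (rule A_comm[OF y_A[of m]])
      (use m inN A_unit A_SC_comm in \<open>auto intro!: y_C y_T\<close>)
  have DSy: "D (Suc m) * y m = y m * D (Suc m)"
    using commute_mult_of_anticommute[of "D (Suc m)" "C m" "D m"] commute_mult_of_anticommute[of "D (Suc m)" "D m" "C m"] D_C[of "Suc m" m] D_D[of m "Suc m"] m
    by (simp add: y_def distrib_left distrib_right)
  show ?thesis
  proof
    fix x assume x: "x \<in> {e, T m, C m, C (Suc m), D m, D (Suc m), R m, R (Suc m)}"
    then have "x \<in> A N" using inN by auto
    then show "e * x = x" "x * e = x" "x * eps = eps * x" "x * SC s = SC s * x"
      using A_unit A_SC_comm by auto
  next
    show "SC s * eps = eps * SC s" by (rule SC_comm)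
    show "T m * T m = eps * T m + e" using TT[of m] m by simp
    show "C m * C m = e" "C (Suc m) * C (Suc m) = e" "D m * D m = e" "D (Suc m) * D (Suc m) = e"
      using CC DD m by auto
    show "C (Suc m) * C m = - (C m * C (Suc m))" using C_anti[of "Suc m" m] m by simp
    show "C (Suc m) * D m = - (D m * C (Suc m))" using D_C_later[of m "Suc m"] m by simp
    show "D (Suc m) * C m = - (C m * D (Suc m))" using D_C[of "Suc m" m] m by simp
    show "D (Suc m) * D m = - (D m * D (Suc m))" using D_D[of m "Suc m"] m by simp
    show "T m * C m = C (Suc m) * T m" using TC[of m] m by simp
    show "T m * C (Suc m) = C m * T m - eps * (C m - C (Suc m))" using TC'[of m] m by simp
    show "T m * D (Suc m) = D m * T m" using T_D[of m] m by simp
    show "T m * D m = D (Suc m) * T m + eps * (D m - D (Suc m))" using T_D'[of m] m by simp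
    show "(SC s * e - (C m * D m + D m * C m)) * R m = e"
      "(SC s * e - (C (Suc m) * D (Suc m) + D (Suc m) * C (Suc m))) * R (Suc m) = e"
      using R_inv[of m] R_inv[of "Suc m"] m by (auto simp: y_def)
  next
    fix x assume x: "x \<in> {C m, C (Suc m), D m, D (Suc m)}"
    show "x * R (Suc m) = R (Suc m) * x"
      using x R_comm[of "Suc m" x] m inN y_C[of "Suc m"] y_D[of "Suc m"] DyS by auto
  next
    fix x assume x: "x \<in> {C m, C (Suc m), D m, D (Suc m), R (Suc m)}"
    have "R (Suc m) * y m = y m * R (Suc m)" using R_comm[of "Suc m" "y m"] inN yy m by simp
    then show "x * R m = R m * x"
      using x R_comm[of m x] m inN y_C[of m] y_D[of m] DSy by auto
  qed
qed

definition "Gam m = Q m (R m * (e + D m * C m))"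
text \<open>The combination that acquires one factor per level; \<open>Gam m\<close> itself has no
  product formula.\<close>

definition "K m = e - eps * eps * Gam m"

lemma A_DC: "0 < m \<Longrightarrow> e + D m * C m \<in> A m"
  by (auto intro!: A_add A_mult A_C D_A A_e)

lemma Gam_A: "\<lbrakk>0 < m; m \<le> N\<rbrakk> \<Longrightarrow> Gam m \<in> A m"
  using A_DC[of m] R_A[of m] by (auto simp: Gam_def intro!: Q_A A_mult)

lemma K_A: "\<lbrakk>0 < m; m \<le> N\<rbrakk> \<Longrightarrow> K m \<in> A m"
  using A_SC[OF A_SC[OF Gam_A[of m]]] by (auto simp: K_def mult.assoc intro!: A_diff A_e)

lemma Gam_1: "0 < N \<Longrightarrow> Gam 1 = R 1 + R 1"
  using CC[of 1] A_unit[OF R_A[of 1]] by (simp add: Gam_def D_1 distrib_left)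

text \<open>Conjugation by \<open>T m\<close> reduces the new seed to the old one, and the
  correction brings in two further sums \<open>F1\<close> and \<open>F2\<close>. Both can be
  expressed through \<open>K m\<close>. The vanishing of the odd sum has to be carried along in the
  induction, since the odd seed enters the evaluation of \<open>F1\<close> and
  \<open>F2\<close>.\<close>

lemma trace_formula_step:
  assumes m: "0 < m" "Suc m \<le> N" and V: "Q m (R m * (C m - D m)) = 0"
  shows "K (Suc m) = (e - eps * eps * (SC s * y (Suc m) - (e + e + e + e)) * R (Suc m) * R (Suc m)) * K m"
    and "Q (Suc m) (R (Suc m) * (C (Suc m) - D (Suc m))) = 0"
proof -
  define t c d Da G Ra Rb where "t = T m" and "c = C m" and "d = C (Suc m)" and "Da = D m"
    and "G = D (Suc m)" and "Ra = R m" and "Rb = R (Suc m)"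
  note defs = t_def c_def d_def Da_def G_def Ra_def Rb_def
  interpret S: hc_step e eps "SC s" t c d Da G Ra Rb
    unfolding defs using hc_step[OF m] .
  note Snorm = S.norm
  define Q' where "Q' x = Q m (x + Da * x * c)" for x
  have inN: "R (Suc m) \<in> A N" using m by (intro A_mono[OF R_A]) auto
  \<comment> \<open>The elements that can be pulled out of \<open>Q m\<close> on either
    side.\<close>
  define cm where "cm x \<longleftrightarrow> (\<forall>i. 0 < i \<longrightarrow> i < m \<longrightarrow> T i * x = x * T i)" for x
  define b bi where "b = d * G" and "bi = G * d"
  have comm: "T i * d = d * T i" "T i * G = G * T i" "T i * Rb = Rb * T i" "T i * SC a = SC a * T i"
     "T i * e = e * T i" if "0 < i" "i < m" for i a
    using that m TC_far[of i "Suc m"] D_T[of "Suc m" i] R_comm[of "Suc m" "T i"] y_T[of "Suc m" i] SC_T[of i] eT[of i] Te[of i] A_T[of i N]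
    by (auto simp: defs)
  have cm_mult: "cm (x * z)" if "cm x" "cm z" for x z
    using that unfolding cm_def by (metis mult.assoc)
  have cm_add: "cm (x + z)" "cm (x - z)" if "cm x" "cm z" for x z
    using that unfolding cm_def by (simp_all add: algebra_simps)
  have cm0: "cm d" "cm G" "cm Rb" "cm (SC a)" "cm e" for a using comm by (auto simp: cm_def)
  have cm_b: "cm b" "cm bi" unfolding b_def bi_def using cm0 cm_mult by auto
  note cm = cm_mult cm_add cm0 cm_b
  have QL: "Q m (x * z) = x * Q m z" and QR: "Q m (z * x) = Q m z * x" if "cm x" for x z
    using Q_left[of m x z] Q_right[of m x z] that unfolding cm_def by auto
  define Y where "Y = Q m (Ra * (e + Da * c))"
  have Y: "Y = Gam m" by (simp add: Y_def Gam_def defs)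
  have V': "Q m (Ra * (c - Da)) = 0" using V by (simp add: defs)
  define F1 F2 where "F1 = Q' (Ra * t)" and "F2 = Q' (Ra * Da * c * t)"
  have YA: "Y \<in> A m" using Gam_A[of m] m by (simp add: Y)
  have Yu: "e * Y = Y" "Y * e = Y" "\<And>a. Y * SC a = SC a * Y"
    using A_unit[OF YA] A_SC_comm[OF YA] m by auto
  have YR: "Y * Rb = Rb * Y"
    by (rule A_comm[OF YA]) (use m R_comm[of "Suc m"] y_C[of "Suc m"] y_T[of "Suc m"] A_unit[OF inN] A_SC_comm[OF inN] A_T A_C in \<open>auto simp: Rb_def\<close>)
  have Yb: "Y * bi = bi * Y"
  proof (rule A_comm[OF YA])
    fix i assume i: "0 < i" "i \<le> m"
    have "C i * G = - (G * C i)" "C i * d = - (d * C i)"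
      using D_C[of "Suc m" i] C_anti[of i "Suc m"] i m by (auto simp: defs)
    then show "C i * bi = bi * C i" unfolding bi_def by (rule commute_mult_of_anticommute)
  next
    have "bi \<in> A N" unfolding bi_def defs using m by (intro A_mult A_mono[OF D_A] A_C) auto
    then show "e * bi = bi * e" "SC a * bi = bi * SC a" for a
      using A_unit A_SC_comm by auto
  qed (use cm_b m in \<open>auto simp: cm_def\<close>)
  have g4: "eps * Q' t = b - e"
  proof -
    have "t + Da * t * c = d * ((d - Da) * t)"
      by (simp add: Snorm)
    then have "Q' t = d * Q m ((d - Da) * t)"
      using QL[OF cm0(1)] by (simp add: Q'_def)
    then have "eps * Q' t = d * (eps * Q m ((d - Da) * t))"
      using S.norm0(3)[of d] by (simp add: mult.assoc[symmetric])
    also have "eps * Q m ((d - Da) * t) = G - d"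
      using D_Q[of m] m by (simp add: defs)
    finally show ?thesis by (simp add: b_def right_diff_distrib S.sq)
  qed
  \<comment> \<open>\<open>Ra * t\<close> is traded for \<open>t * Rb\<close>. This leaves the sum
    \<open>Q' t\<close>, known from \<open>g4\<close>, and a defect which \<open>Er_even\<close>
    expresses through \<open>Y\<close> and the vanishing odd sum.\<close>
  have F1: "F1 = Q' t * Rb - eps * Rb * (b - e) * Y"
  proof -
    have "Ra * t + Da * (Ra * t) * c = (t + Da * t * c) * Rb - eps * Rb * ((b - e) * (Ra * (e + Da * c)) + (d + G) * (Ra * (c - Da)))"
    proof -
      have 1: "Ra * t = t * Rb - eps * Ra * Rb * S.Er" using S.Rb_T by simp
      have 2: "Da * (Ra * t) * c = Da * t * c * Rb - eps * Ra * Rb * (Da * S.Er * c)"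
      proof -
        have "Da * (t * Rb) * c = Da * t * c * Rb" using S.R_comm(2)[of c] by (simp add: mult.assoc)
        moreover have "Da * (eps * Ra * Rb * S.Er) * c = eps * Ra * Rb * (Da * S.Er * c)"
          by (simp add: S.Er_def Snorm)
        ultimately show ?thesis unfolding 1 by (simp add: left_diff_distrib right_diff_distrib)
      qed
      have "Ra * t + Da * (Ra * t) * c = (t + Da * t * c) * Rb - eps * Ra * Rb * (S.Er + Da * S.Er * c)"
        by (subst (1) 1) (simp add: 2 distrib_left distrib_right)
      also have "\<dots> = (t + Da * t * c) * Rb - eps * Rb * ((b - e) * (Ra * (e + Da * c)) + (d + G) * (Ra * (c - Da)))"
        unfolding S.Er_even by (simp add: Snorm b_def)
      finally show ?thesis .
    qed
    then have "F1 = Q m ((t + Da * t * c) * Rb) - Q m (eps * Rb * ((b - e) * (Ra * (e + Da * c)) + (d + G) * (Ra * (c - Da))))"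
      by (simp add: F1_def Q'_def Q_diff)
    also have "Q m ((t + Da * t * c) * Rb) = Q' t * Rb" unfolding Q'_def by (rule QR) (intro cm)
    also have "Q m (eps * Rb * ((b - e) * (Ra * (e + Da * c)) + (d + G) * (Ra * (c - Da)))) =
       eps * Rb * (Q m ((b - e) * (Ra * (e + Da * c))) + Q m ((d + G) * (Ra * (c - Da))))"
      by (subst QL) (intro cm, simp add: Q_add)
    also have "Q m ((b - e) * (Ra * (e + Da * c))) = (b - e) * Y"
      unfolding Y_def by (rule QL) (intro cm)
    also have "Q m ((d + G) * (Ra * (c - Da))) = (d + G) * Q m (Ra * (c - Da))"
      by (rule QL) (intro cm)
    finally show ?thesis by (simp add: V' mult.assoc)
  qed
  define Km where "Km = e - eps * eps * Y"
  have epsF1: "eps * F1 = (b - e) * Rb * Km"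
  proof -
    have "eps * F1 = (eps * Q' t) * Rb - eps * (eps * Rb * (b - e) * Y)"
      by (simp add: F1 right_diff_distrib mult.assoc)
    also have "\<dots> = (b - e) * Rb * Km"
      unfolding g4 Km_def b_def by (simp add: Snorm)
    finally show ?thesis .
  qed
  have F2: "F2 = F1 * bi + eps * Y"
  proof -
    have "Ra * Da * c * t + Da * (Ra * Da * c * t) * c = (Ra * t + Da * (Ra * t) * c) * bi
       + eps * ((Ra * (e + Da * c)) - d * (Ra * (c - Da)))"
      by (simp add: mult.assoc S.D_c_T[simplified mult.assoc] bi_def) (simp add: Snorm)
    then have "F2 = Q m ((Ra * t + Da * (Ra * t) * c) * bi) + Q m (eps * ((Ra * (e + Da * c)) - d * (Ra * (c - Da))))"
      by (simp add: F2_def Q'_def Q_add)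
    also have "Q m ((Ra * t + Da * (Ra * t) * c) * bi) = F1 * bi"
      unfolding F1_def Q'_def by (rule QR) (intro cm)
    also have "Q m (eps * ((Ra * (e + Da * c)) - d * (Ra * (c - Da)))) = eps * (Y - Q m (d * (Ra * (c - Da))))"
      unfolding Y_def by (subst QL) (intro cm, simp add: Q_diff)
    also have "Q m (d * (Ra * (c - Da))) = 0"
      by (subst QL) (intro cm, simp add: V')
    finally show ?thesis by simp
  qed
  have epsF2: "eps * F2 = eps * F1 * bi + (e - Km)"
    unfolding F2 Km_def by (simp add: distrib_left mult.assoc)
  have KmR: "Km * Rb = Rb * Km" "Km * bi = bi * Km"
    using YR Yb Yu by (simp_all add: Km_def bi_def left_diff_distrib right_diff_distrib)
      (simp_all add: Snorm)
  have even: "Gam (Suc m) = Rb * (e + bi) + Y + Rb * ((SC s + e - bi) * (eps * F1) - (e + bi) * (eps * F2))"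
  proof -
    have "Gam (Suc m) = Rb * (e + G * d) + Q m (t * (Rb * (e + G * d)) * t)"
      by (simp add: Gam_def defs)
    also have "Q m (t * (Rb * (e + G * d)) * t) = Y + Q m (eps * Ra * Rb * (S.w + Da * S.w * c))"
      unfolding S.trace_even Q_add Y_def ..
    also have "eps * Ra * Rb * (S.w + Da * S.w * c) = (eps * Rb) * ((SC s + e - bi) * (Ra * t + Da * (Ra * t) * c)
       - (e + bi) * (Ra * Da * c * t + Da * (Ra * Da * c * t) * c))"
      by (simp add: S.w_def bi_def Snorm)
    also have "Q m \<dots> = (eps * Rb) * ((SC s + e - bi) * F1 - (e + bi) * F2)"
    proof -
      have "Q m ((SC s + e - bi) * (Ra * t + Da * (Ra * t) * c)) = (SC s + e - bi) * F1"
        unfolding F1_def Q'_def by (rule QL) (intro cm)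
      moreover have "Q m ((e + bi) * (Ra * Da * c * t + Da * (Ra * Da * c * t) * c)) = (e + bi) * F2"
        unfolding F2_def Q'_def by (rule QL) (intro cm)
      ultimately show ?thesis
        by (subst QL) (intro cm, simp add: Q_diff)
    qed
    finally show ?thesis by (simp add: bi_def Snorm)
  qed
  have odd: "Q (Suc m) (R (Suc m) * (C (Suc m) - D (Suc m))) = Rb * (d - G) + Rb * d * ((SC s - e - b) * (eps * F1) - (e - b) * (eps * F2))"
  proof -
    have "Q (Suc m) (R (Suc m) * (C (Suc m) - D (Suc m))) = Rb * (d - G) + Q m (t * (Rb * (d - G)) * t)"
      by (simp add: defs)
    also have "Q m (t * (Rb * (d - G)) * t) = Q m (eps * Ra * Rb * (S.w' - Da * S.w' * c))"
      unfolding S.trace_odd Q_add V' by simp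
    also have "eps * Ra * Rb * (S.w' - Da * S.w' * c) = (eps * Rb * d) * ((SC s - e - b) * (Ra * t + Da * (Ra * t) * c)
       - (e - b) * (Ra * Da * c * t + Da * (Ra * Da * c * t) * c))"
      by (simp add: S.w'_def b_def Snorm)
    also have "Q m \<dots> = (eps * Rb * d) * ((SC s - e - b) * F1 - (e - b) * F2)"
    proof -
      have "Q m ((SC s - e - b) * (Ra * t + Da * (Ra * t) * c)) = (SC s - e - b) * F1"
        unfolding F1_def Q'_def by (rule QL) (intro cm)
      moreover have "Q m ((e - b) * (Ra * Da * c * t + Da * (Ra * Da * c * t) * c)) = (e - b) * F2"
        unfolding F2_def Q'_def by (rule QL) (intro cm)
      ultimately show ?thesis
        by (subst QL) (intro cm, simp add: Q_diff)
    qed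
    finally show ?thesis by (simp add: b_def Snorm)
  qed
  have Kmu: "e * Km = Km" "Km * e = Km" "\<And>a. Km * SC a = SC a * Km"
    using A_unit[OF K_A[of m]] A_SC_comm[OF K_A[of m]] m by (simp_all add: Km_def K_def Y)
  have yb: "y (Suc m) = b + bi" by (simp add: y_def b_def bi_def defs)
  have RbU: "Rb * b = b * Rb" "Rb * bi = bi * Rb" "Rb * eps = eps * Rb"
    by (simp_all add: b_def bi_def Snorm)
  have fbi: "eps * F1 * bi = (b - e) * bi * Rb * Km"
    unfolding epsF1 using KmR RbU mult_left_absorb[OF RbU(2)] by (simp add: mult.assoc)
  \<comment> \<open>Inserting \<open>(SC s * e - y (Suc m)) * Rb = e\<close> gives all terms the
    common right factor \<open>Rb * Km\<close>, so that only identities between expressions in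
    \<open>b\<close> and \<open>bi\<close> remain.\<close>
  have K_exp: "(e - b) * Km = (e - b) * (SC s * e - (b + bi)) * Rb * Km"
    and K_exp': "(e + bi) * Km = (e + bi) * (SC s * e - (b + bi)) * Rb * Km"
  proof -
    have "(SC s * e - (b + bi)) * Rb = e" using R_inv(1)[of "Suc m"] m by (simp add: defs yb[symmetric])
    then have *: "x * (SC s * e - (b + bi)) * Rb * Km = x * (e * Km)" for x by (simp add: mult.assoc)
    show "(e - b) * Km = (e - b) * (SC s * e - (b + bi)) * Rb * Km"
      "(e + bi) * Km = (e + bi) * (SC s * e - (b + bi)) * Rb * Km"
      unfolding * Kmu by simp_all
  qed
  have "(SC s - e - b) * (eps * F1) - (e - b) * (eps * F2) =
      ((SC s - e - b) * (b - e) - (e - b) * (b - e) * bi) * Rb * Km - (e - b) * (e - Km)"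
    unfolding epsF2 fbi unfolding epsF1 by (simp add: left_diff_distrib distrib_left right_diff_distrib mult.assoc)
  also have "(SC s - e - b) * (b - e) - (e - b) * (b - e) * bi = - ((e - b) * (SC s * e - (b + bi)))"
    by (simp add: b_def bi_def Snorm)
  also have "- ((e - b) * (SC s * e - (b + bi))) * Rb * Km - (e - b) * (e - Km) = - ((e - b) * Km) - (e - b) * (e - Km)"
    unfolding K_exp by simp
  also have "\<dots> = - ((e - b) * e)" by (simp add: right_diff_distrib)
  also have "\<dots> = b - e" by (simp add: b_def Snorm)
  finally have O: "(SC s - e - b) * (eps * F1) - (e - b) * (eps * F2) = b - e" .
  show "Q (Suc m) (R (Suc m) * (C (Suc m) - D (Suc m))) = 0"
    unfolding odd O by (simp add: b_def Snorm)
  have X: "(SC s + e - bi) * (eps * F1) - (e + bi) * (eps * F2) =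
      ((SC s + e - bi) * (b - e) - (e + bi) * (b - e) * bi) * Rb * Km - (e + bi) * (e - Km)"
    unfolding epsF2 fbi unfolding epsF1 by (simp add: left_diff_distrib distrib_left right_diff_distrib mult.assoc)
  have "(e + bi) * (e - Km) = (e + bi) - (e + bi) * (SC s * e - (b + bi)) * Rb * Km"
    unfolding right_diff_distrib K_exp' by (simp add: bi_def Snorm)
  with X have X': "(e + bi) + ((SC s + e - bi) * (eps * F1) - (e + bi) * (eps * F2)) =
      ((SC s + e - bi) * (b - e) - (e + bi) * (b - e) * bi + (e + bi) * (SC s * e - (b + bi))) * Rb * Km"
    by (simp add: distrib_right)
  \<comment> \<open>\<open>b\<close> and \<open>bi\<close> are mutually inverse with sum
    \<open>y (Suc m)\<close>. All mixed terms cancel, and the products \<open>b * bi\<close> account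
    for the constant 4.\<close>
  have Z: "(SC s + e - bi) * (b - e) - (e + bi) * (b - e) * bi + (e + bi) * (SC s * e - (b + bi))
     = SC s * y (Suc m) - (e + e + e + e)"
    unfolding yb by (simp add: b_def bi_def Snorm)
  let ?X = "(SC s + e - bi) * (eps * F1) - (e + bi) * (eps * F2)"
  have Yeq: "eps * eps * Y = e - Km" by (simp add: Km_def)
  have "K (Suc m) = e - eps * eps * Y - eps * eps * (Rb * ((e + bi) + ?X))"
    unfolding K_def even by (simp add: distrib_left)
  also have "\<dots> = Km - eps * eps * (Rb * ((SC s * y (Suc m) - (e + e + e + e)) * Rb * Km))"
    unfolding Yeq X' Z by simp
  also have "Rb * ((SC s * y (Suc m) - (e + e + e + e)) * Rb * Km) = (SC s * y (Suc m) - (e + e + e + e)) * Rb * Rb * Km"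
    unfolding yb by (simp add: b_def bi_def Snorm)
  finally show "K (Suc m) = (e - eps * eps * (SC s * y (Suc m) - (e + e + e + e)) * R (Suc m) * R (Suc m)) * K m"
    unfolding K_def[of m] Y[symmetric] Km_def[symmetric]
    using Kmu by (simp add: left_diff_distrib mult.assoc Rb_def)
qed

lemma trace_odd: "\<lbrakk>0 < m; m \<le> N\<rbrakk> \<Longrightarrow> Q m (R m * (C m - D m)) = 0"
proof (induction m rule: nat_induct_non_zero)
  case (Suc m)
  then show ?case using trace_formula_step(2)[of m] by simp
qed (simp add: D_1)

lemma trace_formula_Suc: "\<lbrakk>0 < m; Suc m \<le> N\<rbrakk> \<Longrightarrow>
   K (Suc m) = (e - eps * eps * (SC s * y (Suc m) - (e + e + e + e)) * R (Suc m) * R (Suc m)) * K m"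
  using trace_formula_step(1) trace_odd by simp

text \<open>At the bottom \<open>y 1 = e + e\<close>, so the numerator is twice
  \<open>SC s * e - y 1\<close> and cancels one of the two resolvents. The first factor thus fits
  the general pattern.\<close>

lemma trace_formula_1: assumes "0 < N"
  shows "K 1 = e - eps * eps * (SC s * y 1 - (e + e + e + e)) * R 1 * R 1"
proof -
  have y1: "y 1 = e + e" using CC[of 1] assms by (simp add: y_def D_1)
  have u: "e * R 1 = R 1" using A_unit[OF R_A[of 1]] assms by simp
  have Re: "(SC s * e - (e + e)) * R 1 = e" using R_inv(1)[of 1] assms unfolding y1 by simp
  have "(SC s * y 1 - (e + e + e + e)) * R 1 * R 1 = ((SC s * e - (e + e)) * R 1) * R 1 + ((SC s * e - (e + e)) * R 1) * R 1"
    unfolding y1 by (simp add: algebra_simps)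
  also have "\<dots> = R 1 + R 1" unfolding Re u ..
  finally show ?thesis using Gam_1 assms by (simp add: K_def mult.assoc)
qed

end

section \<open>Residual orbits\<close>

text \<open>The recursion forces an arithmetic progression, and a single return to the start forces
  slope 0. Values lie in \<open>int\<close>, where the factor \<open>h\<close> can be
  cancelled.\<close>

lemma harmonic_periodic_const:
  fixes f :: "nat \<Rightarrow> int"
  assumes "\<And>i. f (i + 2) + f i = 2 * f (i + 1)" "0 < h" "f h = f 0"
  shows "f i = f 0"
proof -
  have lin: "f i = f 0 + int i * (f 1 - f 0) \<and> f (Suc i) = f 0 + int (Suc i) * (f 1 - f 0)" for i
  proof (induction i)
    case (Suc i)
    have "f (Suc (Suc i)) = 2 * f (Suc i) - f i" using assms(1)[of i] by simp
    with Suc show ?case by (simp add: algebra_simps)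
  qed simp
  have "int h * (f 1 - f 0) = 0" using lin[of h] assms(3) by simp
  then have "f 1 - f 0 = 0" using assms(2) by simp
  then show ?thesis using lin[of i] by simp
qed

text \<open>\<open>M x\<close> counts the points \<open>z k\<close> and their inverses that equal
  \<open>x\<close>. On the orbit of \<open>z 0\<close>, which has \<open>h\<close> points,
  \<open>M\<close> is constant and at least 1, while all orbit points together number at most
  \<open>2 * n\<close>. For odd \<open>h\<close> there are two cases: either the orbit avoids its
  inverse and each \<open>z k\<close> contributes at most once, or it contains a self-inverse point,
  where \<open>M\<close> is even and hence at least 2.\<close>

lemma residual_orbit_bound:
  fixes z :: "nat \<Rightarrow> 'a::field" and t u :: 'a and n h :: nat
  defines "\<phi> \<equiv> \<lambda>x. u * (x + inverse x)"
  assumes n: "0 < n" and z: "\<And>k. k < n \<Longrightarrow> z k \<noteq> 0" and u: "u \<noteq> 0"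
    and h: "0 < h" "t ^ h = 1" "\<And>j. \<lbrakk>0 < j; j < h\<rbrakk> \<Longrightarrow> t ^ j \<noteq> 1"
    and eq: "(\<Prod>k<n. [:- \<phi> (t * z k), 1:] * [:- \<phi> (z k / t), 1:]) = (\<Prod>k<n. [:- \<phi> (z k), 1:] * [:- \<phi> (z k), 1:])"
  shows "h \<le> 2 * n" "odd h \<Longrightarrow> h \<le> n"
proof -
  have t: "t \<noteq> 0" using h(1,2) by (metis power_0_left zero_neq_one not_gr_zero)
  have phi: "\<phi> a = \<phi> x \<longleftrightarrow> a = x \<or> a = inverse x" if "a \<noteq> 0" "x \<noteq> 0" for a x
  proof -
    have "\<phi> a = \<phi> x \<longleftrightarrow> (a - x) * (a * x - 1) = 0"
    proof -
      have "\<phi> a = \<phi> x \<longleftrightarrow> a + inverse a = x + inverse x" using u by (simp add: \<phi>_def)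
      also have "\<dots> \<longleftrightarrow> (a - x) * (a * x - 1) = 0"
        using that by (simp add: field_simps)
      finally show ?thesis .
    qed
    also have "\<dots> \<longleftrightarrow> a = x \<or> a = inverse x"
      unfolding mult_eq_0_iff using that by (simp add: field_simps)
    finally show ?thesis .
  qed
  define g :: "'a \<Rightarrow> 'a \<Rightarrow> int" where "g a x = of_bool (\<phi> a = \<phi> x)" for a x
  define c :: "'a \<Rightarrow> 'a \<Rightarrow> int" where "c a x = of_bool (a = x) + of_bool (a = inverse x)" for a x
  define M where "M x = (\<Sum>k<n. c (z k) x)" for x
  \<comment> \<open>A self-inverse point is counted twice by \<open>c\<close> but only once by
    equality of \<open>\<phi>\<close>-values; the weight repairs this.\<close>
  define w :: "'a \<Rightarrow> int" where "w x = (if x = inverse x then 2 else 1)" for x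
  have wg: "w x * g a x = c a x" if "a \<noteq> 0" "x \<noteq> 0" for a x
    using phi[OF that] by (auto simp: w_def g_def c_def)
  have "proots (\<Prod>k<n. [:- \<phi> (t * z k), 1:] * [:- \<phi> (z k / t), 1:]) = proots (\<Prod>k<n. [:- \<phi> (z k), 1:] * [:- \<phi> (z k), 1:])"
    using eq by simp
  then have "(\<Sum>k<n. {#\<phi> (t * z k)#} + {#\<phi> (z k / t)#}) = (\<Sum>k<n. {#\<phi> (z k)#} + {#\<phi> (z k)#})"
    by (subst (asm) (1 2) proots_prod) (simp_all add: proots_mult del: mult_pCons_left mult_pCons_right)
  then have count: "(\<Sum>k<n. count ({#\<phi> (t * z k)#} + {#\<phi> (z k / t)#}) v) = (\<Sum>k<n. count ({#\<phi> (z k)#} + {#\<phi> (z k)#}) v)" for v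
    by (metis count_sum)
  have gsum: "(\<Sum>k<n. g (t * z k) x + g (z k / t) x) = (\<Sum>k<n. 2 * g (z k) x)" for x
  proof -
    have "int (\<Sum>k<n. count ({#\<phi> (t * z k)#} + {#\<phi> (z k / t)#}) (\<phi> x)) = (\<Sum>k<n. g (t * z k) x + g (z k / t) x)"
      unfolding of_nat_sum by (rule sum.cong) (auto simp: g_def)
    moreover have "int (\<Sum>k<n. count ({#\<phi> (z k)#} + {#\<phi> (z k)#}) (\<phi> x)) = (\<Sum>k<n. 2 * g (z k) x)"
      unfolding of_nat_sum by (rule sum.cong) (auto simp: g_def)
    ultimately show ?thesis by (metis count)
  qed
  have csum: "(\<Sum>k<n. c (t * z k) x + c (z k / t) x) = 2 * M x" if "x \<noteq> 0" for x
  proof -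
    have "(\<Sum>k<n. c (t * z k) x + c (z k / t) x) = w x * (\<Sum>k<n. g (t * z k) x + g (z k / t) x)"
      unfolding sum_distrib_left
      by (rule sum.cong) (use that t z in \<open>auto simp: distrib_left wg\<close>)
    also have "\<dots> = (\<Sum>k<n. 2 * (w x * g (z k) x))"
      unfolding gsum sum_distrib_left by (rule sum.cong) auto
    also have "\<dots> = 2 * M x"
      unfolding M_def sum_distrib_left by (rule sum.cong) (use that z in \<open>auto simp: wg\<close>)
    finally show ?thesis .
  qed
  have harm: "M (t * x) + M (x / t) = 2 * M x" if "x \<noteq> 0" for x
  proof -
    have "M (t * x) + M (x / t) = (\<Sum>k<n. c (z k) (t * x) + c (z k) (x / t))"
      by (simp add: M_def sum.distrib)
    also have "\<dots> = (\<Sum>k<n. c (t * z k) x + c (z k / t) x)"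
    proof (rule sum.cong)
      fix k assume "k \<in> {..<n}"
      then have "z k \<noteq> 0" using z by simp
      then show "c (z k) (t * x) + c (z k) (x / t) = c (t * z k) x + c (z k / t) x"
        using t that by (simp add: c_def field_simps)
    qed simp
    finally show ?thesis using csum[OF that] by simp
  qed
  define x where "x i = z 0 * t ^ i" for i :: nat
  have x0: "x i \<noteq> 0" for i using z[of 0] n t by (simp add: x_def)
  have const: "M (x i) = M (x 0)" for i
  proof (rule harmonic_periodic_const[of "\<lambda>i. M (x i)" h i])
    fix i
    have "t * x (i + 1) = x (i + 2)" "x (i + 1) / t = x i" using t by (simp_all add: x_def)
    then show "M (x (i + 2)) + M (x i) = 2 * M (x (i + 1))" using harm[OF x0, of "i + 1"] by simp
  qed (use h in \<open>auto simp: x_def\<close>)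
  have c0: "c a b \<ge> 0" for a b by (simp add: c_def)
  have M1: "M (x 0) \<ge> 1"
  proof -
    have "c (z 0) (x 0) \<le> M (x 0)" unfolding M_def
      by (rule member_le_sum) (use n c0 in auto)
    moreover have "c (z 0) (x 0) \<ge> 1" by (simp add: c_def x_def)
    ultimately show ?thesis by simp
  qed
  have inj: "inj_on x {..<h}"
  proof -
    have "x i \<noteq> x j" if "i < j" "j < h" for i j
    proof
      assume "x i = x j"
      moreover have "t ^ j = t ^ i * t ^ (j - i)" using that by (simp add: power_add[symmetric])
      ultimately have "t ^ (j - i) = 1" using z[of 0] n t by (simp add: x_def)
      then show False using h(3)[of "j - i"] that by simp
    qed
    then show ?thesis by (metis inj_onI lessThan_iff linorder_neqE_nat)
  qed
  have one: "(\<Sum>i<h. of_bool (a = x i)) \<le> (1::int)" "(\<Sum>i<h. of_bool (a = inverse (x i))) \<le> (1::int)" for a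
  proof -
    have *: "(\<Sum>i<h. of_bool (a = x i)) \<le> (1::int)" for a
    proof (cases "\<exists>i<h. a = x i")
      case True
      then obtain i where i: "i < h" "a = x i" by auto
      have "(\<Sum>j<h. of_bool (a = x j)) = (\<Sum>j<h. if j = i then 1 else (0::int))"
        by (rule sum.cong) (use i inj in \<open>auto simp: inj_on_def\<close>)
      then show ?thesis using i by simp
    qed (simp add: sum_nonneg)
    show "(\<Sum>i<h. of_bool (a = x i)) \<le> (1::int)" by (rule *)
    have "(\<Sum>i<h. of_bool (a = inverse (x i))) = (\<Sum>i<h. of_bool (inverse a = x i) :: int)"
      by (rule sum.cong) (auto, metis inverse_inverse_eq)
    then show "(\<Sum>i<h. of_bool (a = inverse (x i))) \<le> (1::int)" using *[of "inverse a"] by simp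
  qed
  have tot: "int h * M (x 0) = (\<Sum>k<n. \<Sum>i<h. c (z k) (x i))"
  proof -
    have "(\<Sum>i<h. M (x i)) = (\<Sum>i<h. M (x 0))" by (rule sum.cong[OF refl const])
    then have "int h * M (x 0) = (\<Sum>i<h. M (x i))" by simp
    then show ?thesis unfolding M_def by (simp add: sum.swap[of _ "{..<n}"])
  qed
  have le2: "(\<Sum>i<h. c a (x i)) \<le> 2" for a
    unfolding c_def sum.distrib using one[of a] by simp
  have "int h * M (x 0) \<le> (\<Sum>k<n. 2)"
    unfolding tot by (rule sum_mono) (use le2 in simp)
  then have bound: "int h * M (x 0) \<le> 2 * int n" by simp
  moreover have "int h * 1 \<le> int h * M (x 0)" using M1 by (intro mult_left_mono) auto
  ultimately show "h \<le> 2 * n" by simp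
  show "h \<le> n" if odd: "odd h"
  proof (cases "\<exists>i<h. \<exists>j<h. x i = inverse (x j)")
    case True
    then obtain i j where "x i = inverse (x j)" by auto
    then have ij: "z 0 * z 0 * t ^ (i + j) = 1"
      using x0[of j] z[of 0] n t by (simp add: x_def power_add field_simps)
    \<comment> \<open>A solution of \<open>2 * m = i + j\<close> modulo \<open>h\<close>, available
      because \<open>h\<close> is odd; \<open>x m\<close> is then self-inverse.\<close>
    define m where "m = (if even (i + j) then (i + j) div 2 else (i + j + h) div 2)"
    have "2 * m = i + j \<or> 2 * m = i + j + h" using odd by (auto simp: m_def)
    then have "m + m = i + j \<or> m + m = i + j + h" by linarith
    then have "t ^ (m + m) = t ^ (i + j)" using h(2) by (metis power_add mult_1_right)
    then have "x m * x m = 1" using ij by (simp add: x_def power_add algebra_simps)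
    then have self: "inverse (x m) = x m" using x0[of m] by (metis inverse_unique)
    have "M (x m) = 2 * (\<Sum>k<n. of_bool (z k = x m))"
      unfolding M_def c_def self sum_distrib_left by (rule sum.cong) auto
    then have "2 dvd M (x 0)" using const[of m] by simp
    then have "2 \<le> M (x 0)" using M1 by (auto elim!: dvdE)
    then have "int h * 2 \<le> int h * M (x 0)" by (intro mult_left_mono) auto
    then show ?thesis using bound by simp
  next
    case False
    have le1: "(\<Sum>i<h. c a (x i)) \<le> 1" for a
    proof (cases "\<exists>i<h. a = x i")
      case True
      then have "(\<Sum>i<h. of_bool (a = inverse (x i)) :: int) = 0" using False by (auto intro!: sum.neutral)
      then show ?thesis unfolding c_def sum.distrib using one[of a] by simp
    next
      case False
      then have "(\<Sum>i<h. of_bool (a = x i) :: int) = 0" by (auto intro!: sum.neutral)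
      then show ?thesis unfolding c_def sum.distrib using one[of a] by simp
    qed
    have "int h * M (x 0) \<le> (\<Sum>k<n. 1)"
      unfolding tot by (rule sum_mono) (use le1 in simp)
    moreover have "int h * 1 \<le> int h * M (x 0)" using M1 by (intro mult_left_mono) auto
    ultimately show ?thesis by simp
  qed
qed

section \<open>Finite dimensionality and inverses\<close>

context hc_rep
begin

lemma vector_space: "vector_space (\<lambda>a x. SC a * x)"
  by unfold_locales (simp_all add: SC_add SC_mult SC_1 algebra_simps)

interpretation VS: vector_space "\<lambda>a x. SC a * x"
  by (rule vector_space)

lemma SC_minus: "SC (- a) = - SC a"
  using SC_add[of a "- a"] by (simp add: SC_0 add_eq_0_iff)

text \<open>Only left multiplication is recorded: from \<open>x = x * e\<close> it follows that a
  left stable span containing \<open>e\<close> contains all of \<open>A m\<close>.\<close>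

definition left_stable_span :: "nat \<Rightarrow> 'e set \<Rightarrow> bool" where
  "left_stable_span m B \<longleftrightarrow> finite B \<and> e \<in> VS.span B \<and>
     (\<forall>v\<in>VS.span B. (\<forall>i. 0 < i \<and> i < m \<longrightarrow> T i * v \<in> VS.span B) \<and> (\<forall>i. 0 < i \<and> i \<le> m \<longrightarrow> C i * v \<in> VS.span B)
        \<and> e * v = v)"

lemma left_mult_span:
  assumes "v \<in> VS.span B" "\<And>b. b \<in> B \<Longrightarrow> x * b \<in> VS.span W" "\<And>a. SC a * x = x * SC a"
  shows "x * v \<in> VS.span W"
  using assms(1)
proof (induction rule: VS.span_induct_alt)
  case (step c b v)
  have "x * (SC c * b + v) = SC c * (x * b) + x * v"
    using assms(3)[of c] by (simp add: distrib_left mult.assoc[symmetric])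
  then show ?case using step assms(2)[of b] by (simp add: VS.span_add VS.span_scale)
qed (simp add: VS.span_zero)

lemma left_stable_span_0: "left_stable_span 0 {e}"
proof -
  have "e * v = v" if "v \<in> VS.span {e}" for v
    using that by (auto simp: VS.span_singleton) (metis SC_e ee mult.assoc)
  then show ?thesis by (simp add: left_stable_span_def VS.span_base)
qed

text \<open>\<open>P m j = T\<^sub>m\<^sub>-\<^sub>j\<^sub>+\<^sub>1 \<cdots> T\<^sub>m\<close> runs through the minimal representatives of the cosets of \<open>S\<^sub>m\<close> in \<open>S\<^sub>m\<^sub>+\<^sub>1\<close>.\<close>

primrec P :: "nat \<Rightarrow> nat \<Rightarrow> 'e" where
  "P m 0 = e"
| "P m (Suc j) = T (m - j) * P m j"

lemma P_A: "j \<le> m \<Longrightarrow> P m j \<in> A (Suc m)"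
  by (induction j) (auto intro!: A_e A_mult A_T)

lemma P_comm_low: "\<lbrakk>j \<le> m; m < N; 0 < i; i + j < m\<rbrakk> \<Longrightarrow> T i * P m j = P m j * T i"
proof (induction j)
  case (Suc j)
  have "T i * T (m - j) = T (m - j) * T i" using T_far[of i "m - j"] Suc.prems by simp
  moreover have "T i * P m j = P m j * T i" using Suc by simp
  ultimately show ?case using commute_mult by simp
qed (simp add: eT Te)

text \<open>\<open>T (Suc i)\<close> commutes with the leading letters of the word up to the pair
  \<open>T i\<close>, \<open>T (Suc i)\<close>; there the braid relation lowers its index, and
  \<open>T i\<close> commutes with the rest.\<close>

lemma P_shift: "\<lbrakk>j \<le> m; m < N; i < m; m < i + j; 0 < i\<rbrakk> \<Longrightarrow> T (Suc i) * P m j = P m j * T i"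
proof (induction j)
  case (Suc j)
  show ?case
  proof (cases "m < i + j")
    case True
    have "T (m - j) * T (Suc i) = T (Suc i) * T (m - j)" using T_far[of "m - j" "Suc i"] Suc.prems True by simp
    moreover have "T (Suc i) * P m j = P m j * T i" using Suc True by simp
    ultimately show ?thesis by (simp add: mult.assoc) (metis mult.assoc)
  next
    case False
    then have i: "i = m - j" using Suc.prems by simp
    obtain l where l: "j = Suc l" using Suc.prems i by (cases j) auto
    have ml: "m - l = Suc i" using i l Suc.prems by simp
    have "T (Suc i) * P m (Suc j) = T (Suc i) * T i * T (Suc i) * P m l"
      by (simp add: l ml i[unfolded l, symmetric] mult.assoc)
    also have "\<dots> = T i * T (Suc i) * (T i * P m l)"
      using braid[of i] Suc.prems by (simp add: mult.assoc[symmetric])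
    also have "T i * P m l = P m l * T i"
      using P_comm_low[of l m i] Suc.prems i l by simp
    also have "T i * T (Suc i) * (P m l * T i) = P m (Suc j) * T i"
      by (simp add: l ml i[unfolded l, symmetric] mult.assoc)
    finally show ?thesis .
  qed
qed simp

lemma P_C: "\<lbrakk>0 < j; j \<le> m; m < N\<rbrakk> \<Longrightarrow> C (Suc m) * P m j = P m j * C m"
proof (induction j rule: nat_induct_non_zero)
  case 1
  then show ?case using TC[of m] Te[of m] eC[of m] Ce[of m] by (simp add: mult.assoc)
next
  case (Suc j)
  have "T (m - j) * C (Suc m) = C (Suc m) * T (m - j)" using TC_far[of "m - j" "Suc m"] Suc by simp
  with Suc show ?case by (simp add: mult.assoc) (metis Suc_leD mult.assoc)
qed

text \<open>The normal form is a coset representative \<open>P m j\<close>, then an optional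
  \<open>C (Suc m)\<close>, then a spanning element of level \<open>m\<close>.\<close>

lemma left_stable_span_Suc:
  assumes "left_stable_span m B" "Suc m \<le> N"
  shows "\<exists>B'. left_stable_span (Suc m) B'"
proof -
  let ?n = "Suc m"
  define B' where "B' = (\<Union>j\<in>{..m}. (\<lambda>b. P m j * b) ` B \<union> (\<lambda>b. P m j * (C ?n * b)) ` B)"
  let ?W = "VS.span B'"
  have fin: "finite B'" using assms by (auto simp: B'_def left_stable_span_def)
  have PA: "P m j \<in> A ?n" if "j \<le> m" for j using P_A that by simp
  have Pu: "e * P m j = P m j" "SC a * P m j = P m j * SC a" if "j \<le> m" for j a
    using A_unit[OF PA[OF that]] A_SC_comm[OF PA[OF that]] assms by auto
  have Cu: "SC a * C ?n = C ?n * SC a" "e * C ?n = C ?n" "C ?n * e = C ?n" for a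
    using SC_C[of ?n] eC[of ?n] Ce[of ?n] assms by auto
  have W1: "P m j * v \<in> ?W" if "j \<le> m" "v \<in> VS.span B" for j v
    using that(2) by (rule left_mult_span) (use that(1) Pu in \<open>auto simp: B'_def intro!: VS.span_base\<close>)
  have W2: "P m j * (C ?n * v) \<in> ?W" if "j \<le> m" "v \<in> VS.span B" for j v
  proof -
    have "(P m j * C ?n) * v \<in> ?W"
      by (rule left_mult_span[OF that(2)])
        (use that(1) Pu Cu in \<open>auto simp: B'_def mult.assoc intro!: VS.span_base\<close>, metis mult.assoc)
    then show ?thesis by (simp add: mult.assoc)
  qed
  have Bcl: "T i * v \<in> VS.span B" if "v \<in> VS.span B" "0 < i" "i < m" for v i
    using that assms by (auto simp: left_stable_span_def)
  have BclC: "C i * v \<in> VS.span B" if "v \<in> VS.span B" "0 < i" "i \<le> m" for v i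
    using that assms by (auto simp: left_stable_span_def)
  have b0: "b \<in> VS.span B" if "b \<in> B" for b using that by (rule VS.span_base)
  have gen: "x * v \<in> ?W" if "v \<in> ?W" "\<And>a. SC a * x = x * SC a"
     "\<And>j b. j \<le> m \<Longrightarrow> b \<in> B \<Longrightarrow> x * (P m j * b) \<in> ?W"
     "\<And>j b. j \<le> m \<Longrightarrow> b \<in> B \<Longrightarrow> x * (P m j * (C ?n * b)) \<in> ?W" for x v
    by (rule left_mult_span[OF that(1)]) (use that(2-4) in \<open>auto simp: B'_def\<close>)
  have eW: "e * v = v" if "v \<in> ?W" for v
    using that
  proof (induction rule: VS.span_induct_alt)
    case (step c b v)
    then have "e * b = b" using Pu(1) by (auto simp: B'_def mult.assoc[symmetric])
    moreover have "e * (SC c * b) = SC c * (e * b)" by (metis SC_e mult.assoc)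
    ultimately show ?case using step by (simp add: distrib_left)
  qed simp
  have T: "T i * v \<in> ?W" if i: "0 < i" "i < ?n" and v: "v \<in> ?W" for i v
  proof (rule gen[OF v])
    show "SC a * T i = T i * SC a" for a using SC_T[of i] i assms by simp
  next
    have iN: "i < N" using i assms by simp
    \<comment> \<open>According to its position, \<open>T i\<close> either extends the word, or
      meets its first letter and is absorbed by the quadratic relation, or passes through it. In the
      last case it comes out with the same or the next smaller index, as a generator of level
      \<open>m\<close>.\<close>
    have main: "\<exists>j1 j2 x1 x2. j1 \<le> m \<and> j2 \<le> m \<and> T i * P m j = SC x1 * P m j1 + SC x2 * P m j2
        \<or> (\<exists>i'. 0 < i' \<and> i' < m \<and> T i * P m j = P m j * T i')" if j: "j \<le> m" for j
    proof -
      consider "i + j = m" | "i + j = Suc m" | "i + j < m" | "Suc m < i + j" by linarith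
      then show ?thesis
      proof cases
        case 1
        then have "T i * P m j = SC 1 * P m (Suc j) + SC 0 * P m j" "Suc j \<le> m"
          using i by (auto simp: SC_1 SC_0 dest: sym)
        then show ?thesis using j by blast
      next
        case 2
        then obtain l where l: "j = Suc l" "m - l = i" using i by (cases j) auto
        have "T i * P m j = (T i * T i) * P m l" by (simp add: l mult.assoc)
        also have "\<dots> = eps * P m j + SC 1 * P m l"
          using TT[of i] i iN Pu(1)[of l] j l by (simp add: distrib_right mult.assoc SC_1)
        finally show ?thesis using j l by (meson Suc_leD)
      next
        case 3
        then show ?thesis using P_comm_low[of j m i] i assms j by (metis Suc_le_lessD add_lessD1)
      next
        case 4
        then have i': "i = Suc (i - 1)" "0 < i - 1" "i - 1 < m" "m < (i - 1) + j" using j i by auto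
        have "T i * P m j = P m j * T (i - 1)" using P_shift[of j m "i - 1"] i' assms j by simp
        then show ?thesis using i' by blast
      qed
    qed
    fix j b assume j: "j \<le> m" and b: "b \<in> B"
    have both: "T i * (P m j * b) \<in> ?W \<and> T i * (P m j * (C ?n * b)) \<in> ?W"
    proof -
      from main[OF j] consider j1 j2 x1 x2 where "j1 \<le> m" "j2 \<le> m" "T i * P m j = SC x1 * P m j1 + SC x2 * P m j2"
        | i' where "0 < i'" "i' < m" "T i * P m j = P m j * T i'" by blast
      then show ?thesis
      proof cases
        case 1
        have "T i * (P m j * z) = SC x1 * (P m j1 * z) + SC x2 * (P m j2 * z)" for z
          using mult_left_absorb[OF 1(3)] by (simp add: distrib_right mult.assoc)
        then show ?thesis using W1[OF 1(1) b0[OF b]] W1[OF 1(2) b0[OF b]] W2[OF 1(1) b0[OF b]] W2[OF 1(2) b0[OF b]]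
          by (simp add: VS.span_add VS.span_scale)
      next
        case 2
        have z: "T i * (P m j * z) = P m j * (T i' * z)" for z
          using mult_left_absorb[OF 2(3)] by (simp add: mult.assoc)
        have "T i' * (C ?n * b) = C ?n * (T i' * b)"
          using TC_far[of i' ?n] 2 assms by (simp add: mult.assoc[symmetric])
        then show ?thesis using W1[OF j Bcl[OF b0[OF b] 2(1,2)]] W2[OF j Bcl[OF b0[OF b] 2(1,2)]] by (simp add: z)
      qed
    qed
    show "T i * (P m j * b) \<in> ?W" "T i * (P m j * (C ?n * b)) \<in> ?W" using both by auto
  qed
  have Cn: "C ?n * v \<in> ?W" if v: "v \<in> ?W" for v
  proof (rule gen[OF v])
    show "SC a * C ?n = C ?n * SC a" for a using Cu by simp
    fix j b assume j: "j \<le> m" and b: "b \<in> B"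
    have both: "C ?n * (P m j * b) \<in> ?W \<and> C ?n * (P m j * (C ?n * b)) \<in> ?W"
    proof (cases "j = 0")
      case True
      have "C ?n * (P m j * b) = P m 0 * (C ?n * b)" using True Cu by (simp add: mult.assoc[symmetric])
      moreover have "C ?n * (P m j * (C ?n * b)) = P m 0 * b"
        using True Cu CC[of ?n] assms ee by (simp add: mult.assoc[symmetric])
      ultimately show ?thesis using W1[OF _ b0[OF b], of 0] W2[OF _ b0[OF b], of 0] by simp
    next
      case False
      then have jm: "0 < j" "0 < m" using j by auto
      have z: "C ?n * (P m j * z) = P m j * (C m * z)" for z
        using mult_left_absorb[OF P_C[of j m]] jm j assms by (simp add: mult.assoc)
      have "C m * (C ?n * b) = - (C ?n * (C m * b))"
        using C_anti[of m ?n] jm assms by (simp add: mult.assoc[symmetric])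
      then show ?thesis using W1[OF j BclC[OF b0[OF b] jm(2)]] W2[OF j BclC[OF b0[OF b] jm(2)]]
        by (simp add: z VS.span_neg)
    qed
    show "C ?n * (P m j * b) \<in> ?W" "C ?n * (P m j * (C ?n * b)) \<in> ?W" using both by auto
  qed
  \<comment> \<open>Induction downward from \<open>C (Suc m)\<close>, using
    \<open>C i = Ti i * C (Suc i) * T i\<close>.\<close>
  have C: "C (?n - k) * v \<in> ?W" if "k < ?n" "v \<in> ?W" for k v
    using that
  proof (induction k arbitrary: v)
    case 0
    then show ?case using Cn by simp
  next
    case (Suc k)
    define i where "i = ?n - Suc k"
    have i: "0 < i" "i < ?n" "?n - k = Suc i" using Suc by (auto simp: i_def)
    have iN: "i < N" using i assms by simp
    have "C i * v = Ti i * (T i * C i) * v"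
      using eC[of i] i iN by (simp add: mult.assoc[symmetric] T_Ti)
    also have "\<dots> = Ti i * (C (Suc i) * (T i * v))"
      using TC[of i] i iN by (simp add: mult.assoc)
    finally have 1: "C i * v = Ti i * (C (Suc i) * (T i * v))" .
    define w where "w = C (Suc i) * (T i * v)"
    have w: "w \<in> ?W" using Suc.IH[of "T i * v"] T[of i v] i Suc.prems by (simp add: w_def)
    have "Ti i * w = T i * w - eps * w"
      using eW[OF w] by (simp add: Ti_def left_diff_distrib mult.assoc)
    also have "\<dots> \<in> ?W" using T[of i w] i w by (simp add: VS.span_diff VS.span_scale)
    finally show ?case using 1 by (simp add: w_def i_def)
  qed
  have "C i * v \<in> ?W" if "0 < i" "i \<le> ?n" "v \<in> ?W" for i v
    using C[of "?n - i" v] that by simp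
  moreover have "e \<in> ?W" using W1[of 0 e] assms by (simp add: left_stable_span_def ee)
  ultimately have "left_stable_span ?n B'" using fin T eW by (auto simp: left_stable_span_def)
  then show ?thesis ..
qed

lemma A_finite_dim:
  assumes "m \<le> N"
  shows "\<exists>B. finite B \<and> A m \<subseteq> VS.span B"
proof -
  have "\<exists>B. left_stable_span m B" using assms
    by (induction m) (use left_stable_span_0 left_stable_span_Suc in auto)
  then obtain B where B: "left_stable_span m B" by blast
  have "v \<in> VS.span B \<Longrightarrow> x * v \<in> VS.span B" if "x \<in> A m" for x v
    using that
  proof (induction arbitrary: v rule: A.induct)
    case (A_mult x y)
    then show ?case by (simp add: mult.assoc)
  next
    case (A_SC x a)
    then show ?case by (simp add: mult.assoc VS.span_scale)
  qed (use B in \<open>auto simp: left_stable_span_def distrib_right VS.span_add\<close>)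
  then have "x \<in> VS.span B" if "x \<in> A m" for x
    using that[THEN A_unit, OF assms] B that by (metis left_stable_span_def)
  then show ?thesis using B by (auto simp: left_stable_span_def)
qed

end

section \<open>Polynomials in one operator and inverses inside \<open>A m\<close>\<close>

context hc_rep
begin

text \<open>The constant term acts through the unit \<open>1\<close> of the whole ring and not
  through \<open>e\<close>, hence the extra factor \<open>e\<close> wherever the value is to lie in
  \<open>A m\<close>.\<close>

definition ev :: "'a poly \<Rightarrow> 'e \<Rightarrow> 'e" where
  "ev f x = (\<Sum>i\<le>degree f. SC (coeff f i) * x ^ i)"

lemma ev_le: "degree f \<le> n \<Longrightarrow> ev f x = (\<Sum>i\<le>n. SC (coeff f i) * x ^ i)"
  unfolding ev_def by (rule sum.mono_neutral_left) (auto simp: coeff_eq_0 SC_0)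

lemma ev_0: "ev 0 x = 0" by (simp add: ev_def SC_0)

lemma ev_pCons:
  assumes "\<And>a. SC a * x = x * SC a"
  shows "ev (pCons a f) x = SC a + x * ev f x"
proof -
  have "ev (pCons a f) x = (\<Sum>i\<le>Suc (degree f). SC (coeff (pCons a f) i) * x ^ i)"
    by (rule ev_le) (simp add: degree_pCons_le)
  also have "\<dots> = SC a + (\<Sum>i\<le>degree f. SC (coeff f i) * x ^ Suc i)"
    by (subst sum.atMost_Suc_shift) simp
  also have "(\<Sum>i\<le>degree f. SC (coeff f i) * x ^ Suc i) = x * ev f x"
    unfolding ev_def sum_distrib_left
    by (rule sum.cong) (use assms in \<open>auto simp: mult.assoc[symmetric]\<close>)
  finally show ?thesis .
qed

lemma ev_linear_factor:
  assumes "\<And>a. SC a * x = x * SC a"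
  shows "ev ([:- c, 1:] * f) x = (x - SC c) * ev f x"
proof -
  have sm: "ev (smult c f) x = SC c * ev f x" for c f
    using ev_le[of "smult c f" "degree f"] degree_smult_le[of c f]
    by (simp add: ev_def[of f] SC_mult sum_distrib_left mult.assoc)
  have ad: "ev (f + g) x = ev f x + ev g x" for f g
    using ev_le[of "f + g" "max (degree f) (degree g)"] ev_le[of f "max (degree f) (degree g)"]
      ev_le[of g "max (degree f) (degree g)"] degree_add_le[of f "max (degree f) (degree g)" g]
    by (simp add: SC_add distrib_right sum.distrib)
  have "[:- c, 1:] * f = pCons 0 f + smult (- c) f" by simp
  then have "ev ([:- c, 1:] * f) x = ev (pCons 0 f) x + ev (smult (- c) f) x" by (simp only: ad)
  then show ?thesis by (simp only: sm ev_pCons[OF assms] SC_0 SC_minus) (simp add: left_diff_distrib)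
qed

lemma ev_comm: "(\<And>a. SC a * z = z * SC a) \<Longrightarrow> x * z = z * x \<Longrightarrow> ev f x * z = z * ev f x"
proof -
  assume z: "\<And>a. SC a * z = z * SC a" "x * z = z * x"
  have "x ^ i * z = z * x ^ i" for i
    by (induction i) (simp_all add: mult.assoc z(2), simp add: mult.assoc[symmetric] z(2))
  then show ?thesis unfolding ev_def sum_distrib_left sum_distrib_right
    by (intro sum.cong refl) (metis z(1) mult.assoc)
qed

lemma ev_eigen:
  assumes "x * v = SC c * v" "\<And>a. SC a * x = x * SC a"
  shows "ev f x * v = SC (poly f c) * v"
proof (induction f)
  case 0
  then show ?case by (simp add: ev_0 SC_0)
next
  case (pCons a f)
  have "x * (ev f x * v) = SC (poly f c) * (x * v)"
    unfolding pCons by (metis assms(2) mult.assoc)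
  then show ?case
    by (simp add: ev_pCons[OF assms(2)] distrib_right mult.assoc assms(1) SC_add SC_mult)
      (metis SC_comm mult.assoc)
qed

lemma A_power: "x \<in> A m \<Longrightarrow> x ^ i * e \<in> A m"
  by (induction i) (auto simp: mult.assoc intro: A_e A_mult)

lemma ev_A: "x \<in> A m \<Longrightarrow> ev f x * e \<in> A m"
proof -
  assume x: "x \<in> A m"
  have z: "0 \<in> A m" using A_diff[OF x x] by simp
  have "(\<Sum>i\<in>I. SC (coeff f i) * x ^ i * e) \<in> A m" if "finite I" for I
    using that by induction (auto intro!: A_add A_SC A_power x z simp: mult.assoc)
  then show ?thesis by (simp add: ev_def sum_distrib_right)
qed

lemma A_algebraic:
  assumes x: "x \<in> A m" "m \<le> N"
  shows "\<exists>f. f \<noteq> 0 \<and> ev f x * e = 0"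
proof -
  interpret VS: vector_space "\<lambda>a x. SC a * x" by (rule vector_space)
  obtain B where B: "finite B" "A m \<subseteq> VS.span B" using A_finite_dim[OF x(2)] by blast
  define n where "n = card B"
  define g where "g i = x ^ i * e" for i
  have gB: "g ` {..n} \<subseteq> VS.span B" using A_power[OF x(1)] B by (auto simp: g_def)
  \<comment> \<open>Linear dependence is a property of the set of powers. If two powers coincide,
    this set says nothing, and the relation is a difference of two monomials.\<close>
  show ?thesis
  proof (cases "inj_on g {..n}")
    case True
    then have "card (g ` {..n}) = Suc n" by (simp add: card_image)
    then have "VS.dependent (g ` {..n})"
      using VS.independent_span_bound[OF B(1) _ gB] n_def by auto
    then obtain u v where u: "(\<Sum>v\<in>g ` {..n}. SC (u v) * v) = 0" "v \<in> g ` {..n}" "u v \<noteq> 0"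
      by (auto simp: VS.dependent_finite)
    define f where "f = (\<Sum>i\<le>n. monom (u (g i)) i)"
    have cf: "coeff f i = (if i \<le> n then u (g i) else 0)" for i
      by (simp add: f_def coeff_sum)
    have "degree f \<le> n" by (rule degree_le) (simp add: cf)
    then have "ev f x * e = (\<Sum>i\<le>n. SC (u (g i)) * g i)"
      by (simp add: ev_le cf sum_distrib_right g_def mult.assoc)
    also have "\<dots> = 0" using u(1) by (simp add: sum.reindex[OF True])
    finally have "ev f x * e = 0" .
    moreover have "f \<noteq> 0" using u(2,3) cf by (metis coeff_0 imageE atMost_iff)
    ultimately show ?thesis by blast
  next
    case False
    then obtain i j where ij: "g i = g j" "i < j" by (metis inj_onI linorder_neqE_nat)
    define f :: "'a poly" where "f = monom 1 i - monom 1 j"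
    have "coeff f i = 1" using ij by (simp add: f_def)
    then have "f \<noteq> 0" by auto
    have "degree f \<le> j" by (rule degree_le) (use ij in \<open>auto simp: f_def\<close>)
    then have "ev f x * e = (\<Sum>l\<le>j. SC (coeff f l) * g l)"
      by (simp add: ev_le sum_distrib_right g_def mult.assoc)
    also have "\<dots> = (\<Sum>l\<le>j. (if l = i then g i else 0) - (if l = j then g j else 0))"
      by (rule sum.cong) (use ij in \<open>auto simp: f_def SC_1 SC_0 SC_minus\<close>)
    also have "\<dots> = 0" using ij by (simp add: sum_subtractf)
    finally show ?thesis using \<open>f \<noteq> 0\<close> by blast
  qed
qed

text \<open>Take a polynomial annihilating \<open>z\<close>. While its constant term is 0,
  injectivity cancels a factor \<open>z\<close>; a nonzero constant term exhibits an inverse that is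
  itself a polynomial in \<open>z\<close>, hence in \<open>A m\<close>.\<close>

lemma A_invertible:
  assumes z: "z \<in> A m" "m \<le> N" and inj: "\<And>v. \<lbrakk>e * v = v; z * v = 0\<rbrakk> \<Longrightarrow> v = 0"
  shows "\<exists>w\<in>A m. z * w = e \<and> w * z = e"
proof -
  have zc: "SC a * z = z * SC a" for a using A_SC_comm[OF z] by simp
  have u: "e * z = z" "z * e = z" using A_unit[OF z] by auto
  have "\<exists>w\<in>A m. z * w = e \<and> w * z = e" if "f \<noteq> 0" "ev f z * e = 0" for f
    using that
  proof (induction "degree f" arbitrary: f rule: less_induct)
    case less
    obtain a g where f: "f = pCons a g" by (rule pCons_cases)
    have gA: "ev g z * e \<in> A m" using ev_A z by simp
    have eq: "SC a * e + z * (ev g z * e) = 0"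
      using less.prems(2) by (simp add: f ev_pCons[OF zc] distrib_right mult.assoc)
    show ?case
    proof (cases "a = 0")
      case True
      then have "g \<noteq> 0" using less.prems f by auto
      moreover have "ev g z * e = 0"
        using inj[of "ev g z * e"] eq True A_unit[OF gA] z by (simp add: SC_0)
      moreover have "degree g < degree f" using True \<open>g \<noteq> 0\<close> by (simp add: f)
      ultimately show ?thesis using less.hyps by blast
    next
      case False
      define w where "w = SC (- inverse a) * (ev g z * e)"
      have "w \<in> A m" unfolding w_def using gA by (rule A_SC)
      moreover have "z * w = e"
      proof -
        have "z * w = SC (- inverse a) * (z * (ev g z * e))" unfolding w_def by (metis zc mult.assoc)
        also have "z * (ev g z * e) = - (SC a * e)" using eq by (simp add: eq_neg_iff_add_eq_0 add.commute)
        also have "SC (- inverse a) * (- (SC a * e)) = SC (inverse a * a) * e"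
          by (simp add: SC_minus SC_mult mult.assoc)
        finally show ?thesis using False by (simp add: SC_1)
      qed
      moreover have "z * w = w * z"
        unfolding w_def using ev_comm[of z z g] zc u by (metis mult.assoc)
      ultimately show ?thesis by metis
    qed
  qed
  then show ?thesis using A_algebraic[OF z] by blast
qed

end

section \<open>Equivariant projections\<close>

text \<open>Over a finite field the product of all \<open>X - a\<close>, increased by 1, has no
  root.\<close>

lemma alg_closed_infinite: "infinite (UNIV :: 'a::alg_closed_field set)"
proof
  assume fin: "finite (UNIV :: 'a set)"
  define p :: "'a poly" where "p = (\<Prod>a\<in>UNIV. [:- a, 1:])"
  have "degree p = (\<Sum>a\<in>(UNIV::'a set). degree [:- a, 1:])"
    unfolding p_def by (rule degree_prod_eq_sum_degree) simp
  then have "degree p > 0" using fin by (simp add: finite_UNIV_card_ge_0)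
  then have "degree (p + 1) > 0" by (simp add: degree_add_eq_left)
  then obtain x where "poly (p + 1) x = 0" using alg_closed_imp_poly_has_root by blast
  moreover have "poly p x = 0" unfolding p_def poly_prod using fin by (auto intro: bexI[of _ x])
  ultimately show False by simp
qed

text \<open>The first hypothesis expresses that the image of \<open>p\<close> is stable under
  \<open>x\<close>.\<close>

lemma stable_left:
  fixes x :: "'e::semigroup_mult"
  assumes "x * p = p * (x * p)" "p * z = z"
  shows "p * (x * z) = x * z"
proof -
  have "p * (x * z) = (p * (x * p)) * z" by (simp add: mult.assoc assms(2))
  also have "\<dots> = x * p * z" by (simp only: assms(1)[symmetric])
  finally show ?thesis by (simp add: mult.assoc assms(2))
qed

lemma stable_right:
  fixes x :: "'e::semigroup_mult"
  assumes "x * p = p * (x * p)" "z * p = z' * p"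
  shows "z * x * p = z' * x * p"
proof -
  have "z * x * p = z * (p * (x * p))" by (simp only: mult.assoc assms(1)[symmetric])
  also have "\<dots> = z' * (p * (x * p))" by (simp only: mult.assoc[symmetric] assms(2))
  also have "\<dots> = z' * x * p" by (simp only: mult.assoc assms(1)[symmetric])
  finally show ?thesis .
qed

locale hc_rep_closed = hc_rep SC e T C q N
  for SC :: "'a::alg_closed_field \<Rightarrow> 'e::ring_1" and e T C q N
begin

lemma SC_cancel: assumes "c \<noteq> 0" "SC c * v = 0" shows "v = 0"
proof -
  have "SC (inverse c) * (SC c * v) = v"
    using assms(1) by (simp add: mult.assoc[symmetric] SC_mult[symmetric] SC_1)
  then show ?thesis using assms(2) by simp
qed

text \<open>Linear factors of \<open>f\<close> are split off until one annihilates the vector. The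
  eigenvalue is a root of the prescribed \<open>f\<close>, so the finitely many candidates are known
  before \<open>s\<close> is chosen. Vectors here are elements of the operator ring itself, acted on
  from the left.\<close>

lemma eigenvector_exists:
  assumes "\<And>a. SC a * x = x * SC a" "f \<noteq> 0" "ev f x * v = 0" "v \<noteq> 0"
  shows "\<exists>c g. ev g x * v \<noteq> 0 \<and> x * (ev g x * v) = SC c * (ev g x * v) \<and> poly f c = 0"
  using assms(2,3)
proof (induction "degree f" arbitrary: f rule: less_induct)
  case less
  show ?case
  proof (cases "degree f = 0")
    case True
    then obtain a where a: "f = [:a:]" by (auto elim: degree_eq_zeroE)
    then have "SC a * v = 0" using less.prems by (simp add: ev_def)
    then show ?thesis using SC_cancel[of a v] assms(4) less.prems(1) a by simp
  next
    case False
    then obtain c where c: "poly f c = 0" using alg_closed_imp_poly_has_root by blast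
    then obtain g where g: "f = [:- c, 1:] * g" by (metis poly_eq_0_iff_dvd dvdE)
    have g0: "g \<noteq> 0" using g less.prems(1) by auto
    have deg: "degree g < degree f" unfolding g using g0 by (subst degree_mult_eq) auto
    have *: "x * (ev g x * v) = SC c * (ev g x * v)"
      using less.prems(2) unfolding g ev_linear_factor[OF assms(1)]
      by (simp add: left_diff_distrib mult.assoc)
    show ?thesis
    proof (cases "ev g x * v = 0")
      case True
      from less.hyps[OF deg g0 True] obtain c' g' where
        "ev g' x * v \<noteq> 0" "x * (ev g' x * v) = SC c' * (ev g' x * v)" "poly g c' = 0" by blast
      then show ?thesis unfolding g by (metis mult_zero_right poly_mult)
    qed (use * c in blast)
  qed
qed

lemma y_y: "\<lbrakk>0 < k; k \<le> N; 0 < l; l \<le> N\<rbrakk> \<Longrightarrow> y k * y l = y l * y k"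
proof -
  have *: "y k * y l = y l * y k" if "0 < k" "k < l" "l \<le> N" for k l
  proof (rule A_comm[OF y_A])
    have "y l \<in> A N" using that by (intro A_mono[OF y_A]) auto
    then show "e * y l = y l * e" "SC a * y l = y l * SC a" for a using A_unit A_SC_comm by auto
  qed (use that in \<open>auto intro!: y_T y_C\<close>)
  show "\<lbrakk>0 < k; k \<le> N; 0 < l; l \<le> N\<rbrakk> \<Longrightarrow> y k * y l = y l * y k"
    by (cases k l rule: linorder_cases) (use * in auto)
qed

text \<open>The kernel of \<open>z\<close> is stable under the \<open>y k\<close>, and these
  commute, so the eigenvector for one more \<open>y\<close> can be sought among polynomial images of
  the previous one without losing any property. The intended \<open>z\<close> is
  \<open>Gam m\<close>.\<close>

lemma joint_eigenvector:
  assumes f: "\<And>k. \<lbrakk>0 < k; k \<le> N\<rbrakk> \<Longrightarrow> f k \<noteq> 0 \<and> ev (f k) (y k) * e = 0"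
    and z: "\<And>k. \<lbrakk>0 < k; k \<le> m\<rbrakk> \<Longrightarrow> y k * z = z * y k" "\<And>a. SC a * z = z * SC a"
    and v: "v \<noteq> 0" "e * v = v" "z * v = 0" and m: "m \<le> N"
  shows "\<exists>v \<eta>. v \<noteq> 0 \<and> e * v = v \<and> z * v = 0 \<and>
    (\<forall>k. 0 < k \<longrightarrow> k \<le> m \<longrightarrow> y k * v = SC (\<eta> k) * v \<and> poly (f k) (\<eta> k) = 0)"
proof -
  have "j \<le> m \<Longrightarrow> \<exists>v \<eta>. v \<noteq> 0 \<and> e * v = v \<and> z * v = 0 \<and>
    (\<forall>k. 0 < k \<longrightarrow> k \<le> j \<longrightarrow> y k * v = SC (\<eta> k) * v \<and> poly (f k) (\<eta> k) = 0)" for j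
  proof (induction j)
    case 0
    then show ?case using v by auto
  next
    case (Suc j)
    then obtain v \<eta> where v: "v \<noteq> 0" "e * v = v" "z * v = 0"
      "\<And>k. \<lbrakk>0 < k; k \<le> j\<rbrakk> \<Longrightarrow> y k * v = SC (\<eta> k) * v \<and> poly (f k) (\<eta> k) = 0" by auto
    let ?n = "Suc j"
    have n: "0 < ?n" "?n \<le> N" "?n \<le> m" using Suc m by auto
    have yA: "y k \<in> A N" if "0 < k" "k \<le> N" for k using that by (intro A_mono[OF y_A]) auto
    have ySC: "SC a * y k = y k * SC a" if "0 < k" "k \<le> N" for a k using A_SC_comm[OF yA[OF that]] by simp
    have "ev (f ?n) (y ?n) * v = ev (f ?n) (y ?n) * e * v" using v(2) by (simp add: mult.assoc)
    then have "ev (f ?n) (y ?n) * v = 0" using f n by simp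
    from eigenvector_exists[OF ySC[OF n(1,2)] _ this v(1)] f n
    obtain c g where cg: "ev g (y ?n) * v \<noteq> 0" "y ?n * (ev g (y ?n) * v) = SC c * (ev g (y ?n) * v)" "poly (f ?n) c = 0"
      by blast
    let ?w = "ev g (y ?n) * v"
    have comm: "w * (ev g (y ?n) * v) = ev g (y ?n) * (w * v)" if "y ?n * w = w * y ?n" "\<And>a. SC a * w = w * SC a" for w
      using ev_comm[of w "y ?n" g] that by (simp add: mult.assoc[symmetric])
    have "e * ?w = ?w" using comm[of e] v(2) SC_e A_unit[OF yA[OF n(1,2)]] by simp
    moreover have "z * ?w = 0" using comm[of z] z n v(3) by simp
    moreover have "y k * ?w = SC (\<eta> k) * ?w" if "0 < k" "k \<le> j" for k
    proof -
      have "y k * ?w = ev g (y ?n) * (SC (\<eta> k) * v)"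
        using comm[of "y k"] ySC[of k] y_y[of ?n k] that n v(4)[OF that] by simp
      also have "\<dots> = SC (\<eta> k) * ?w"
      proof -
        have "ev g (y ?n) * SC (\<eta> k) = SC (\<eta> k) * ev g (y ?n)"
          by (rule ev_comm) (use SC_comm ySC[OF n(1,2)] in auto)
        then show ?thesis by (simp add: mult.assoc[symmetric])
      qed
      finally show ?thesis .
    qed
    ultimately show ?case using cg v(4)
      by (intro exI[of _ ?w] exI[of _ "\<eta>(?n := c)"]) (auto simp: le_Suc_eq)
  qed
  then show ?thesis by blast
qed

end

context hc_resolvent
begin

text \<open>A symmetrisation satisfies \<open>z * C m = D m * z\<close> because \<open>C m\<close>
  and \<open>D m\<close> both square to \<open>e\<close>.\<close>

definition "avg m p = R m * p + D m * R m * p * C m"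

lemma avg_commutes:
  assumes m: "0 < m" "m \<le> N" and p: "e * p = p" "p * e = p" "\<And>a. SC a * p = p * SC a"
    and pA: "\<And>x. x \<in> A (m - 1) \<Longrightarrow> x * p = p * x" and x: "x \<in> A m"
  shows "x * Q m (avg m p) = Q m (avg m p) * x" "e * Q m (avg m p) = Q m (avg m p)"
    "Q m (avg m p) * e = Q m (avg m p)" "SC a * Q m (avg m p) = Q m (avg m p) * SC a"
proof -
  have R: "R m \<in> A m" "R m \<in> A N" using R_A[OF m] A_mono[OF R_A[OF m]] m by auto
  have D: "D m \<in> A m" "D m \<in> A N" using D_A[OF m(1)] A_mono[OF D_A[OF m(1)]] m by auto
  have Cm: "C m \<in> A N" using A_C[of m N] m by simp
  have RC: "C i * R m = R m * C i" if "0 < i" "i \<le> m" for i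
    using R_comm[OF m, of "C i"] y_C[OF m, of i] A_C[of i N] that m by simp
  have RT: "T i * R m = R m * T i" if "0 < i" "Suc i < m" for i
    using R_comm[OF m, of "T i"] y_T[OF m, of i] A_T[of i N] that m by simp
  have eR: "e * R m = R m" "R m * e = R m" "e * D m = D m" "D m * e = D m" "e * C m = C m" "C m * e = C m"
    using A_unit R D Cm by auto
  have SCs: "SC a * R m = R m * SC a" "SC a * D m = D m * SC a" "SC a * C m = C m * SC a" for a
    using A_SC_comm R D Cm by auto
  have pT: "T i * p = p * T i" if "0 < i" "Suc i < m" for i using pA[OF A_T[of i "m - 1"]] that by simp
  have pC: "C i * p = p * C i" if "0 < i" "i < m" for i using pA[OF A_C[of i "m - 1"]] that by simp
  let ?z = "avg m p"
  have z1: "e * ?z = ?z" "?z * e = ?z"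
    using eR p by (simp_all add: avg_def distrib_left distrib_right mult.assoc) (simp_all add: mult.assoc[symmetric] eR)
  have z2: "SC a * ?z = ?z * SC a" for a
    using commute_mult[OF SCs(1) p(3), of a] commute_mult[OF SCs(2) commute_mult[OF SCs(1) commute_mult[OF p(3) SCs(3)]], of a]
    by (simp add: avg_def distrib_left distrib_right mult.assoc)
  have z3: "T i * ?z = ?z * T i" if "0 < i" "Suc i < m" for i
  proof -
    have 1: "T i * D m = D m * T i" using D_T[of m i] that m by simp
    have 2: "T i * C m = C m * T i" using TC_far[of i m] that m by simp
    show ?thesis
      using commute_mult[OF RT pT, OF that that] commute_mult[OF 1 commute_mult[OF RT[OF that] commute_mult[OF pT[OF that] 2]]]
      by (simp add: avg_def distrib_left distrib_right mult.assoc)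
  qed
  have z4: "C i * ?z = ?z * C i" if "0 < i" "i < m" for i
  proof -
    have 1: "C i * D m = - (D m * C i)" using D_C[of m i] that m by simp
    have 2: "C i * C m = - (C m * C i)" using C_anti[of i m] that m by simp
    have r: "C i * R m = R m * C i" using RC[of i] that by simp
    have 3: "C i * (R m * p * C m) = - ((R m * p * C m) * C i)"
      using commute_mult[OF r pC[OF that]] by (simp add: mult.assoc[symmetric]) (simp add: mult.assoc 2)
    show ?thesis
      using commute_mult[OF r pC[OF that]] commute_mult_of_anticommute[OF 1 3]
      by (simp add: avg_def distrib_left distrib_right mult.assoc)
  qed
  have z5: "?z * C m = D m * ?z"
    using CC[of m] DD[of m] m eR p
    by (simp add: avg_def distrib_left distrib_right mult.assoc[symmetric]) (simp add: mult.assoc)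
  show "x * Q m ?z = Q m ?z * x" "e * Q m ?z = Q m ?z" "Q m ?z * e = Q m ?z" "SC a * Q m ?z = Q m ?z * SC a"
    by (rule Casimir[OF m z1 z2 z3 z4 z5 x]; assumption)+
qed

lemma Gam_avg: assumes "0 < m" "m \<le> N" shows "Gam m = Q m (avg m e)"
proof -
  have "R m * D m = D m * R m"
    using R_comm[OF assms A_mono[OF D_A]] y_D assms by simp
  then show ?thesis
    using A_unit[OF R_A[OF assms]] assms by (simp add: Gam_def avg_def distrib_left mult.assoc[symmetric]) (simp add: mult.assoc)
qed

lemma Gam_comm: "\<lbrakk>0 < m; m \<le> N; x \<in> A m\<rbrakk> \<Longrightarrow> x * Gam m = Gam m * x"
  using avg_commutes(1)[of m e x] A_unit[OF A_mono[of _ "m - 1" N]] by (simp add: Gam_avg ee SC_e)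

end

lemma (in hc_resolvent) K_eigen:
  assumes v: "e * v = v" and \<eta>: "\<And>k. \<lbrakk>0 < k; k \<le> m\<rbrakk> \<Longrightarrow> y k * v = SC (\<eta> k) * v \<and> s \<noteq> \<eta> k"
    and m: "0 < m" "m \<le> N"
  shows "K m * v = SC (\<Prod>k<m. 1 - (q - inverse q)\<^sup>2 * (s * \<eta> (Suc k) - 4) / (s - \<eta> (Suc k))\<^sup>2) * v"
proof -
  define fac where "fac c = 1 - (q - inverse q)\<^sup>2 * (s * c - 4) / (s - c)\<^sup>2" for c
  have Rv: "R k * v = SC (inverse (s - \<eta> k)) * v" if k: "0 < k" "k \<le> m" for k
  proof -
    have kN: "k \<le> N" using k m by simp
    have "(SC s * e - y k) * v = SC (s - \<eta> k) * v"
      using SC_add[of "s - \<eta> k" "\<eta> k"] v \<eta>[OF k] by (simp add: left_diff_distrib distrib_right mult.assoc)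
    then have "R k * (SC s * e - y k) * v = R k * SC (s - \<eta> k) * v" by (simp add: mult.assoc)
    then have "v = SC (s - \<eta> k) * (R k * v)"
      using R_inv(2)[OF k(1) kN] v A_SC_comm[OF R_A[OF k(1) kN] kN] by (simp add: mult.assoc)
    then have "SC (inverse (s - \<eta> k)) * v = SC (inverse (s - \<eta> k)) * (SC (s - \<eta> k) * (R k * v))" by simp
    also have "\<dots> = R k * v"
      using \<eta>[OF k] by (simp add: mult.assoc[symmetric] SC_mult[symmetric] SC_1)
    finally show ?thesis by simp
  qed
  have four: "SC 4 * w = w + w + w + w" for w
    using SC_add[of 1 1] SC_add[of 2 2] by (simp add: SC_1 distrib_right del: one_add_one)
  have SCm: "SC (a - b) = SC a - SC b" for a b using SC_add[of "a - b" b] by simp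
  have fac: "(e - eps * eps * (SC s * y k - (e + e + e + e)) * R k * R k) * v = SC (fac (\<eta> k)) * v"
    if k: "0 < k" "k \<le> m" for k
  proof -
    have RSC: "R k * SC a = SC a * R k" for a using A_SC_comm[OF R_A[of k]] k m by simp
    have ySC: "y k * SC a = SC a * y k" for a using A_SC_comm[OF y_A[of k]] k m by simp
    let ?i = "inverse (s - \<eta> k)"
    have RR: "R k * (R k * v) = SC (?i * ?i) * v"
      using Rv[OF k] RSC by (simp add: mult.assoc[symmetric] SC_mult) (simp add: mult.assoc Rv[OF k])
    have "(SC s * y k - (e + e + e + e)) * (SC c * v) = SC c * (SC (s * \<eta> k - 4) * v)" for c
    proof -
      have "(SC s * y k - (e + e + e + e)) * (SC c * v) = SC s * (y k * (SC c * v)) - (e * (SC c * v) + e * (SC c * v) + e * (SC c * v) + e * (SC c * v))"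
        by (simp add: left_diff_distrib distrib_right mult.assoc)
      also have "y k * (SC c * v) = SC c * (SC (\<eta> k) * v)" using ySC \<eta>[OF k] by (metis mult.assoc)
      also have "e * (SC c * v) = SC c * v" using v SC_e by (metis mult.assoc)
      also have "SC s * (SC c * (SC (\<eta> k) * v)) = SC c * (SC (s * \<eta> k) * v)"
        by (metis SC_mult SC_comm mult.assoc)
      finally show ?thesis by (simp add: SCm four left_diff_distrib right_diff_distrib distrib_left distrib_right)
    qed
    then have "(e - eps * eps * (SC s * y k - (e + e + e + e)) * R k * R k) * v = v - eps * (eps * (SC (?i * ?i) * (SC (s * \<eta> k - 4) * v)))"
      by (simp add: left_diff_distrib mult.assoc v RR)
    also have "\<dots> = SC (1 - (q - inverse q) * ((q - inverse q) * (?i * ?i * (s * \<eta> k - 4)))) * v"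
      by (simp only: SCm SC_1 SC_mult left_diff_distrib mult.assoc mult_1_left)
    also have "1 - (q - inverse q) * ((q - inverse q) * (?i * ?i * (s * \<eta> k - 4))) = fac (\<eta> k)"
      using \<eta>[OF k] by (simp add: fac_def power2_eq_square divide_inverse)
    finally show ?thesis .
  qed
  have "K j * v = SC (\<Prod>k<j. fac (\<eta> (Suc k))) * v" if "0 < j" "j \<le> m" for j
    using that
  proof (induction j rule: nat_induct_non_zero)
    case 1
    then show ?case using trace_formula_1 fac[of 1] m by simp
  next
    case (Suc j)
    have "K (Suc j) * v = (e - eps * eps * (SC s * y (Suc j) - (e + e + e + e)) * R (Suc j) * R (Suc j)) * (SC (\<Prod>k<j. fac (\<eta> (Suc k))) * v)"
      using trace_formula_Suc[of j] Suc m by (simp add: mult.assoc)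
    also have "\<dots> = SC (\<Prod>k<j. fac (\<eta> (Suc k))) * ((e - eps * eps * (SC s * y (Suc j) - (e + e + e + e)) * R (Suc j) * R (Suc j)) * v)"
    proof -
      have in_A: "e - eps * eps * (SC s * y (Suc j) - (e + e + e + e)) * R (Suc j) * R (Suc j) \<in> A (Suc j)"
        using R_A[of "Suc j"] y_A[of "Suc j"] Suc m
        by (intro A_diff A_e, simp only: mult.assoc, intro A_SC A_mult A_diff A_add A_e) auto
      have "Suc j \<le> N" using Suc m by simp
      then show ?thesis by (rule trans[OF mult_left_absorb[OF A_SC_comm[OF in_A]] mult.assoc])
    qed
    also have "\<dots> = SC (\<Prod>k<Suc j. fac (\<eta> (Suc k))) * v"
      using fac[of "Suc j"] Suc by (simp add: SC_mult mult.assoc)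
    finally show ?case .
  qed
  then show ?thesis using m by (simp add: fac_def)
qed

context hc_rep_closed
begin

text \<open>The eigenvalues of each \<open>y k\<close> lie among the roots of a fixed polynomial, so
  there are finitely many tuples, and by \<open>H\<close> each of them excludes finitely many
  \<open>s\<close>. A vector killed by \<open>Gam m\<close> is fixed by \<open>K m\<close>; a joint
  eigenvector of this kind would make the product of the trace formula equal to 1 at
  \<open>s\<close>.\<close>

lemma good_resolvent:
  assumes H: "\<And>m \<eta>. \<lbrakk>0 < m; m \<le> N\<rbrakk> \<Longrightarrow>
    (\<Prod>k<m. [:- \<eta> k, 1:]\<^sup>2 - smult ((q - inverse q)\<^sup>2) [:- 4, \<eta> k:]) \<noteq> (\<Prod>k<m. [:- \<eta> k, 1:]\<^sup>2)"
  obtains s R where "hc_resolvent SC e T C q N s R"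
    "\<And>m. \<lbrakk>0 < m; m \<le> N\<rbrakk> \<Longrightarrow> \<exists>w\<in>A m. hc_resolvent.Gam SC e T C q R m * w = e \<and> w * hc_resolvent.Gam SC e T C q R m = e"
proof -
  have "\<forall>k\<in>{1..N}. \<exists>f. f \<noteq> 0 \<and> ev f (y k) * e = 0"
    using A_algebraic[OF y_A] by auto
  from bchoice[OF this] obtain f where "\<forall>k\<in>{1..N}. f k \<noteq> 0 \<and> ev (f k) (y k) * e = 0" by blast
  then have f: "f k \<noteq> 0 \<and> ev (f k) (y k) * e = 0" if "0 < k" "k \<le> N" for k
    using that by simp
  define Z where "Z k = {c. poly (f k) c = 0}" for k
  have Zfin: "finite (Z k)" if "0 < k" "k \<le> N" for k
    unfolding Z_def using f[OF that] poly_roots_finite by blast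
  define Pol where "Pol m \<eta> = (\<Prod>k<m. [:- \<eta> k, 1:]\<^sup>2 - smult ((q - inverse q)\<^sup>2) [:- 4, \<eta> k:]) - (\<Prod>k<m. [:- \<eta> k, 1:]\<^sup>2)"
    for m :: nat and \<eta> :: "nat \<Rightarrow> 'a"
  \<comment> \<open>The first union guarantees the resolvents, the second the injectivity of every
    \<open>Gam m\<close>. Tuples are indexed from 0 and the \<open>y k\<close> from 1, hence
    \<open>Z (Suc k)\<close>.\<close>
  define bad where "bad = (\<Union>k\<in>{1..N}. Z k) \<union> (\<Union>m\<in>{1..N}. \<Union>\<eta>\<in>PiE {..<m} (\<lambda>k. Z (Suc k)). {c. poly (Pol m \<eta>) c = 0})"
  have "finite bad" unfolding bad_def
  proof (intro finite_UnI finite_UN_I)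
    fix m \<eta> assume "m \<in> {1..N}"
    then show "finite {c. poly (Pol m \<eta>) c = 0}"
      using H[of m \<eta>] by (intro poly_roots_finite) (simp add: Pol_def)
  qed (auto intro!: Zfin finite_PiE)
  then obtain s where s: "s \<notin> bad" using alg_closed_infinite by (metis UNIV_I ex_new_if_finite)
  have sZ: "s \<noteq> c" if "0 < k" "k \<le> N" "poly (f k) c = 0" for k c
    using s that by (force simp: bad_def Z_def)
  have yA: "y k \<in> A N" if "0 < k" "k \<le> N" for k using that by (intro A_mono[OF y_A]) auto
  have ySC: "SC a * y k = y k * SC a" if "0 < k" "k \<le> N" for a k using A_SC_comm[OF yA[OF that]] by simp
  have "\<exists>w\<in>A k. (SC s * e - y k) * w = e \<and> w * (SC s * e - y k) = e" if k: "k \<in> {1..N}" for k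
  proof (rule A_invertible)
    show "SC s * e - y k \<in> A k" using k by (intro A_diff A_SC A_e y_A) auto
    show "k \<le> N" using k by simp
    fix v assume v: "e * v = v" "(SC s * e - y k) * v = 0"
    then have "y k * v = SC s * v" by (simp add: left_diff_distrib mult.assoc)
    then have "ev (f k) (y k) * v = SC (poly (f k) s) * v"
      using ySC k by (intro ev_eigen) auto
    moreover have "ev (f k) (y k) * v = (ev (f k) (y k) * e) * v" using v by (simp add: mult.assoc)
    ultimately have "SC (poly (f k) s) * v = 0" using f[of k] k by simp
    moreover have "poly (f k) s \<noteq> 0" using sZ[of k s] k by auto
    ultimately show "v = 0" using SC_cancel by blast
  qed
  then have "\<forall>k\<in>{1..N}. \<exists>w. w \<in> A k \<and> (SC s * e - y k) * w = e \<and> w * (SC s * e - y k) = e" by blast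
  from bchoice[OF this] obtain R where
    "\<forall>k\<in>{1..N}. R k \<in> A k \<and> (SC s * e - y k) * R k = e \<and> R k * (SC s * e - y k) = e" by blast
  then have R: "R k \<in> A k \<and> (SC s * e - y k) * R k = e \<and> R k * (SC s * e - y k) = e" if "0 < k" "k \<le> N" for k
    using that by simp
  interpret res: hc_resolvent SC e T C q N s R
    by unfold_locales (use R in auto)
  have inv: "\<exists>w\<in>A m. res.Gam m * w = e \<and> w * res.Gam m = e" if m: "0 < m" "m \<le> N" for m
  proof (rule A_invertible)
    show G: "res.Gam m \<in> A m" using res.Gam_A m by simp
    show "m \<le> N" by fact
    fix v assume v: "e * v = v" "res.Gam m * v = 0"
    show "v = 0"
    proof (rule ccontr)
      assume "v \<noteq> 0"
      have Gc: "x * res.Gam m = res.Gam m * x" if "x \<in> A m" for x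
        using res.Gam_comm m that by simp
      have "\<exists>v \<eta>. v \<noteq> 0 \<and> e * v = v \<and> res.Gam m * v = 0 \<and>
         (\<forall>k. 0 < k \<longrightarrow> k \<le> m \<longrightarrow> y k * v = SC (\<eta> k) * v \<and> poly (f k) (\<eta> k) = 0)"
      proof (rule joint_eigenvector[OF f])
        show "y k * res.Gam m = res.Gam m * y k" if "0 < k" "k \<le> m" for k
          using Gc[of "y k"] A_mono[OF y_A[OF that(1)] that(2)] by simp
        show "SC a * res.Gam m = res.Gam m * SC a" for a using A_SC_comm[OF G m(2)] by simp
      qed (use v m \<open>v \<noteq> 0\<close> in auto)
      then obtain v \<eta> where v: "v \<noteq> 0" "e * v = v" "res.Gam m * v = 0"
        and \<eta>: "\<And>k. \<lbrakk>0 < k; k \<le> m\<rbrakk> \<Longrightarrow> y k * v = SC (\<eta> k) * v \<and> poly (f k) (\<eta> k) = 0" by blast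
      have neq: "s \<noteq> \<eta> k" if "0 < k" "k \<le> m" for k using sZ[of k "\<eta> k"] \<eta>[OF that] that m by auto
      let ?pr = "\<Prod>k<m. 1 - (q - inverse q)\<^sup>2 * (s * \<eta> (Suc k) - 4) / (s - \<eta> (Suc k))\<^sup>2"
      have "res.K m * v = SC ?pr * v"
        using v(2) \<eta> neq m by (intro res.K_eigen) auto
      moreover have "res.K m * v = v"
        using v by (simp add: res.K_def left_diff_distrib mult.assoc)
      ultimately have "SC (?pr - 1) * v = 0"
        using SC_add[of "?pr - 1" 1] by (simp add: SC_1 distrib_right)
      then have "?pr - 1 = 0" using SC_cancel[of "?pr - 1" v] v(1) by blast
      then have "?pr = 1" by (simp only: right_minus_eq)
      define \<eta>' where "\<eta>' = restrict (\<lambda>k. \<eta> (Suc k)) {..<m}"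
      have mem: "\<eta>' \<in> PiE {..<m} (\<lambda>k. Z (Suc k))"
        using \<eta> by (auto simp: \<eta>'_def Z_def)
      have mult_1_minus_div: "D * (1 - X / D) = D - X" if "D \<noteq> 0" for D X :: 'a
        using that by (simp add: right_diff_distrib)
      have "poly (\<Prod>k<m. [:- \<eta>' k, 1:]\<^sup>2 - smult ((q - inverse q)\<^sup>2) [:- 4, \<eta>' k:]) s
         = (\<Prod>k<m. (s - \<eta> (Suc k))\<^sup>2 * (1 - (q - inverse q)\<^sup>2 * (s * \<eta> (Suc k) - 4) / (s - \<eta> (Suc k))\<^sup>2))"
        unfolding poly_prod
      proof (rule prod.cong)
        fix k assume "k \<in> {..<m}"
        then have "s - \<eta> (Suc k) \<noteq> 0" "\<eta>' k = \<eta> (Suc k)" using neq[of "Suc k"] by (auto simp: \<eta>'_def)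
        then show "poly ([:- \<eta>' k, 1:]\<^sup>2 - smult ((q - inverse q)\<^sup>2) [:- 4, \<eta>' k:]) s
           = (s - \<eta> (Suc k))\<^sup>2 * (1 - (q - inverse q)\<^sup>2 * (s * \<eta> (Suc k) - 4) / (s - \<eta> (Suc k))\<^sup>2)"
          by (simp add: mult_1_minus_div) (simp add: algebra_simps)
      qed simp
      also have "\<dots> = (\<Prod>k<m. (s - \<eta> (Suc k))\<^sup>2) * ?pr" by (rule prod.distrib)
      also have "\<dots> = poly (\<Prod>k<m. [:- \<eta>' k, 1:]\<^sup>2) s"
        unfolding \<open>?pr = 1\<close> poly_prod by (simp add: \<eta>'_def)
      finally have "poly (Pol m \<eta>') s = 0" by (simp add: Pol_def)
      then have "s \<in> bad" using mem m by (auto simp: bad_def)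
      then show False using s by simp
    qed
  qed
  show ?thesis by (rule that[OF res.hc_resolvent_axioms inv])
qed

text \<open>\<open>p0\<close> is a linear projection onto a submodule; the two equations for
  \<open>p\<close> say that \<open>p\<close> maps into that submodule and is the identity on it.
  Both survive averaging because the submodule is stable. In each step a projection commuting with
  \<open>A m\<close> is averaged at level \<open>Suc m\<close> and divided by the central element
  \<open>Gam (Suc m)\<close>.\<close>

lemma equivariant_projection:
  assumes H: "\<And>m \<eta>. \<lbrakk>0 < m; m \<le> N\<rbrakk> \<Longrightarrow>
    (\<Prod>k<m. [:- \<eta> k, 1:]\<^sup>2 - smult ((q - inverse q)\<^sup>2) [:- 4, \<eta> k:]) \<noteq> (\<Prod>k<m. [:- \<eta> k, 1:]\<^sup>2)"
    and p0: "e * p0 = p0" "p0 * e = p0" "p0 * p0 = p0" "\<And>a. SC a * p0 = p0 * SC a"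
    "\<And>i. \<lbrakk>0 < i; i < N\<rbrakk> \<Longrightarrow> T i * p0 = p0 * (T i * p0)"
    "\<And>i. \<lbrakk>0 < i; i \<le> N\<rbrakk> \<Longrightarrow> C i * p0 = p0 * (C i * p0)"
  shows "\<exists>p. p0 * p = p \<and> p * p0 = p0 \<and> (\<forall>x\<in>A N. x * p = p * x)"
proof -
  obtain s R where res: "hc_resolvent SC e T C q N s R"
    and inv: "\<And>m. \<lbrakk>0 < m; m \<le> N\<rbrakk> \<Longrightarrow> \<exists>w\<in>A m. hc_resolvent.Gam SC e T C q R m * w = e \<and> w * hc_resolvent.Gam SC e T C q R m = e"
    using good_resolvent[OF H] by blast
  interpret res: hc_resolvent SC e T C q N s R by (rule res)
  have Ap0: "x * p0 = p0 * (x * p0)" if "x \<in> A N" for x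
    using that
  proof (induction rule: A.induct)
    case (A_mult x y)
    have "x * y * p0 = x * p0 * (y * p0)" using A_mult by (simp add: mult.assoc)
    also have "\<dots> = p0 * (x * p0) * (y * p0)" by (simp only: A_mult(3)[symmetric])
    also have "\<dots> = p0 * (x * p0 * (y * p0))" by (simp only: mult.assoc)
    also have "x * p0 * (y * p0) = x * (p0 * (y * p0))" by (simp only: mult.assoc)
    also have "\<dots> = x * y * p0" by (simp only: A_mult(4)[symmetric] mult.assoc)
    finally show ?case .
  next
    case (A_SC x a)
    then show ?case by (metis p0(4) mult.assoc)
  qed (use p0 in \<open>auto simp: distrib_left distrib_right\<close>)
  have Q_range: "p0 * Q m z = Q m z" if "p0 * z = z" "m \<le> N" for m z
    using that
  proof (induction m arbitrary: z)
    case (Suc m)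
    show ?case
    proof (cases "m = 0")
      case False
      then have "p0 * (T m * z) = T m * z"
        using Suc.prems by (intro stable_left p0(5)) auto
      then have "p0 * (T m * z * T m) = T m * z * T m" by (simp add: mult.assoc[symmetric])
      then show ?thesis using Suc by (simp add: distrib_left)
    qed (use Suc in simp)
  qed simp
  have Q_restrict: "Q m z * p0 = Q m z' * p0" if "z * p0 = z' * p0" "m \<le> N" for m z z'
    using that
  proof (induction m arbitrary: z z')
    case (Suc m)
    show ?case
    proof (cases "m = 0")
      case False
      then have "z * T m * p0 = z' * T m * p0"
        using Suc.prems by (intro stable_right p0(5)) auto
      then have "T m * z * T m * p0 = T m * z' * T m * p0" by (simp add: mult.assoc)
      then have "Q m (T m * z * T m) * p0 = Q m (T m * z' * T m) * p0"
        by (rule Suc.IH) (use Suc.prems in simp)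
      then show ?thesis using Suc.prems by (simp add: distrib_right)
    qed (use Suc in simp)
  qed simp
  have "m \<le> N \<Longrightarrow> \<exists>p. p0 * p = p \<and> p * p0 = p0 \<and> p * e = p \<and> (\<forall>a. SC a * p = p * SC a) \<and> (\<forall>x\<in>A m. x * p = p * x)" for m
  proof (induction m)
    case 0
    have "x * p0 = p0 * x" if "x \<in> A 0" for x
      by (rule A_comm[OF that]) (use p0 in auto)
    then show ?case using p0 by blast
  next
    case (Suc m)
    let ?n = "Suc m"
    from Suc obtain p where p: "p0 * p = p" "p * p0 = p0" "p * e = p" "\<And>a. SC a * p = p * SC a"
      "\<And>x. x \<in> A m \<Longrightarrow> x * p = p * x" by auto
    have ep: "e * p = p" using mult_left_absorb[OF p0(1), of p] p(1) by simp
    have n: "0 < ?n" "?n \<le> N" using Suc by auto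
    obtain w where w: "w \<in> A ?n" "w * res.Gam ?n = e" using inv[OF n] by blast
    define P where "P = Q ?n (res.avg ?n p)"
    have comm: "x * P = P * x" "SC a * P = P * SC a" "P * e = P" if "x \<in> A ?n" for x a
      unfolding P_def using res.avg_commutes[OF n ep p(3) p(4) _ that] p(5) by auto
    have RN: "R ?n \<in> A N" "D ?n \<in> A N" "w \<in> A N" "C ?n \<in> A N"
      using A_mono[OF res.R_A[OF n] n(2)] A_mono[OF D_A[OF n(1)] n(2)] A_mono[OF w(1) n(2)] A_C[OF n] A_C[of ?n N] n by auto
    have stable: "p0 * (x * (p * z)) = x * (p * z)" if "x \<in> A N" for x z
      using Ap0[OF that] by (rule stable_left) (simp add: mult.assoc[symmetric] p(1))
    have "p0 * res.avg ?n p = res.avg ?n p"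
      using stable[of "R ?n" 1] stable[of "D ?n * R ?n" "C ?n"] A_mult[of "D ?n" N "R ?n"] RN
      by (simp add: res.avg_def distrib_left mult.assoc)
    then have P_range: "p0 * P = P" unfolding P_def using n by (intro Q_range) auto
    \<comment> \<open>On the submodule \<open>p\<close> acts as the identity, so there the averaged
      \<open>p\<close> agrees with the averaged identity, which is \<open>Gam\<close>.\<close>
    have "res.avg ?n p * p0 = res.avg ?n e * p0"
    proof -
      have "p * (C ?n * p0) = p * (p0 * (C ?n * p0))" using Ap0[OF RN(4)] by simp
      also have "\<dots> = C ?n * p0" unfolding mult.assoc[symmetric] p(2) using Ap0[OF RN(4)] by (simp add: mult.assoc)
      finally have "p * (C ?n * p0) = C ?n * p0" .
      then show ?thesis using p(2) p0(1) A_unit[OF RN(4)] by (simp add: res.avg_def distrib_right mult.assoc)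
    qed
    then have "P * p0 = res.Gam ?n * p0"
      unfolding P_def res.Gam_avg[OF n] using n by (intro Q_restrict) auto
    then have "(w * P) * p0 = p0" using mult_left_absorb[OF w(2), of p0] p0(1) by (simp add: mult.assoc)
    moreover have "p0 * (w * P) = w * P" using Ap0[OF RN(3)] P_range by (rule stable_left)
    moreover have "(w * P) * e = w * P" using comm(3)[OF w(1)] by (simp add: mult.assoc)
    moreover have "SC a * (w * P) = (w * P) * SC a" for a
      by (rule commute_mult) (use comm(2)[OF w(1)] A_SC_comm[OF RN(3)] in auto)
    moreover have "x * (w * P) = (w * P) * x" if "x \<in> A ?n" for x
    proof -
      have "w * res.Gam ?n * x * w = w * x * (res.Gam ?n * w)"
        using mult_left_absorb[OF res.Gam_comm[OF n that], of w] by (simp add: mult.assoc)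
      moreover have "res.Gam ?n * w = e"
        using res.Gam_comm[OF n w(1)] w(2) by simp
      ultimately have "x * w = w * x"
        using w(2) A_unit[OF A_mult[OF w(1) that] n(2)] A_unit[OF A_mult[OF that w(1)] n(2)] by (simp add: mult.assoc)
      then show ?thesis using comm(1)[OF that] by (rule commute_mult)
    qed
    ultimately show ?case by blast
  qed
  from this[of N] show ?thesis by blast
qed

end

section \<open>Complements of left ideals\<close>

context ring
begin

lemma left_idealI:
  assumes "L \<subseteq> carrier R" "\<zero> \<in> L" "\<And>x y. \<lbrakk>x \<in> L; y \<in> L\<rbrakk> \<Longrightarrow> x \<oplus> y \<in> L"
    "\<And>a x. \<lbrakk>a \<in> carrier R; x \<in> L\<rbrakk> \<Longrightarrow> a \<otimes> x \<in> L"
  shows "left_ideal L R"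
proof -
  have "\<ominus> x \<in> L" if "x \<in> L" for x
    using assms(4)[of "\<ominus> \<one>" x] that assms(1) by (auto simp: l_minus)
  then have "subgroup L (add_monoid R)"
    using assms by (intro add.subgroupI) (auto simp: a_inv_def[symmetric])
  then show ?thesis using assms(4) by (auto simp: left_ideal_def intro: additive_subgroupI)
qed

lemma left_idealD:
  assumes "left_ideal L R"
  shows "L \<subseteq> carrier R" "\<zero> \<in> L" "\<lbrakk>x \<in> L; y \<in> L\<rbrakk> \<Longrightarrow> x \<oplus> y \<in> L"
    "\<lbrakk>a \<in> carrier R; x \<in> L\<rbrakk> \<Longrightarrow> a \<otimes> x \<in> L" "x \<in> L \<Longrightarrow> \<ominus> x \<in> L" "\<lbrakk>x \<in> L; y \<in> L\<rbrakk> \<Longrightarrow> x \<ominus> y \<in> L"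
proof -
  interpret additive_subgroup L R using assms by (simp add: left_ideal_def)
  show sub: "L \<subseteq> carrier R" by (rule a_subset)
  show "\<zero> \<in> L" by simp
  show "\<lbrakk>x \<in> L; y \<in> L\<rbrakk> \<Longrightarrow> x \<oplus> y \<in> L" by simp
  show m: "\<And>a x. \<lbrakk>a \<in> carrier R; x \<in> L\<rbrakk> \<Longrightarrow> a \<otimes> x \<in> L" using assms by (simp add: left_ideal_def)
  show n: "\<And>x. x \<in> L \<Longrightarrow> \<ominus> x \<in> L" using m[of "\<ominus> \<one>"] sub by (force simp: l_minus)
  show "\<lbrakk>x \<in> L; y \<in> L\<rbrakk> \<Longrightarrow> x \<ominus> y \<in> L" using n by (simp add: a_minus_def)
qed

lemma left_ideal_zero: "left_ideal {\<zero>} R"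
  by (rule left_idealI) auto

lemma left_ideal_Int: "left_ideal L R \<Longrightarrow> left_ideal M R \<Longrightarrow> left_ideal (L \<inter> M) R"
  by (rule left_idealI) (auto dest: left_idealD)

lemma left_ideal_add: assumes "left_ideal L R" "left_ideal M R"
  shows "left_ideal {x \<oplus> y | x y. x \<in> L \<and> y \<in> M} R"
proof (rule left_idealI)
  note L = left_idealD[OF assms(1)] and M = left_idealD[OF assms(2)]
  show "{x \<oplus> y | x y. x \<in> L \<and> y \<in> M} \<subseteq> carrier R" using L(1) M(1) by auto
  show "\<zero> \<in> {x \<oplus> y | x y. x \<in> L \<and> y \<in> M}" using L(2) M(2) by (force intro: exI[of _ \<zero>])
  fix u v assume "u \<in> {x \<oplus> y | x y. x \<in> L \<and> y \<in> M}" "v \<in> {x \<oplus> y | x y. x \<in> L \<and> y \<in> M}"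
  then obtain a b c d where "u = a \<oplus> b" "v = c \<oplus> d" "a \<in> L" "b \<in> M" "c \<in> L" "d \<in> M" by auto
  moreover from this have "a \<oplus> b \<oplus> (c \<oplus> d) = (a \<oplus> c) \<oplus> (b \<oplus> d)"
    using L(1) M(1) by (simp add: a_ac subset_iff)
  ultimately have "u \<oplus> v = (a \<oplus> c) \<oplus> (b \<oplus> d)" "a \<oplus> c \<in> L" "b \<oplus> d \<in> M" using L(3) M(3) by auto
  then show "u \<oplus> v \<in> {x \<oplus> y | x y. x \<in> L \<and> y \<in> M}" by (intro CollectI exI[of _ "a \<oplus> c"] exI[of _ "b \<oplus> d"]) simp
next
  note L = left_idealD[OF assms(1)] and M = left_idealD[OF assms(2)]
  fix a u assume a: "a \<in> carrier R" and "u \<in> {x \<oplus> y | x y. x \<in> L \<and> y \<in> M}"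
  then obtain x y where xy: "u = x \<oplus> y" "x \<in> L" "y \<in> M" by auto
  then have "a \<otimes> u = a \<otimes> x \<oplus> a \<otimes> y" using a L(1) M(1) by (simp add: subset_iff r_distr)
  then show "a \<otimes> u \<in> {x \<oplus> y | x y. x \<in> L \<and> y \<in> M}"
    using xy a L(4) M(4) by (intro CollectI exI[of _ "a \<otimes> x"] exI[of _ "a \<otimes> y"]) simp
qed

lemma left_ideal_principal: "x \<in> carrier R \<Longrightarrow> left_ideal {a \<otimes> x | a. a \<in> carrier R} R"
proof (rule left_idealI)
  assume x: "x \<in> carrier R"
  show "\<zero> \<in> {a \<otimes> x | a. a \<in> carrier R}" using x by (auto intro: exI[of _ \<zero>])
  show "u \<oplus> v \<in> {a \<otimes> x | a. a \<in> carrier R}" if "u \<in> {a \<otimes> x | a. a \<in> carrier R}" "v \<in> {a \<otimes> x | a. a \<in> carrier R}" for u v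
    using that x by (auto simp: l_distr[symmetric])
  show "c \<otimes> u \<in> {a \<otimes> x | a. a \<in> carrier R}" if "c \<in> carrier R" "u \<in> {a \<otimes> x | a. a \<in> carrier R}" for c u
    using that x by (auto simp: m_assoc[symmetric])
qed auto

lemma left_ideal_Union_chain:
  assumes "\<C> \<noteq> {}" "subset.chain UNIV \<C>" "\<And>L. L \<in> \<C> \<Longrightarrow> left_ideal L R"
  shows "left_ideal (\<Union>\<C>) R"
proof (rule left_idealI)
  show "\<Union>\<C> \<subseteq> carrier R" "\<zero> \<in> \<Union>\<C>" using assms left_idealD(1,2) by blast+
  show "a \<otimes> x \<in> \<Union>\<C>" if "a \<in> carrier R" "x \<in> \<Union>\<C>" for a x using that assms(3) left_idealD(4) by blast
  fix x y assume "x \<in> \<Union>\<C>" "y \<in> \<Union>\<C>"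
  then obtain L M where "L \<in> \<C>" "M \<in> \<C>" "x \<in> L" "y \<in> M" by auto
  moreover have "L \<subseteq> M \<or> M \<subseteq> L" using assms(2) \<open>L \<in> \<C>\<close> \<open>M \<in> \<C>\<close> by (auto simp: subset.chain_def)
  ultimately show "x \<oplus> y \<in> \<Union>\<C>" using assms(3) left_idealD(3) by (metis UnionI subsetD)
qed

lemma maximal_left_ideal:
  assumes "left_ideal K R" "P K" "\<And>\<C>. \<lbrakk>\<C> \<noteq> {}; subset.chain UNIV \<C>; \<And>L. L \<in> \<C> \<Longrightarrow> left_ideal L R \<and> P L\<rbrakk> \<Longrightarrow> P (\<Union>\<C>)"
  obtains M where "left_ideal M R" "P M" "\<And>L. \<lbrakk>left_ideal L R; P L; M \<subseteq> L\<rbrakk> \<Longrightarrow> L = M"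
proof -
  have "\<exists>M\<in>{L. left_ideal L R \<and> P L}. \<forall>X\<in>{L. left_ideal L R \<and> P L}. M \<subseteq> X \<longrightarrow> X = M"
  proof (rule subset_Zorn)
    fix \<C> assume C: "subset.chain {L. left_ideal L R \<and> P L} \<C>"
    show "\<exists>U\<in>{L. left_ideal L R \<and> P L}. \<forall>X\<in>\<C>. X \<subseteq> U"
    proof (cases "\<C> = {}")
      case True
      then show ?thesis using assms(1,2) by blast
    next
      case False
      have chain: "subset.chain UNIV \<C>" and el: "\<And>L. L \<in> \<C> \<Longrightarrow> left_ideal L R \<and> P L"
        using C by (auto simp: subset.chain_def)
      then have "left_ideal (\<Union>\<C>) R" "P (\<Union>\<C>)"
        using left_ideal_Union_chain[OF False chain] assms(3)[OF False chain] by auto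
      then show ?thesis by blast
    qed
  qed
  then show ?thesis using that by blast
qed

definition complemented :: "'a set \<Rightarrow> bool" where
  "complemented N \<longleftrightarrow> (\<exists>M. left_ideal M R \<and> N \<inter> M = {\<zero>} \<and> (\<forall>x\<in>carrier R. \<exists>a\<in>N. \<exists>b\<in>M. x = a \<oplus> b))"

lemma left_ideal_finsum:
  assumes "left_ideal L R" "finite F" "\<And>i. i \<in> F \<Longrightarrow> f i \<in> L"
  shows "(\<Oplus>i\<in>F. f i) \<in> L"
  using assms(2,3)
proof (induction rule: finite_induct)
  case (insert i F)
  then show ?case using left_idealD[OF assms(1)] by (subst finsum_insert) auto
qed (use left_idealD[OF assms(1)] in simp)

text \<open>A left ideal \<open>M\<close> maximal among those meeting \<open>N\<close> trivially is
  a complement: a simple summand not inside \<open>N + M\<close> would meet it trivially and could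
  be added to \<open>M\<close>.\<close>

lemma semisimple_imp_complemented:
  assumes "semisimple_ring R" "left_ideal N R"
  shows "complemented N"
proof -
  obtain \<L> where simple0: "\<forall>L\<in>\<L>. simple_left_ideal L R" and
    dec0: "\<forall>x\<in>carrier R. \<exists>!f. f \<in> (\<Pi>\<^sub>E L\<in>\<L>. L) \<and> finite {L\<in>\<L>. f L \<noteq> \<zero>} \<and> x = (\<Oplus>L\<in>{L\<in>\<L>. f L \<noteq> \<zero>}. f L)"
    using assms(1) unfolding semisimple_ring_def by (elim conjE exE) (rule that; assumption)
  note simple = bspec[OF simple0]
  note dec = ex1_implies_ex[OF bspec[OF dec0]]
  note N = left_idealD[OF assms(2)]
  obtain M where M: "left_ideal M R" "N \<inter> M = {\<zero>}" and max: "\<And>L. \<lbrakk>left_ideal L R; N \<inter> L = {\<zero>}; M \<subseteq> L\<rbrakk> \<Longrightarrow> L = M"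
  proof (rule maximal_left_ideal[of "{\<zero>}" "\<lambda>M. N \<inter> M = {\<zero>}"])
    show "N \<inter> \<Union>\<C> = {\<zero>}" if "\<C> \<noteq> {}" "\<And>L. L \<in> \<C> \<Longrightarrow> left_ideal L R \<and> N \<inter> L = {\<zero>}" for \<C> :: "'a set set"
      using that by blast
  qed (use left_ideal_zero N(2) in auto)
  note M' = left_idealD[OF M(1)]
  let ?S = "{x \<oplus> y | x y. x \<in> N \<and> y \<in> M}"
  have S: "left_ideal ?S R" by (rule left_ideal_add[OF assms(2) M(1)])
  have MS: "M \<subseteq> ?S"
  proof
    fix y assume "y \<in> M"
    then have "y = \<zero> \<oplus> y" using M'(1) by auto
    then show "y \<in> ?S" using N(2) \<open>y \<in> M\<close> by blast
  qed
  have LS: "L \<subseteq> ?S" if "L \<in> \<L>" for L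
  proof (rule ccontr)
    assume n: "\<not> L \<subseteq> ?S"
    have L: "left_ideal L R" "L \<noteq> {\<zero>}" "\<And>J. \<lbrakk>left_ideal J R; J \<subseteq> L\<rbrakk> \<Longrightarrow> J = {\<zero>} \<or> J = L"
      using simple[OF that] by (auto simp: simple_left_ideal_def)
    note L' = left_idealD[OF L(1)]
    have LS0: "L \<inter> ?S = {\<zero>}" using L(3)[OF left_ideal_Int[OF L(1) S]] n by blast
    let ?M = "{x \<oplus> y | x y. x \<in> M \<and> y \<in> L}"
    have "N \<inter> ?M = {\<zero>}"
    proof -
      have "n = \<zero>" if "n \<in> N" "m \<in> M" "l \<in> L" "n = m \<oplus> l" for n m l
      proof -
        have car: "n \<in> carrier R" "m \<in> carrier R" "l \<in> carrier R" using that N(1) M'(1) L'(1) by auto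
        have "n = l \<oplus> m" using that(4) car a_comm by simp
        then have "l = n \<oplus> \<ominus> m" using car by (simp add: a_assoc r_neg)
        then have "l \<in> ?S" using that(1,2) M'(5) by blast
        then have "l = \<zero>" using LS0 that(3) by blast
        then have "n = m" using that car by simp
        then show ?thesis using M(2) that by blast
      qed
      moreover have "\<zero> \<in> ?M" using left_idealD(2)[OF left_ideal_add[OF M(1) L(1)]] .
      ultimately show ?thesis using N(2) by blast
    qed
    moreover have "M \<subseteq> ?M"
    proof
      fix y assume "y \<in> M"
      then have "y = y \<oplus> \<zero>" using M'(1) by auto
      then show "y \<in> ?M" using L'(2) \<open>y \<in> M\<close> by blast
    qed
    ultimately have "?M = M" using max[OF left_ideal_add[OF M(1) L(1)]] by simp
    moreover have "L \<subseteq> ?M"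
    proof
      fix y assume "y \<in> L"
      then have "y = \<zero> \<oplus> y" using L'(1) by auto
      then show "y \<in> ?M" using M'(2) \<open>y \<in> L\<close> by blast
    qed
    ultimately have "L \<subseteq> M" by simp
    then have "L \<subseteq> ?S" using MS by (rule order_trans)
    with n show False by (rule notE)
  qed
  have "x \<in> ?S" if x: "x \<in> carrier R" for x
  proof -
    obtain f where f: "f \<in> (\<Pi>\<^sub>E L\<in>\<L>. L)" "finite {L\<in>\<L>. f L \<noteq> \<zero>}" "x = (\<Oplus>L\<in>{L\<in>\<L>. f L \<noteq> \<zero>}. f L)"
      using dec[OF x] by (elim exE conjE)
    have "(\<Oplus>L\<in>{L\<in>\<L>. f L \<noteq> \<zero>}. f L) \<in> ?S"
      by (rule left_ideal_finsum[OF S f(2)]) (use f(1) LS in blast)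
    then show ?thesis using f(3) by simp
  qed
  then show ?thesis unfolding complemented_def using M by (intro exI[of _ M]) blast
qed

text \<open>Inside the principal left ideal of \<open>x\<close> choose \<open>K\<close> maximal
  without \<open>x\<close>. The part of a complement of \<open>K\<close> inside that ideal is
  simple: for a nonzero \<open>J\<close> in it, \<open>K + J\<close> contains \<open>x\<close> and
  so everything.\<close>

lemma exists_simple_left_ideal:
  assumes compl: "\<And>N. left_ideal N R \<Longrightarrow> complemented N" and S: "left_ideal S R" "S \<noteq> {\<zero>}"
  obtains L where "simple_left_ideal L R" "L \<subseteq> S"
proof -
  note S' = left_idealD[OF S(1)]
  obtain x where x: "x \<in> S" "x \<noteq> \<zero>" "x \<in> carrier R" using S S' by blast
  define Rx where "Rx = {a \<otimes> x | a. a \<in> carrier R}"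
  have Rx: "left_ideal Rx R" "x \<in> Rx" "Rx \<subseteq> S"
    using left_ideal_principal x S'(4) unfolding Rx_def by (auto intro: exI[of _ \<one>])
  note Rx' = left_idealD[OF Rx(1)]
  obtain K where K: "left_ideal K R" "K \<subseteq> Rx \<and> x \<notin> K" and max: "\<And>L. \<lbrakk>left_ideal L R; L \<subseteq> Rx \<and> x \<notin> L; K \<subseteq> L\<rbrakk> \<Longrightarrow> L = K"
    by (rule maximal_left_ideal[of "{\<zero>}" "\<lambda>L. L \<subseteq> Rx \<and> x \<notin> L"]) (use left_ideal_zero x Rx' in auto)
  note K' = left_idealD[OF K(1)]
  obtain K2 where K2: "left_ideal K2 R" "K \<inter> K2 = {\<zero>}" "\<And>x. x \<in> carrier R \<Longrightarrow> \<exists>a\<in>K. \<exists>b\<in>K2. x = a \<oplus> b"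
    using compl[OF K(1)] by (auto simp: complemented_def)
  note K2' = left_idealD[OF K2(1)]
  define M where "M = K2 \<inter> Rx"
  have M: "left_ideal M R" unfolding M_def by (rule left_ideal_Int[OF K2(1) Rx(1)])
  have "M \<noteq> {\<zero>}"
  proof
    assume M0: "M = {\<zero>}"
    obtain a b where ab: "a \<in> K" "b \<in> K2" "x = a \<oplus> b" using K2(3)[OF x(3)] by blast
    have car: "a \<in> carrier R" "b \<in> carrier R" using ab K'(1) K2'(1) by auto
    have "x = b \<oplus> a" using ab(3) car a_comm by simp
    then have "b = x \<ominus> a" using car by (simp add: a_minus_def a_assoc r_neg)
    then have "b \<in> Rx" using Rx'(6)[of x a] Rx(2) K(2) ab(1) by auto
    then have "b = \<zero>" using M0 ab(2) M_def by auto
    then show False using ab car K(2) by auto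
  qed
  moreover have "J = {\<zero>} \<or> J = M" if J: "left_ideal J R" "J \<subseteq> M" for J
  proof (rule ccontr)
    assume n: "\<not> (J = {\<zero>} \<or> J = M)"
    note J' = left_idealD[OF J(1)]
    let ?KJ = "{x \<oplus> y | x y. x \<in> K \<and> y \<in> J}"
    have KJ: "left_ideal ?KJ R" by (rule left_ideal_add[OF K(1) J(1)])
    have sub: "?KJ \<subseteq> Rx" using K(2) J(2) by (auto simp: M_def intro!: Rx'(3))
    have KKJ: "K \<subseteq> ?KJ"
    proof
      fix y assume "y \<in> K"
      then have "y = y \<oplus> \<zero>" using K'(1) by auto
      then show "y \<in> ?KJ" using J'(2) \<open>y \<in> K\<close> by blast
    qed
    have JKJ: "J \<subseteq> ?KJ"
    proof
      fix y assume "y \<in> J"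
      then have "y = \<zero> \<oplus> y" using J'(1) by auto
      then show "y \<in> ?KJ" using K'(2) \<open>y \<in> J\<close> by blast
    qed
    have "x \<in> ?KJ"
    proof (rule ccontr)
      assume "x \<notin> ?KJ"
      then have "?KJ = K" using max[OF KJ] sub KKJ by blast
      then have "J \<subseteq> K" using JKJ by simp
      then have "J \<subseteq> {\<zero>}" using J(2) K2(2) by (auto simp: M_def)
      then show False using n J'(2) by blast
    qed
    then have "a \<otimes> x \<in> ?KJ" if "a \<in> carrier R" for a using left_idealD(4)[OF KJ that] by blast
    then have "Rx \<subseteq> ?KJ" unfolding Rx_def by blast
    have "M \<subseteq> J"
    proof
      fix m assume m: "m \<in> M"
      then obtain k j where kj: "k \<in> K" "j \<in> J" "m = k \<oplus> j" using \<open>Rx \<subseteq> ?KJ\<close> by (auto simp: M_def)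
      have car: "k \<in> carrier R" "j \<in> carrier R" using kj K'(1) J'(1) by auto
      have "k = m \<ominus> j" using kj(3) car by (simp add: a_minus_def a_assoc r_neg)
      moreover have "m \<in> K2" "j \<in> K2" using m kj(2) J(2) by (auto simp: M_def)
      ultimately have "k \<in> K2" using K2'(6) by simp
      then have "k = \<zero>" using kj(1) K2(2) by blast
      then show "m \<in> J" using kj car by simp
    qed
    then show False using n J(2) by blast
  qed
  ultimately have "simple_left_ideal M R" using M by (auto simp: simple_left_ideal_def)
  then show ?thesis using that[of M] Rx(3) by (auto simp: M_def)
qed

definition independent :: "'a set set \<Rightarrow> bool" where
  "independent \<L> \<longleftrightarrow> (\<forall>F f. finite F \<and> F \<subseteq> \<L> \<and> (\<forall>L\<in>F. f L \<in> L) \<and> (\<Oplus>L\<in>F. f L) = \<zero> \<longrightarrow> (\<forall>L\<in>F. f L = \<zero>))"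

lemma finsum_support:
  assumes "finite F" "\<And>i. i \<in> F \<Longrightarrow> f i \<in> carrier R" "G \<subseteq> F" "\<And>i. i \<in> F - G \<Longrightarrow> f i = \<zero>"
  shows "(\<Oplus>i\<in>F. f i) = (\<Oplus>i\<in>G. f i)"
  by (rule add.finprod_mono_neutral_cong_left[symmetric]; use assms finite_subset in \<open>auto\<close>)

definition ideal_sums :: "'a set set \<Rightarrow> 'a set" where
  "ideal_sums \<L> = {(\<Oplus>L\<in>F. f L) | F f. finite F \<and> F \<subseteq> \<L> \<and> (\<forall>L\<in>F. f L \<in> L)}"

lemma left_ideal_sums:
  assumes "\<And>L. L \<in> \<L> \<Longrightarrow> left_ideal L R"
  shows "left_ideal (ideal_sums \<L>) R"
proof (rule left_idealI)
  have car: "f L \<in> carrier R" if "f L \<in> L" "L \<in> \<L>" for f :: "'a set \<Rightarrow> 'a" and L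
    using left_idealD(1)[OF assms[OF that(2)]] that(1) by blast
  show "ideal_sums \<L> \<subseteq> carrier R"
    unfolding ideal_sums_def using car by (auto intro!: finsum_closed)
  show "\<zero> \<in> ideal_sums \<L>"
    unfolding ideal_sums_def by (auto intro!: exI[of _ "{}"])
  show "a \<otimes> x \<in> ideal_sums \<L>" if a: "a \<in> carrier R" and x: "x \<in> ideal_sums \<L>" for a x
  proof -
    obtain F f where F: "x = (\<Oplus>L\<in>F. f L)" "finite F" "F \<subseteq> \<L>" "\<forall>L\<in>F. f L \<in> L"
      using x by (auto simp: ideal_sums_def)
    then have "a \<otimes> x = (\<Oplus>L\<in>F. a \<otimes> f L)"
      using a car by (simp add: finsum_rdistr Pi_def subset_iff)
    moreover have "\<forall>L\<in>F. a \<otimes> f L \<in> L" using F a assms left_idealD(4) by blast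
    ultimately show ?thesis unfolding ideal_sums_def using F by (intro CollectI exI[of _ F] exI[of _ "\<lambda>L. a \<otimes> f L"]) simp
  qed
  fix x y assume "x \<in> ideal_sums \<L>" "y \<in> ideal_sums \<L>"
  then obtain F f G g where F: "x = (\<Oplus>L\<in>F. f L)" "finite F" "F \<subseteq> \<L>" "\<forall>L\<in>F. f L \<in> L"
    and G: "y = (\<Oplus>L\<in>G. g L)" "finite G" "G \<subseteq> \<L>" "\<forall>L\<in>G. g L \<in> L"
    unfolding ideal_sums_def by blast
  define f' g' where "f' L = (if L \<in> F then f L else \<zero>)" and "g' L = (if L \<in> G then g L else \<zero>)" for L
  have z: "\<zero> \<in> L" if "L \<in> \<L>" for L using left_idealD(2)[OF assms[OF that]] .
  have in': "f' L \<in> L" "g' L \<in> L" if "L \<in> F \<union> G" for L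
    using that F G z by (auto simp: f'_def g'_def)
  have c': "f' L \<in> carrier R" "g' L \<in> carrier R" if "L \<in> F \<union> G" for L
    using car in'[OF that] that F(3) G(3) by blast+
  have "(\<Oplus>L\<in>F \<union> G. f' L) = (\<Oplus>L\<in>F. f' L)"
    by (rule finsum_support) (use F(2) G(2) c' in \<open>auto simp: f'_def\<close>)
  also have "\<dots> = x" unfolding F(1) by (rule finsum_cong') (use c' F car in \<open>auto simp: f'_def\<close>)
  finally have 1: "(\<Oplus>L\<in>F \<union> G. f' L) = x" .
  have "(\<Oplus>L\<in>F \<union> G. g' L) = (\<Oplus>L\<in>G. g' L)"
    by (rule finsum_support) (use F(2) G(2) c' in \<open>auto simp: g'_def\<close>)
  also have "\<dots> = y" unfolding G(1) by (rule finsum_cong') (use c' G car in \<open>auto simp: g'_def\<close>)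
  finally have 2: "(\<Oplus>L\<in>F \<union> G. g' L) = y" .
  have "(\<Oplus>L\<in>F \<union> G. f' L \<oplus> g' L) = x \<oplus> y"
    unfolding 1[symmetric] 2[symmetric] using c' by (intro finsum_addf) auto
  moreover have "\<forall>L\<in>F \<union> G. f' L \<oplus> g' L \<in> L"
    using in' assms left_idealD(3) F(3) G(3) by blast
  ultimately show "x \<oplus> y \<in> ideal_sums \<L>"
    unfolding ideal_sums_def using F(2,3) G(2,3) by (intro CollectI exI[of _ "F \<union> G"] exI[of _ "\<lambda>L. f' L \<oplus> g' L"]) simp
qed

lemma ideal_sums_member:
  assumes "L \<in> \<L>" "left_ideal L R" shows "L \<subseteq> ideal_sums \<L>"
proof
  fix x assume x: "x \<in> L"
  then have "x \<in> carrier R" using left_idealD(1)[OF assms(2)] by blast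
  then have "(\<Oplus>J\<in>{L}. x) = x" by (simp add: finsum_insert)
  then show "x \<in> ideal_sums \<L>"
    unfolding ideal_sums_def using assms x by (intro CollectI exI[of _ "{L}"] exI[of _ "\<lambda>_. x"]) simp
qed

text \<open>A maximal independent family of simple left ideals spans the ring, since a nonzero
  complement of its sum would contain one more simple left ideal. Independence then gives uniqueness
  of the decomposition.\<close>

lemma complemented_imp_semisimple:
  assumes compl: "\<And>N. left_ideal N R \<Longrightarrow> complemented N"
  shows "semisimple_ring R"
proof -
  let ?F = "{\<L>. (\<forall>L\<in>\<L>. simple_left_ideal L R) \<and> independent \<L>}"
  have "\<exists>M\<in>?F. \<forall>X\<in>?F. M \<subseteq> X \<longrightarrow> X = M"
  proof (rule subset_Zorn)
    fix \<C> assume C: "subset.chain ?F \<C>"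
    show "\<exists>U\<in>?F. \<forall>X\<in>\<C>. X \<subseteq> U"
    proof (cases "\<C> = {}")
      case True
      have "{} \<in> ?F" by (simp add: independent_def)
      then show ?thesis using True by blast
    next
      case False
      have "independent (\<Union>\<C>)" unfolding independent_def
      proof (intro allI impI, elim conjE)
        fix F f assume F: "finite F" "F \<subseteq> \<Union>\<C>" "\<forall>L\<in>F. f L \<in> L" "(\<Oplus>L\<in>F. f L) = \<zero>"
        obtain \<L> where L: "\<L> \<in> \<C>" "F \<subseteq> \<L>"
          by (rule finite_subset_Union_chain[OF F(1,2) False C])
        have "independent \<L>" using C L(1) by (auto simp: subset.chain_def)
        then show "\<forall>L\<in>F. f L = \<zero>" using F L(2) unfolding independent_def by blast
      qed
      moreover have "\<forall>L\<in>\<Union>\<C>. simple_left_ideal L R" using C by (auto simp: subset.chain_def)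
      ultimately have "\<Union>\<C> \<in> ?F" by simp
      then show ?thesis by blast
    qed
  qed
  then obtain \<L> where L: "\<L> \<in> ?F" and max0: "\<forall>X\<in>?F. \<L> \<subseteq> X \<longrightarrow> X = \<L>" by (rule bexE)
  have simple: "simple_left_ideal L R" if "L \<in> \<L>" for L using L that by simp
  have ind: "independent \<L>" using L by simp
  have max: "X = \<L>" if "\<forall>L\<in>X. simple_left_ideal L R" "independent X" "\<L> \<subseteq> X" for X
    using max0 that by simp
  have li: "left_ideal L R" if "L \<in> \<L>" for L using simple[OF that] by (simp add: simple_left_ideal_def)
  let ?S = "ideal_sums \<L>"
  have S: "left_ideal ?S R" by (rule left_ideal_sums) (rule li)
  have S_all: "carrier R \<subseteq> ?S"
  proof -
    obtain M where M: "left_ideal M R" "?S \<inter> M = {\<zero>}" "\<forall>x\<in>carrier R. \<exists>a\<in>?S. \<exists>b\<in>M. x = a \<oplus> b"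
      using compl[OF S] unfolding complemented_def by blast
    have "M = {\<zero>}"
    proof (rule ccontr)
      assume "M \<noteq> {\<zero>}"
      then obtain L where L: "simple_left_ideal L R" "L \<subseteq> M"
        using exists_simple_left_ideal[OF compl M(1)] by blast
      have Ll: "left_ideal L R" "L \<noteq> {\<zero>}" using L(1) by (auto simp: simple_left_ideal_def)
      have SL: "?S \<inter> L \<subseteq> {\<zero>}" using M(2) L(2) by blast
      have notin: "L \<notin> \<L>"
      proof
        assume "L \<in> \<L>"
        then have "L \<subseteq> {\<zero>}" using ideal_sums_member[OF _ Ll(1)] SL by blast
        then show False using Ll left_idealD(2)[OF Ll(1)] by blast
      qed
      have "independent (insert L \<L>)" unfolding independent_def
      proof (intro allI impI, elim conjE)
        fix F f assume F: "finite F" "F \<subseteq> insert L \<L>" "\<forall>L\<in>F. f L \<in> L" "(\<Oplus>L\<in>F. f L) = \<zero>"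
        have car: "f J \<in> carrier R" if "J \<in> F" for J
          using F(2,3) that left_idealD(1) li Ll(1) by blast
        let ?G = "F - {L}"
        have G: "finite ?G" "?G \<subseteq> \<L>" "\<forall>L\<in>?G. f L \<in> L" using F by auto
        have inS: "(\<Oplus>L\<in>?G. f L) \<in> ?S" unfolding ideal_sums_def using G by blast
        show "\<forall>L\<in>F. f L = \<zero>"
        proof (cases "L \<in> F")
          case True
          have "F = insert L ?G" using True by blast
          then have "(\<Oplus>L\<in>F. f L) = (\<Oplus>L\<in>insert L ?G. f L)" by simp
          also have "\<dots> = f L \<oplus> (\<Oplus>L\<in>?G. f L)"
            using G(1) car True by (intro finsum_insert) auto
          finally have z: "f L \<oplus> (\<Oplus>L\<in>?G. f L) = \<zero>" using F(4) by simp
          have c: "(\<Oplus>L\<in>?G. f L) \<in> carrier R" using car by (intro finsum_closed) auto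
          have "f L = \<ominus> (\<Oplus>L\<in>?G. f L)" using z c car[OF True] by (simp add: minus_equality)
          then have "f L \<in> ?S" using left_idealD(5)[OF S inS] by simp
          then have fL: "f L = \<zero>" using SL F(3) True by blast
          then have "(\<Oplus>L\<in>?G. f L) = \<zero>" using z c by simp
          then have "\<forall>L\<in>?G. f L = \<zero>" using ind G unfolding independent_def by blast
          then show ?thesis using fL by blast
        next
          case False
          then have "F \<subseteq> \<L>" using F(2) by blast
          then show ?thesis using ind F unfolding independent_def by blast
        qed
      qed
      then have "insert L \<L> = \<L>" using max[of "insert L \<L>"] simple L(1) by blast
      then show False using notin by blast
    qed
    show ?thesis
    proof
      fix x assume x: "x \<in> carrier R"
      then obtain a where "a \<in> ?S" "x = a \<oplus> \<zero>" using M(3) \<open>M = {\<zero>}\<close> by blast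
      moreover have "a \<in> carrier R" using left_idealD(1)[OF S] \<open>a \<in> ?S\<close> by blast
      ultimately show "x \<in> ?S" by simp
    qed
  qed
  have carf: "f L \<in> carrier R" if "f \<in> (\<Pi>\<^sub>E L\<in>\<L>. L)" "L \<in> \<L>" for f L
    using left_idealD(1)[OF li[OF that(2)]] PiE_mem[OF that] by blast
  have "\<exists>!f. f \<in> (\<Pi>\<^sub>E L\<in>\<L>. L) \<and> finite {L\<in>\<L>. f L \<noteq> \<zero>} \<and> x = (\<Oplus>L\<in>{L\<in>\<L>. f L \<noteq> \<zero>}. f L)"
    if x: "x \<in> carrier R" for x
  proof (rule ex_ex1I)
    have "x \<in> ?S" using x S_all by blast
    then obtain F f where F: "x = (\<Oplus>L\<in>F. f L)" "finite F" "F \<subseteq> \<L>" "\<forall>L\<in>F. f L \<in> L"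
      unfolding ideal_sums_def by blast
    define g where "g = (\<lambda>L\<in>\<L>. if L \<in> F then f L else \<zero>)"
    have g: "g \<in> (\<Pi>\<^sub>E L\<in>\<L>. L)" using F left_idealD(2)[OF li] by (auto simp: g_def)
    let ?G = "{L\<in>\<L>. g L \<noteq> \<zero>}"
    have GF: "?G \<subseteq> F" by (auto simp: g_def split: if_splits)
    have gf: "g L = f L" "f L \<in> carrier R" if "L \<in> F" for L
      using that F(3,4) left_idealD(1)[OF li] by (auto simp: g_def)
    have "(\<Oplus>L\<in>F. f L) = (\<Oplus>L\<in>F. g L)"
      by (rule finsum_cong') (use gf in auto)
    also have "\<dots> = (\<Oplus>L\<in>?G. g L)"
      by (rule finsum_support) (use F(2,3) GF carf[OF g] in auto)
    finally have "x = (\<Oplus>L\<in>?G. g L)" using F(1) by simp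
    then show "\<exists>f. f \<in> (\<Pi>\<^sub>E L\<in>\<L>. L) \<and> finite {L\<in>\<L>. f L \<noteq> \<zero>} \<and> x = (\<Oplus>L\<in>{L\<in>\<L>. f L \<noteq> \<zero>}. f L)"
      using g finite_subset[OF GF F(2)] by blast
  next
    fix f g
    assume f: "f \<in> (\<Pi>\<^sub>E L\<in>\<L>. L) \<and> finite {L\<in>\<L>. f L \<noteq> \<zero>} \<and> x = (\<Oplus>L\<in>{L\<in>\<L>. f L \<noteq> \<zero>}. f L)"
      and g: "g \<in> (\<Pi>\<^sub>E L\<in>\<L>. L) \<and> finite {L\<in>\<L>. g L \<noteq> \<zero>} \<and> x = (\<Oplus>L\<in>{L\<in>\<L>. g L \<noteq> \<zero>}. g L)"
    define F where "F = {L\<in>\<L>. f L \<noteq> \<zero>} \<union> {L\<in>\<L>. g L \<noteq> \<zero>}"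
    have F: "finite F" "F \<subseteq> \<L>" using f g by (auto simp: F_def)
    have cf: "f L \<in> carrier R" "g L \<in> carrier R" if "L \<in> F" for L
      using carf f g that F(2) by blast+
    have "(\<Oplus>L\<in>F. f L) = (\<Oplus>L\<in>{L\<in>\<L>. f L \<noteq> \<zero>}. f L)"
      by (rule finsum_support) (use F cf in \<open>auto simp: F_def\<close>)
    then have 1: "(\<Oplus>L\<in>F. f L) = x" using f by simp
    have "(\<Oplus>L\<in>F. g L) = (\<Oplus>L\<in>{L\<in>\<L>. g L \<noteq> \<zero>}. g L)"
      by (rule finsum_support) (use F cf in \<open>auto simp: F_def\<close>)
    then have 2: "(\<Oplus>L\<in>F. g L) = x" using g by simp
    have d: "f L \<ominus> g L \<in> L" if "L \<in> F" for L
      using left_idealD(6)[OF li] f g that F(2) by (meson PiE_mem subsetD)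
    have dc: "f L \<ominus> g L \<in> carrier R" if "L \<in> F" for L using cf[OF that] by simp
    have "(\<Oplus>L\<in>F. f L) = (\<Oplus>L\<in>F. (f L \<ominus> g L) \<oplus> g L)"
      by (rule finsum_cong') (use cf in \<open>auto simp: a_minus_def a_assoc l_neg\<close>)
    also have "\<dots> = (\<Oplus>L\<in>F. f L \<ominus> g L) \<oplus> (\<Oplus>L\<in>F. g L)"
      using dc cf by (intro finsum_addf) auto
    finally have e: "x = (\<Oplus>L\<in>F. f L \<ominus> g L) \<oplus> x" unfolding 1 2 .
    have "(\<Oplus>L\<in>F. f L \<ominus> g L) \<in> carrier R" using dc by (intro finsum_closed) auto
    then have "(\<Oplus>L\<in>F. f L \<ominus> g L) = \<zero>" using e x by (metis add.r_cancel_one')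
    then have z: "f L \<ominus> g L = \<zero>" if "L \<in> F" for L
      using ind F d that unfolding independent_def by (metis (no_types, lifting))
    have "f L = g L" if "L \<in> \<L>" for L
    proof (cases "L \<in> F")
      case True
      have "f L = (f L \<ominus> g L) \<oplus> g L" using cf[OF True] by (simp add: a_minus_def a_assoc l_neg)
      then show ?thesis using z[OF True] cf[OF True] by simp
    next
      case False
      then show ?thesis using that by (auto simp: F_def)
    qed
    then show "f = g" by (rule PiE_ext[OF conjunct1[OF f] conjunct1[OF g]])
  qed
  then show ?thesis unfolding semisimple_ring_def
    by (intro conjI exI[of _ \<L>] ballI ring_axioms simple)
qed

end

section \<open>Left ideals of a quotient ring\<close>

context ideal
begin

lemma coset_eq_iff: "x \<in> carrier R \<Longrightarrow> I +> x = I \<longleftrightarrow> x \<in> I"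
  by (metis a_rcos_const a_rcos_self a_subgroup abelian_subgroupI3 is_abelian_group)

lemma quot_simps:
  "x \<in> carrier R \<Longrightarrow> I +> x \<in> carrier (R Quot I)" "\<zero>\<^bsub>R Quot I\<^esub> = I"
  "\<lbrakk>x \<in> carrier R; y \<in> carrier R\<rbrakk> \<Longrightarrow> (I +> x) \<oplus>\<^bsub>R Quot I\<^esub> (I +> y) = I +> (x \<oplus> y)"
  "\<lbrakk>x \<in> carrier R; y \<in> carrier R\<rbrakk> \<Longrightarrow> (I +> x) \<otimes>\<^bsub>R Quot I\<^esub> (I +> y) = I +> (x \<otimes> y)"
  using ring_hom_closed[OF rcos_ring_hom] ring_hom_add[OF rcos_ring_hom] ring_hom_mult[OF rcos_ring_hom]
  by (auto simp: FactRing_def)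

lemma quot_rep: "X \<in> carrier (R Quot I) \<Longrightarrow> \<exists>x\<in>carrier R. X = I +> x"
  by (auto simp: FactRing_def A_RCOSETS_def')

lemma left_ideal_preimage:
  assumes "left_ideal L (R Quot I)"
  shows "left_ideal {x \<in> carrier R. I +> x \<in> L} R" "I \<subseteq> {x \<in> carrier R. I +> x \<in> L}"
proof -
  interpret Q: ring "R Quot I" by (rule quotient_is_ring)
  note L = Q.left_idealD[OF assms]
  show "left_ideal {x \<in> carrier R. I +> x \<in> L} R"
  proof (rule left_idealI)
    show "\<zero> \<in> {x \<in> carrier R. I +> x \<in> L}" using coset_eq_iff[of \<zero>] L(2) by (simp add: quot_simps)
  next
    fix x y assume "x \<in> {x \<in> carrier R. I +> x \<in> L}" "y \<in> {x \<in> carrier R. I +> x \<in> L}"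
    then show "x \<oplus> y \<in> {x \<in> carrier R. I +> x \<in> L}" using L(3)[of "I +> x" "I +> y"] by (simp add: quot_simps)
  next
    fix a x assume "a \<in> carrier R" "x \<in> {x \<in> carrier R. I +> x \<in> L}"
    then show "a \<otimes> x \<in> {x \<in> carrier R. I +> x \<in> L}" using L(4)[of "I +> a" "I +> x"] by (simp add: quot_simps)
  qed auto
  show "I \<subseteq> {x \<in> carrier R. I +> x \<in> L}"
  proof
    fix x assume x: "x \<in> I"
    then have "x \<in> carrier R" using a_subset by blast
    then show "x \<in> {x \<in> carrier R. I +> x \<in> L}" using x L(2) coset_eq_iff[of x] by (simp add: quot_simps)
  qed
qed

lemma left_ideal_image:
  assumes "left_ideal M R"
  shows "left_ideal {I +> x | x. x \<in> M} (R Quot I)"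
proof -
  interpret Q: ring "R Quot I" by (rule quotient_is_ring)
  note M = left_idealD[OF assms]
  have c: "x \<in> carrier R" if "x \<in> M" for x using M(1) that by blast
  show ?thesis
  proof (rule Q.left_idealI)
    show "{I +> x | x. x \<in> M} \<subseteq> carrier (R Quot I)" using c by (auto simp: quot_simps)
    show "\<zero>\<^bsub>R Quot I\<^esub> \<in> {I +> x | x. x \<in> M}"
      using coset_eq_iff[of \<zero>] M(2) unfolding quot_simps by (metis (mono_tags, lifting) mem_Collect_eq zero_closed additive_subgroup.zero_closed additive_subgroup_axioms)
  next
    fix X Y assume "X \<in> {I +> x | x. x \<in> M}" "Y \<in> {I +> x | x. x \<in> M}"
    then obtain x y where "X = I +> x" "Y = I +> y" "x \<in> M" "y \<in> M" by blast
    moreover from this have "X \<oplus>\<^bsub>R Quot I\<^esub> Y = I +> (x \<oplus> y)" using c by (simp add: quot_simps)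
    ultimately show "X \<oplus>\<^bsub>R Quot I\<^esub> Y \<in> {I +> x | x. x \<in> M}" using M(3) by blast
  next
    fix A X assume "A \<in> carrier (R Quot I)" "X \<in> {I +> x | x. x \<in> M}"
    then obtain a x where ax: "A = I +> a" "a \<in> carrier R" "X = I +> x" "x \<in> M" using quot_rep by blast
    then have "A \<otimes>\<^bsub>R Quot I\<^esub> X = I +> (a \<otimes> x)" using c by (simp add: quot_simps)
    then show "A \<otimes>\<^bsub>R Quot I\<^esub> X \<in> {I +> x | x. x \<in> M}" using M(4)[OF ax(2,4)] by blast
  qed
qed

text \<open>Transfers the question to left ideals of \<open>R\<close> above \<open>I\<close>, so
  that later arguments handle elements of the free algebra instead of cosets.\<close>

lemma semisimple_quotientI:
  assumes "\<And>M. \<lbrakk>left_ideal M R; I \<subseteq> M\<rbrakk> \<Longrightarrow> \<exists>M'. left_ideal M' R \<and> I \<subseteq> M' \<and> M \<inter> M' \<subseteq> I \<and>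
    (\<forall>x\<in>carrier R. \<exists>a\<in>M. \<exists>b\<in>M'. x = a \<oplus> b)"
  shows "semisimple_ring (R Quot I)"
proof -
  interpret Q: ring "R Quot I" by (rule quotient_is_ring)
  show ?thesis
  proof (rule Q.complemented_imp_semisimple)
    fix L assume L: "left_ideal L (R Quot I)"
    let ?M = "{x \<in> carrier R. I +> x \<in> L}"
    obtain M' where M': "left_ideal M' R" "I \<subseteq> M'" "?M \<inter> M' \<subseteq> I" "\<forall>x\<in>carrier R. \<exists>a\<in>?M. \<exists>b\<in>M'. x = a \<oplus> b"
      using assms[OF left_ideal_preimage[OF L]] by blast
    let ?L' = "{I +> x | x. x \<in> M'}"
    have c: "x \<in> carrier R" if "x \<in> M'" for x using left_idealD(1)[OF M'(1)] that by blast
    have L': "left_ideal ?L' (R Quot I)" by (rule left_ideal_image[OF M'(1)])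
    have "L \<inter> ?L' \<subseteq> {\<zero>\<^bsub>R Quot I\<^esub>}"
    proof
      fix X assume "X \<in> L \<inter> ?L'"
      then obtain x where x: "X = I +> x" "x \<in> M'" "X \<in> L" by blast
      then have "x \<in> I" using M'(3) c by blast
      then show "X \<in> {\<zero>\<^bsub>R Quot I\<^esub>}" using coset_eq_iff[OF c[OF x(2)]] x(1) by (simp add: quot_simps)
    qed
    then have dis: "L \<inter> ?L' = {\<zero>\<^bsub>R Quot I\<^esub>}" using Q.left_idealD(2)[OF L] Q.left_idealD(2)[OF L'] by blast
    have dec: "\<exists>A\<in>L. \<exists>B\<in>?L'. X = A \<oplus>\<^bsub>R Quot I\<^esub> B" if X: "X \<in> carrier (R Quot I)" for X
    proof -
      obtain x where x: "x \<in> carrier R" "X = I +> x" using quot_rep[OF X] by blast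
      then obtain a b where ab: "a \<in> ?M" "b \<in> M'" "x = a \<oplus> b" using M'(4) by blast
      then have "X = (I +> a) \<oplus>\<^bsub>R Quot I\<^esub> (I +> b)" using x(2) c by (simp add: quot_simps)
      moreover have "I +> b \<in> ?L'" using ab(2) by blast
      ultimately show ?thesis using ab(1) by blast
    qed
    show "Q.complemented L" unfolding Q.complemented_def
      by (intro exI[of _ ?L'] conjI ballI) (rule L', rule dis, rule dec)
  qed
qed

lemma semisimple_quotientD:
  assumes ss: "semisimple_ring (R Quot I)" and M: "left_ideal M R" "I \<subseteq> M"
  shows "\<exists>M'. left_ideal M' R \<and> I \<subseteq> M' \<and> M \<inter> M' \<subseteq> I \<and> (\<forall>x\<in>carrier R. \<exists>a\<in>M. \<exists>b\<in>M'. x = a \<oplus> b)"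
proof -
  interpret Q: ring "R Quot I" by (rule quotient_is_ring)
  note M' = left_idealD[OF M(1)]
  have c: "x \<in> carrier R" if "x \<in> M" for x using M'(1) that by blast
  obtain L where L: "left_ideal L (R Quot I)" "{I +> x | x. x \<in> M} \<inter> L = {\<zero>\<^bsub>R Quot I\<^esub>}"
    "\<forall>X\<in>carrier (R Quot I). \<exists>A\<in>{I +> x | x. x \<in> M}. \<exists>B\<in>L. X = A \<oplus>\<^bsub>R Quot I\<^esub> B"
    using Q.semisimple_imp_complemented[OF ss left_ideal_image[OF M(1)]] unfolding Q.complemented_def
    by (elim exE conjE) (rule that)
  let ?N = "{x \<in> carrier R. I +> x \<in> L}"
  have dis: "M \<inter> ?N \<subseteq> I"
  proof
    fix x assume x: "x \<in> M \<inter> ?N"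
    then have "I +> x \<in> {\<zero>\<^bsub>R Quot I\<^esub>}" using L(2) by blast
    then show "x \<in> I" using coset_eq_iff[of x] x by (simp add: quot_simps)
  qed
  have dec: "\<exists>a\<in>M. \<exists>b\<in>?N. x = a \<oplus> b" if x: "x \<in> carrier R" for x
  proof -
    obtain m B where mB: "m \<in> M" "B \<in> L" "I +> x = (I +> m) \<oplus>\<^bsub>R Quot I\<^esub> B"
      using L(3) quot_simps(1)[OF x] by blast
    obtain b where b: "b \<in> carrier R" "B = I +> b" using quot_rep Q.left_idealD(1)[OF L(1)] mB(2) by blast
    have car: "m \<in> carrier R" "m \<oplus> b \<in> carrier R" using c mB(1) b by auto
    have "I +> x = I +> (m \<oplus> b)" using mB(3) b car by (simp add: quot_simps)
    then have "x \<in> I +> (m \<oplus> b)" using a_rcos_self[OF x] by simp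
    then obtain i where i: "i \<in> I" "x = i \<oplus> (m \<oplus> b)" by (auto simp: a_r_coset_def')
    have "i \<in> carrier R" using i(1) a_subset by blast
    then have "x = (i \<oplus> m) \<oplus> b" using i(2) car b by (simp add: a_assoc)
    moreover have "i \<oplus> m \<in> M" using i(1) M(2) mB(1) M'(3) by blast
    ultimately show ?thesis using b mB(2) by blast
  qed
  show ?thesis
    by (intro exI[of _ ?N] conjI ballI left_ideal_preimage[OF L(1)] dis) (rule dec)
qed

end

section \<open>Additive endomorphisms and free algebras\<close>

text \<open>Besides the addition, the sort \<open>ring_1\<close> provides a nonzero vector, which
  gives \<open>0 \<noteq> 1\<close> in the endomorphism ring.\<close>

typedef (overloaded) 'v endo = "{f :: 'v::ring_1 \<Rightarrow> 'v. \<forall>x y. f (x + y) = f x + f y}"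
  morphisms apply_endo Endo
  by (rule exI[of _ "\<lambda>x. x"]) simp

setup_lifting type_definition_endo

instantiation endo :: (ring_1) ring_1
begin

lift_definition zero_endo :: "'a endo" is "\<lambda>x. 0" by simp
lift_definition one_endo :: "'a endo" is "\<lambda>x. x" by simp
lift_definition plus_endo :: "'a endo \<Rightarrow> 'a endo \<Rightarrow> 'a endo" is "\<lambda>f g x. f x + g x"
  by (simp add: algebra_simps)
lift_definition minus_endo :: "'a endo \<Rightarrow> 'a endo \<Rightarrow> 'a endo" is "\<lambda>f g x. f x - g x"
  by (simp add: algebra_simps)
lift_definition uminus_endo :: "'a endo \<Rightarrow> 'a endo" is "\<lambda>f x. - f x"
  by simp
lift_definition times_endo :: "'a endo \<Rightarrow> 'a endo \<Rightarrow> 'a endo" is "\<lambda>f g x. f (g x)"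
  by simp

instance
proof
  show "(0 :: 'a endo) \<noteq> 1" by transfer (metis zero_neq_one)
qed (transfer; simp add: fun_eq_iff algebra_simps)+

end

lemma apply_endo_simps [simp]:
  "apply_endo (f + g) x = apply_endo f x + apply_endo g x"
  "apply_endo (f - g) x = apply_endo f x - apply_endo g x"
  "apply_endo (- f) x = - apply_endo f x"
  "apply_endo (f * g) x = apply_endo f (apply_endo g x)"
  "apply_endo 1 x = x" "apply_endo 0 x = 0"
  by (transfer; simp)+

lemma endo_eqI: "(\<And>x. apply_endo f x = apply_endo g x) \<Longrightarrow> f = g"
  by transfer auto

lemma apply_endo_add: "apply_endo f (x + y) = apply_endo f x + apply_endo f y"
  by transfer simp

lemma apply_endo_0: "apply_endo f 0 = 0"
  using apply_endo_add[of f 0 0] by simp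

lemma apply_endo_diff: "apply_endo f (x - y) = apply_endo f x - apply_endo f y"
  using apply_endo_add[of f "x - y" y] by simp

lemma apply_Endo: "(\<And>x y. f (x + y) = f x + f y) \<Longrightarrow> apply_endo (Endo f) = f"
  by (rule Endo_inverse) simp

section \<open>Linear algebra in the free algebra\<close>

lemma poly_mapping_sum_single: "p = (\<Sum>w\<in>Poly_Mapping.keys p. Poly_Mapping.single w (Poly_Mapping.lookup p w))"
  by (rule poly_mapping_eqI) (simp add: lookup_sum lookup_single when_def in_keys_iff)

lemma scalar_simps:
  fixes a b :: "'a::field"
  shows "scalar (a + b) = scalar a + scalar b" "scalar (a * b) = scalar a * scalar b"
    "scalar 1 = 1" "scalar 0 = 0" "generator g * scalar a = scalar a * generator g"
  by (simp_all add: scalar_def generator_def single_add mult_single)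

lemma mult_closed_if_generators:
  fixes S :: "('g word \<Rightarrow>\<^sub>0 'a::field) set"
  assumes S: "0 \<in> S" "\<And>x y. \<lbrakk>x \<in> S; y \<in> S\<rbrakk> \<Longrightarrow> x + y \<in> S" "\<And>a x. x \<in> S \<Longrightarrow> scalar a * x \<in> S"
    "\<And>g x. \<lbrakk>g \<in> G; x \<in> S\<rbrakk> \<Longrightarrow> generator g * x \<in> S"
    and a: "a \<in> carrier (free_algebra G)" and x: "x \<in> S"
  shows "a * x \<in> S"
proof -
  have word: "Poly_Mapping.single (Word l) 1 * x \<in> S" if "set l \<subseteq> G" for l
    using that
  proof (induction l)
    case Nil
    have "Poly_Mapping.single (Word []) 1 = (1 :: 'g word \<Rightarrow>\<^sub>0 'a)"
      using scalar_simps(3) by (simp add: scalar_def zero_word_def)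
    then show ?case using x by simp
  next
    case (Cons g l)
    have "Poly_Mapping.single (Word (g # l)) (1::'a) = generator g * Poly_Mapping.single (Word l) 1"
      by (simp add: generator_def mult_single plus_word_def)
    then show ?case using Cons S(4) by (simp add: mult.assoc)
  qed
  have mono: "Poly_Mapping.single w c * x \<in> S" if "set (letters w) \<subseteq> G" for w c
  proof -
    have "Poly_Mapping.single w c = scalar c * Poly_Mapping.single (Word (letters w)) 1"
      by (simp add: scalar_def mult_single)
    then show ?thesis using word[OF that] S(3) by (simp add: mult.assoc)
  qed
  have sum: "(\<Sum>w\<in>K. Poly_Mapping.single w (Poly_Mapping.lookup a w)) * x \<in> S"
    if "finite K" "K \<subseteq> Poly_Mapping.keys a" for K
    using that
  proof (induction rule: finite_induct)
    case (insert w K)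
    have "set (letters w) \<subseteq> G" using a insert.prems by (auto simp: free_algebra_def)
    then show ?case using insert mono S(2) by (simp add: distrib_right)
  qed (use S(1) in simp)
  show ?thesis
    using sum[of "Poly_Mapping.keys a"] by (simp add: poly_mapping_sum_single[of a, symmetric])
qed

lemma vector_space_free_algebra: "vector_space (\<lambda>a (v :: 'g word \<Rightarrow>\<^sub>0 'a::field). scalar a * v)"
  by unfold_locales (simp_all add: scalar_simps algebra_simps)

lemma linear_projection:
  fixes S :: "('g word \<Rightarrow>\<^sub>0 'a::field) set"
  assumes "0 \<in> S" "\<And>x y. \<lbrakk>x \<in> S; y \<in> S\<rbrakk> \<Longrightarrow> x + y \<in> S" "\<And>a x. x \<in> S \<Longrightarrow> scalar a * x \<in> S"
  obtains g where "\<And>x y. g (x + y) = g x + g y" "\<And>a x. g (scalar a * x) = scalar a * g x"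
    "\<And>x. g x \<in> S" "\<And>x. x \<in> S \<Longrightarrow> g x = x"
proof -
  interpret free_alg: vector_space "\<lambda>a (v :: 'g word \<Rightarrow>\<^sub>0 'a). scalar a * v"
    by (rule vector_space_free_algebra)
  have S: "free_alg.subspace S" using assms by (simp add: free_alg.subspace_def)
  interpret vector_space_pair "\<lambda>a (v :: 'g word \<Rightarrow>\<^sub>0 'a). scalar a * v" "\<lambda>a (v :: 'g word \<Rightarrow>\<^sub>0 'a). scalar a * v"
    by unfold_locales
  have "Vector_Spaces.linear (\<lambda>a (v :: 'g word \<Rightarrow>\<^sub>0 'a). scalar a * v) (\<lambda>a v. scalar a * v) (\<lambda>x. x)"
    by unfold_locales auto
  from linear_exists_left_inverse_on[OF this S] obtain g where
    g: "range g \<subseteq> S" "Vector_Spaces.linear (\<lambda>a v. scalar a * v) (\<lambda>a v. scalar a * v) g" "\<forall>v\<in>S. g v = v" by auto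
  interpret Vector_Spaces.linear "\<lambda>a v. scalar a * v" "\<lambda>a v. scalar a * v" g by (rule g(2))
  show ?thesis by (rule that[of g]) (use g add scale in auto)
qed

lemma free_algebra_simps:
  "x \<oplus>\<^bsub>free_algebra G\<^esub> y = x + y" "x \<otimes>\<^bsub>free_algebra G\<^esub> y = x * y"
  "\<zero>\<^bsub>free_algebra G\<^esub> = 0" "\<one>\<^bsub>free_algebra G\<^esub> = 1"
  by (simp_all add: free_algebra_def)

lemma free_algebra_minus:
  assumes "x \<in> carrier (free_algebra G)" "y \<in> carrier (free_algebra G)"
  shows "x \<ominus>\<^bsub>free_algebra G\<^esub> y = x - (y :: 'g word \<Rightarrow>\<^sub>0 'a::ring_1)"
proof -
  interpret ring "free_algebra G :: ('g word \<Rightarrow>\<^sub>0 'a) ring" by (rule ring_free_algebra)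
  have "\<ominus>\<^bsub>free_algebra G\<^esub> y = - y"
    by (rule minus_equality) (use assms free_algebra_uminus_closed in \<open>auto simp: free_algebra_simps\<close>)
  then show ?thesis by (simp add: a_minus_def free_algebra_simps)
qed

section \<open>Left ideals above the ideal of relations\<close>

abbreviation "hc_free n \<equiv> free_algebra (hc_generators n)"
abbreviation "hc_ideal n q \<equiv> Idl\<^bsub>hc_free n\<^esub> (hc_relations n q)"

lemma hc_ideal: "ideal (hc_ideal n q) (hc_free n)"
  by (rule ring.genideal_ideal[OF ring_free_algebra hc_relations_subset_carrier])

lemma hc_relation_in_ideal: "r \<in> hc_relations n q \<Longrightarrow> r \<in> hc_ideal n q"
  using ring.genideal_self[OF ring_free_algebra hc_relations_subset_carrier] by blast

lemma hc_gen_in: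
  "\<lbrakk>0 < i; i < n\<rbrakk> \<Longrightarrow> generator (HC_T i) \<in> carrier (hc_free n :: (hc_generator word \<Rightarrow>\<^sub>0 'a::field) ring)"
  "\<lbrakk>0 < i; i \<le> n\<rbrakk> \<Longrightarrow> generator (HC_C i) \<in> carrier (hc_free n :: (hc_generator word \<Rightarrow>\<^sub>0 'a::field) ring)"
  by (auto intro!: generator_in_carrier simp: hc_generators_def)

lemma hc_relations_intros:
  fixes q :: "'a::field"
  defines "T \<equiv> \<lambda>i. generator (HC_T i) :: hc_generator word \<Rightarrow>\<^sub>0 'a" and "C \<equiv> \<lambda>i. generator (HC_C i)"
    and "\<epsilon> \<equiv> scalar (q - inverse q)"
  shows "\<lbrakk>0 < i; i < n\<rbrakk> \<Longrightarrow> T i * T i - (\<epsilon> * T i + 1) \<in> hc_relations n q"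
    "\<lbrakk>0 < i; i < n; 0 < j; j < n; Suc i < j\<rbrakk> \<Longrightarrow> T i * T j - T j * T i \<in> hc_relations n q"
    "\<lbrakk>0 < i; Suc i < n\<rbrakk> \<Longrightarrow> T i * T (i + 1) * T i - T (i + 1) * T i * T (i + 1) \<in> hc_relations n q"
    "\<lbrakk>0 < i; i \<le> n\<rbrakk> \<Longrightarrow> C i * C i - 1 \<in> hc_relations n q"
    "\<lbrakk>0 < i; i \<le> n; 0 < j; j \<le> n; i \<noteq> j\<rbrakk> \<Longrightarrow> C i * C j - (- (C j * C i)) \<in> hc_relations n q"
    "\<lbrakk>0 < i; i < n\<rbrakk> \<Longrightarrow> T i * C i - C (i + 1) * T i \<in> hc_relations n q"
    "\<lbrakk>0 < i; i < n\<rbrakk> \<Longrightarrow> T i * C (i + 1) - (C i * T i - \<epsilon> * (C i - C (i + 1))) \<in> hc_relations n q"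
    "\<lbrakk>0 < i; i < n; 0 < j; j \<le> n; j \<noteq> i; j \<noteq> Suc i\<rbrakk> \<Longrightarrow> T i * C j - C j * T i \<in> hc_relations n q"
  unfolding hc_relations_def Let_def T_def C_def \<epsilon>_def
  subgoal by (rule UnI1, rule UnI1, rule UnI1, rule UnI1, rule UnI1, rule UnI1, rule UnI1, intro CollectI exI conjI refl) auto
  subgoal by (rule UnI1, rule UnI1, rule UnI1, rule UnI1, rule UnI1, rule UnI1, rule UnI2, intro CollectI exI conjI refl) auto
  subgoal by (rule UnI1, rule UnI1, rule UnI1, rule UnI1, rule UnI1, rule UnI2, intro CollectI exI conjI refl) auto
  subgoal by (rule UnI1, rule UnI1, rule UnI1, rule UnI1, rule UnI2, intro CollectI exI conjI refl) auto
  subgoal by (rule UnI1, rule UnI1, rule UnI1, rule UnI2, intro CollectI exI conjI refl) auto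
  subgoal by (rule UnI1, rule UnI1, rule UnI2, intro CollectI exI conjI refl) auto
  subgoal by (rule UnI1, rule UnI2, intro CollectI exI conjI refl) auto
  subgoal by (rule UnI2, intro CollectI exI conjI refl) auto
  done

text \<open>The quotient is modelled on a linear complement of the ideal, with \<open>\<pi>\<close>
  the projection onto it, and \<open>M\<close> becomes the subspace \<open>W\<close>. The kernel of
  an equivariant projection onto \<open>W\<close>, taken in the whole free algebra, is the required
  left ideal; it contains the ideal because the projection factors through
  \<open>\<pi>\<close>.\<close>

lemma complement_of_left_ideal:
  fixes q :: "'a::alg_closed_field"
  assumes H: "\<And>m \<eta>. \<lbrakk>0 < m; m \<le> n\<rbrakk> \<Longrightarrow>
      (\<Prod>k<m. [:- \<eta> k, 1:]\<^sup>2 - smult ((q - inverse q)\<^sup>2) [:- 4, \<eta> k:]) \<noteq> (\<Prod>k<m. [:- \<eta> k, 1:]\<^sup>2)"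
    and M: "left_ideal M (hc_free n)" "hc_ideal n q \<subseteq> M"
  shows "\<exists>M'. left_ideal M' (hc_free n) \<and> hc_ideal n q \<subseteq> M' \<and> M \<inter> M' \<subseteq> hc_ideal n q \<and>
    (\<forall>x\<in>carrier (hc_free n). \<exists>a\<in>M. \<exists>b\<in>M'. x = a \<oplus>\<^bsub>hc_free n\<^esub> b)"
proof -
  define V where "V = carrier (hc_free n :: (hc_generator word \<Rightarrow>\<^sub>0 'a) ring)"
  define I where "I = hc_ideal n q"
  interpret R: ring "hc_free n :: (hc_generator word \<Rightarrow>\<^sub>0 'a) ring" by (rule ring_free_algebra)
  interpret J: ideal I "hc_free n :: (hc_generator word \<Rightarrow>\<^sub>0 'a) ring" unfolding I_def by (rule hc_ideal)
  note fs = free_algebra_simps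
  have V: "0 \<in> V" "1 \<in> V" "\<And>x y. \<lbrakk>x \<in> V; y \<in> V\<rbrakk> \<Longrightarrow> x + y \<in> V" "\<And>x y. \<lbrakk>x \<in> V; y \<in> V\<rbrakk> \<Longrightarrow> x - y \<in> V"
    "\<And>x y. \<lbrakk>x \<in> V; y \<in> V\<rbrakk> \<Longrightarrow> x * y \<in> V" "\<And>a. scalar a \<in> V"
    using R.zero_closed free_algebra_one_closed free_algebra_add_closed free_algebra_diff_closed
      free_algebra_mult_closed scalar_in_carrier by (auto simp: V_def fs)
  have Isub: "I \<subseteq> V" using J.a_subset by (simp add: V_def)
  have I: "0 \<in> I" "\<And>x y. \<lbrakk>x \<in> I; y \<in> I\<rbrakk> \<Longrightarrow> x + y \<in> I" "\<And>x y. \<lbrakk>x \<in> I; y \<in> V\<rbrakk> \<Longrightarrow> x * y \<in> I"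
    "\<And>x y. \<lbrakk>x \<in> V; y \<in> I\<rbrakk> \<Longrightarrow> x * y \<in> I"
    using J.zero_closed J.a_closed J.I_r_closed J.I_l_closed by (auto simp: V_def fs)
  note Mi = R.left_idealD[OF M(1), folded V_def, unfolded fs]
  have IM: "I \<subseteq> M" using M(2) by (simp add: I_def)
  have Mm: "x - y \<in> M" if "x \<in> M" "y \<in> M" for x y
    using Mi(6)[OF that] free_algebra_minus[of x "hc_generators n" y] Mi(1) that by (auto simp: V_def subset_iff)
  \<comment> \<open>The type also contains words in generators outside
    \<open>hc_generators n\<close>, so a projection onto the carrier comes first.\<close>
  obtain gR where gR: "\<And>x y. gR (x + y) = gR x + gR y" "\<And>a x. gR (scalar a * x) = scalar a * gR x"
    "\<And>x. gR x \<in> V" "\<And>x. x \<in> V \<Longrightarrow> gR x = x"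
    by (rule linear_projection[of V]) (use V in auto)
  obtain gI where gI: "\<And>x y. gI (x + y) = gI x + gI y" "\<And>a x. gI (scalar a * x) = scalar a * gI x"
    "\<And>x. gI x \<in> I" "\<And>x. x \<in> I \<Longrightarrow> gI x = x"
    by (rule linear_projection[of I]) (use I V in auto)
  define \<pi> where "\<pi> x = gR x - gI (gR x)" for x
  have gI0: "gI (x - y) = gI x - gI y" for x y using gI(1)[of "x - y" y] by simp
  have pi_add: "\<pi> (x + y) = \<pi> x + \<pi> y" for x y by (simp add: \<pi>_def gR gI)
  have pi_diff: "\<pi> (x - y) = \<pi> x - \<pi> y" for x y using pi_add[of "x - y" y] by simp
  have pi_scalar: "\<pi> (scalar a * x) = scalar a * \<pi> x" for a x by (simp add: \<pi>_def gR gI right_diff_distrib)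
  have pi_V: "\<pi> x \<in> V" for x using gR(3)[of x] gI(3)[of "gR x"] Isub V(4) by (auto simp: \<pi>_def)
  have pi_I: "\<pi> x = 0" if "x \<in> I" for x using that gR(4) gI(4) Isub by (auto simp: \<pi>_def)
  have pi_mod: "x - \<pi> x \<in> I" if "x \<in> V" for x using gI(3)[of x] gR(4)[OF that] by (simp add: \<pi>_def)
  have pi_cong: "\<pi> x = \<pi> y" if "x - y \<in> I" for x y using pi_I[OF that] pi_diff by simp
  have pi_pi: "\<pi> (\<pi> x) = \<pi> x" for x
    using pi_cong[of "gR x" "\<pi> x"] pi_mod[OF gR(3)[of x]] gR(3,4) by (simp add: \<pi>_def gI gI0)
  define W where "W = \<pi> ` M"
  have W: "0 \<in> W" "\<And>x y. \<lbrakk>x \<in> W; y \<in> W\<rbrakk> \<Longrightarrow> x + y \<in> W" "\<And>a x. x \<in> W \<Longrightarrow> scalar a * x \<in> W"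
  proof -
    show "0 \<in> W" using pi_I[OF I(1)] Mi(2) by (force simp: W_def)
    show "x + y \<in> W" if "x \<in> W" "y \<in> W" for x y using that Mi(3) by (auto simp: W_def pi_add[symmetric])
    show "scalar a * x \<in> W" if "x \<in> W" for a x using that Mi(4)[OF V(6)] by (auto simp: W_def pi_scalar[symmetric])
  qed
  obtain gW where gW: "\<And>x y. gW (x + y) = gW x + gW y" "\<And>a x. gW (scalar a * x) = scalar a * gW x"
    "\<And>x. gW x \<in> W" "\<And>x. x \<in> W \<Longrightarrow> gW x = x"
    by (rule linear_projection[of W]) (use W in auto)
  have pi_W: "\<pi> x = x" if "x \<in> W" for x using that by (auto simp: W_def pi_pi)
  have W_M: "W \<subseteq> M"
  proof
    fix w assume "w \<in> W"
    then obtain m where m: "m \<in> M" "w = \<pi> m" by (auto simp: W_def)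
    then have "m - \<pi> m \<in> M" using pi_mod Mi(1) IM by blast
    then show "w \<in> M" using Mm[OF m(1), of "m - \<pi> m"] m by simp
  qed
  define e where "e = Endo \<pi>"
  define p0 where "p0 = Endo (\<lambda>x. gW (\<pi> x))"
  define SC where "SC a = Endo (\<lambda>x :: hc_generator word \<Rightarrow>\<^sub>0 'a. scalar a * x)" for a
  define hat where "hat a = Endo (\<lambda>x. \<pi> (a * \<pi> x))" for a
  have ap: "apply_endo e x = \<pi> x" "apply_endo p0 x = gW (\<pi> x)" "apply_endo (SC a) x = scalar a * x"
    "apply_endo (hat b) x = \<pi> (b * \<pi> x)" for a b x
    by (simp_all add: e_def p0_def SC_def hat_def apply_Endo pi_add gW distrib_left)
  \<comment> \<open>Compression by \<open>\<pi>\<close> is multiplicative because the discarded part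
    lies in an ideal and stays there under left multiplication.\<close>
  have hat_mult: "hat a * hat b = hat (a * b)" if "a \<in> V" "b \<in> V" for a b
  proof (rule endo_eqI)
    fix x
    have "a * (b * \<pi> x) - a * \<pi> (b * \<pi> x) \<in> I"
      using I(4)[OF that(1) pi_mod[OF V(5)[OF that(2) pi_V]]] by (simp add: right_diff_distrib)
    then show "apply_endo (hat a * hat b) x = apply_endo (hat (a * b)) x"
      using pi_cong by (simp add: ap pi_pi mult.assoc)
  qed
  have hat_add: "hat (a + b) = hat a + hat b" "hat (a - b) = hat a - hat b" for a b
    by (rule endo_eqI; simp add: ap pi_add pi_diff algebra_simps)+
  have hat_scalar: "hat (scalar c * a) = SC c * hat a" for a c
    by (rule endo_eqI) (simp add: ap pi_scalar mult.assoc)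
  have hat_minus: "hat (- a) = - hat a" for a
    using hat_add(2)[of 0 a] hat_add(2)[of 0 0] by simp
  have hat_1: "hat 1 = e" by (rule endo_eqI) (simp add: ap pi_pi)
  have hat_e: "e * hat a = hat a" "hat a * e = hat a" for a
    by (rule endo_eqI; simp add: ap pi_pi)+
  have hat_cong: "hat a = hat b" if "a - b \<in> I" for a b
  proof (rule endo_eqI)
    fix x
    have "a * \<pi> x - b * \<pi> x \<in> I" using I(3)[OF that pi_V] by (simp add: left_diff_distrib)
    then show "apply_endo (hat a) x = apply_endo (hat b) x" using pi_cong by (simp add: ap)
  qed
  have hat_SC: "SC a * hat (generator g) = hat (generator g) * SC a" for a g
  proof (rule endo_eqI)
    fix x
    have "generator g * (scalar a * \<pi> x) = scalar a * (generator g * \<pi> x)"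
      by (simp add: mult.assoc[symmetric] scalar_simps)
    then show "apply_endo (SC a * hat (generator g)) x = apply_endo (hat (generator g) * SC a) x"
      by (simp add: ap pi_scalar)
  qed
  let ?T = "\<lambda>i. generator (HC_T i) :: hc_generator word \<Rightarrow>\<^sub>0 'a"
  let ?C = "\<lambda>i. generator (HC_C i) :: hc_generator word \<Rightarrow>\<^sub>0 'a"
  let ?eps = "scalar (q - inverse q) :: hc_generator word \<Rightarrow>\<^sub>0 'a"
  have TV: "?T i \<in> V" if "0 < i" "i < n" for i using hc_gen_in(1)[OF that] by (simp add: V_def)
  have CV: "?C i \<in> V" if "0 < i" "i \<le> n" for i using hc_gen_in(2)[OF that] by (simp add: V_def)
  have rel: "hat a = hat b" if "a - b \<in> hc_relations n q" for a b
    using hat_cong hc_relation_in_ideal[OF that] by (simp add: I_def)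
  interpret hc: hc_rep_closed SC e "\<lambda>i. hat (?T i)" "\<lambda>i. hat (?C i)" q n
  proof unfold_locales
    show "SC (a + b) = SC a + SC b" for a b by (rule endo_eqI) (simp add: ap scalar_simps distrib_right)
    show "SC (a * b) = SC a * SC b" for a b by (rule endo_eqI) (simp add: ap scalar_simps mult.assoc)
    show "SC 1 = 1" by (rule endo_eqI) (simp add: ap scalar_simps)
    show "SC a * e = e * SC a" for a by (rule endo_eqI) (simp add: ap pi_scalar)
    show "e * e = e" by (rule endo_eqI) (simp add: ap pi_pi)
  next
    fix i assume i: "0 < i" "i < n"
    have "hat (?T i * ?T i) = hat (?eps * ?T i + 1)"
      by (rule rel, rule hc_relations_intros(1)) (use i in auto)
    then show "hat (?T i) * hat (?T i) = SC (q - inverse q) * hat (?T i) + e"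
      using TV[OF i] by (simp add: hat_mult hat_add hat_scalar hat_1)
    have "hat (?T i * ?C i) = hat (?C (i + 1) * ?T i)"
      by (rule rel, rule hc_relations_intros(6)) (use i in auto)
    then show "hat (?T i) * hat (?C i) = hat (?C (Suc i)) * hat (?T i)"
      using TV[OF i] CV i by (simp add: hat_mult)
    have "hat (?T i * ?C (i + 1)) = hat (?C i * ?T i - ?eps * (?C i - ?C (i + 1)))"
      by (rule rel, rule hc_relations_intros(7)) (use i in auto)
    then show "hat (?T i) * hat (?C (Suc i)) = hat (?C i) * hat (?T i) - SC (q - inverse q) * (hat (?C i) - hat (?C (Suc i)))"
      using TV[OF i] CV i by (simp add: hat_mult hat_add hat_scalar)
  next
    fix i j assume ij: "0 < i" "i < n" "0 < j" "j < n" "Suc i < j"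
    have "hat (?T i * ?T j) = hat (?T j * ?T i)"
      by (rule rel, rule hc_relations_intros(2)) (use ij in auto)
    then show "hat (?T i) * hat (?T j) = hat (?T j) * hat (?T i)"
      using TV ij by (simp add: hat_mult)
  next
    fix i assume i: "0 < i" "Suc i < n"
    have "hat (?T i * ?T (i + 1) * ?T i) = hat (?T (i + 1) * ?T i * ?T (i + 1))"
      by (rule rel, rule hc_relations_intros(3)) (use i in auto)
    then show "hat (?T i) * hat (?T (Suc i)) * hat (?T i) = hat (?T (Suc i)) * hat (?T i) * hat (?T (Suc i))"
      using TV i by (simp add: hat_mult V)
  next
    fix i assume i: "0 < i" "i \<le> n"
    have "hat (?C i * ?C i) = hat 1"
      by (rule rel, rule hc_relations_intros(4)) (use i in auto)
    then show "hat (?C i) * hat (?C i) = e" using CV i by (simp add: hat_mult hat_1)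
  next
    fix i j assume ij: "0 < i" "i \<le> n" "0 < j" "j \<le> n" "i \<noteq> j"
    have "hat (?C i * ?C j) = hat (- (?C j * ?C i))"
      by (rule rel, rule hc_relations_intros(5)) (use ij in auto)
    then show "hat (?C i) * hat (?C j) = - (hat (?C j) * hat (?C i))"
      using CV ij by (simp add: hat_mult hat_minus)
  next
    fix i j assume ij: "0 < i" "i < n" "0 < j" "j \<le> n" "j \<noteq> i" "j \<noteq> Suc i"
    have "hat (?T i * ?C j) = hat (?C j * ?T i)"
      by (rule rel, rule hc_relations_intros(8)) (use ij in auto)
    then show "hat (?T i) * hat (?C j) = hat (?C j) * hat (?T i)"
      using TV CV ij by (simp add: hat_mult)
  qed (simp_all add: hat_e hat_SC)
  have stable: "hat a * p0 = p0 * (hat a * p0)" if "a \<in> V" for a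
  proof (rule endo_eqI)
    fix x
    define w where "w = gW (\<pi> x)"
    have w: "w \<in> M" "\<pi> w = w" using gW(3) W_M pi_W by (auto simp: w_def)
    then have "\<pi> (a * w) \<in> W" using Mi(4)[OF that w(1)] by (auto simp: W_def)
    then show "apply_endo (hat a * p0) x = apply_endo (p0 * (hat a * p0)) x"
      using w gW(4) by (simp add: ap pi_pi w_def)
  qed
  obtain p where p: "p0 * p = p" "p * p0 = p0" "\<And>x. x \<in> hc.A n \<Longrightarrow> x * p = p * x"
  proof -
    have "\<exists>p. p0 * p = p \<and> p * p0 = p0 \<and> (\<forall>x\<in>hc.A n. x * p = p * x)"
    proof (rule hc.equivariant_projection[OF H])
      show "e * p0 = p0" by (rule endo_eqI) (simp add: ap pi_W gW)
      show "p0 * e = p0" by (rule endo_eqI) (simp add: ap pi_pi)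
      show "p0 * p0 = p0" by (rule endo_eqI) (simp add: ap pi_W gW)
      show "SC a * p0 = p0 * SC a" for a by (rule endo_eqI) (simp add: ap pi_scalar gW)
    qed (use stable TV CV in auto)
    then show ?thesis using that by blast
  qed
  let ?P = "apply_endo p"
  have P_W: "?P x \<in> W" for x
  proof -
    have "?P x = apply_endo p0 (?P x)" using arg_cong[OF p(1), of "\<lambda>f. apply_endo f x"] by simp
    then show ?thesis using gW(3) by (metis ap(2))
  qed
  have P_id: "?P x = x" if "x \<in> W" for x
  proof -
    have "?P (apply_endo p0 x) = apply_endo p0 x" using arg_cong[OF p(2), of "\<lambda>f. apply_endo f x"] by simp
    then show ?thesis using that by (simp add: ap pi_W gW)
  qed
  have P_comm: "apply_endo x (?P v) = ?P (apply_endo x v)" if "x \<in> hc.A n" for x v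
    using arg_cong[OF p(3)[OF that], of "\<lambda>f. apply_endo f v"] by simp
  have P_pi: "?P (\<pi> x) = ?P x" for x
    using P_comm[OF hc.A_e, of x] pi_W[OF P_W] by (simp add: ap)
  define M' where "M' = {x \<in> V. ?P x = 0}"
  have gen0: "?P (generator g * x) = 0" if g: "hat (generator g) \<in> hc.A n" "generator g \<in> V" and x: "x \<in> M'" for g x
  proof -
    have xV: "x \<in> V" "?P x = 0" using x by (auto simp: M'_def)
    have "generator g * x - generator g * \<pi> x \<in> I"
      using I(4)[OF g(2) pi_mod[OF xV(1)]] by (simp add: right_diff_distrib)
    then have "?P (generator g * x) = ?P (apply_endo (hat (generator g)) x)"
      using pi_cong by (metis P_pi ap(4))
    also have "\<dots> = apply_endo (hat (generator g)) 0" using P_comm[OF g(1), of x] xV(2) by simp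
    finally show ?thesis by (simp add: apply_endo_0)
  qed
  have M'_gen: "generator g * x \<in> M'" if "g \<in> hc_generators n" "x \<in> M'" for g x
  proof -
    from that(1) consider i where "g = HC_T i" "0 < i" "i < n" | i where "g = HC_C i" "0 < i" "i \<le> n"
      by (auto simp: hc_generators_def)
    then have "hat (generator g) \<in> hc.A n \<and> generator g \<in> V"
      by cases (use hc.A_T[of _ n] hc.A_C[of _ n] TV CV in auto)
    then show ?thesis using gen0[of g x] that(2) V(5) by (auto simp: M'_def)
  qed
  have M'_scalar: "scalar a * x \<in> M'" if "x \<in> M'" for a x
  proof -
    have "SC a * e \<in> hc.A n" by (rule hc.A_SC[OF hc.A_e])
    from P_comm[OF this, of x] have "?P (scalar a * \<pi> x) = 0" using that pi_I[OF I(1)] by (simp add: ap M'_def apply_endo_0)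
    then have "?P (scalar a * x) = 0" using P_pi[of "scalar a * x"] by (simp add: pi_scalar)
    then show ?thesis using that V(5,6) by (simp add: M'_def)
  qed
  have M'_basic: "0 \<in> M'" "x \<in> M' \<Longrightarrow> y \<in> M' \<Longrightarrow> x + y \<in> M'" for x y
    using V by (auto simp: M'_def apply_endo_0 apply_endo_add)
  have M'_ideal: "left_ideal M' (hc_free n)"
  proof (rule R.left_idealI)
    show "M' \<subseteq> carrier (hc_free n)" by (auto simp: M'_def V_def)
    show "a \<otimes>\<^bsub>hc_free n\<^esub> x \<in> M'" if "a \<in> carrier (hc_free n)" "x \<in> M'" for a x
      unfolding fs by (rule mult_closed_if_generators[OF M'_basic M'_scalar M'_gen that]) auto
  qed (use M'_basic in \<open>auto simp: fs\<close>)
  have I_M': "I \<subseteq> M'"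
  proof
    fix x assume "x \<in> I"
    then show "x \<in> M'" using P_pi[of x] Isub pi_I[of x] by (auto simp: M'_def apply_endo_0)
  qed
  have disj: "M \<inter> M' \<subseteq> I"
  proof
    fix x assume x: "x \<in> M \<inter> M'"
    then have "\<pi> x \<in> W" by (simp add: W_def)
    then have "\<pi> x = 0" using P_id[of "\<pi> x"] P_pi[of x] x by (simp add: M'_def)
    then show "x \<in> I" using pi_mod[of x] x by (simp add: M'_def)
  qed
  have sum: "\<exists>a\<in>M. \<exists>b\<in>M'. x = a + b" if "x \<in> V" for x
  proof -
    have PV: "?P x \<in> V" "?P x \<in> M" using P_W W_M Mi(1) by blast+
    have "?P (x - ?P x) = 0" using P_id[OF P_W, of x] by (simp add: apply_endo_diff)
    then have "x - ?P x \<in> M'" using V(4)[OF that PV(1)] by (simp add: M'_def)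
    moreover have "x = ?P x + (x - ?P x)" by simp
    ultimately show ?thesis using PV(2) by blast
  qed
  show ?thesis
    by (intro exI[of _ M'] conjI ballI M'_ideal I_M'[unfolded I_def] disj[unfolded I_def])
      (use sum in \<open>auto simp: V_def fs\<close>)
qed

section \<open>Evaluation of the free algebra in an operator ring\<close>

locale free_algebra_eval =
  fixes SC :: "'a::field \<Rightarrow> 'e::ring_1" and act :: "'g \<Rightarrow> 'e"
  assumes SC_add: "SC (a + b) = SC a + SC b" and SC_mult: "SC (a * b) = SC a * SC b" and SC_1: "SC 1 = 1"
    and SC_act: "SC a * act g = act g * SC a"
begin

definition act_word :: "'g word \<Rightarrow> 'e" where
  "act_word w = prod_list (map act (letters w))"

definition eval :: "('g word \<Rightarrow>\<^sub>0 'a) \<Rightarrow> 'e" where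
  "eval p = (\<Sum>w\<in>Poly_Mapping.keys p. SC (Poly_Mapping.lookup p w) * act_word w)"

lemma SC_0: "SC 0 = 0"
  using SC_add[of 0 0] by simp

lemma eval_superset:
  "\<lbrakk>finite K; Poly_Mapping.keys p \<subseteq> K\<rbrakk> \<Longrightarrow> eval p = (\<Sum>w\<in>K. SC (Poly_Mapping.lookup p w) * act_word w)"
  unfolding eval_def by (rule sum.mono_neutral_left) (auto simp: in_keys_iff SC_0)

lemma eval_add: "eval (p + r) = eval p + eval r"
proof -
  let ?K = "Poly_Mapping.keys p \<union> Poly_Mapping.keys r"
  have "eval (p + r) = (\<Sum>w\<in>?K. SC (Poly_Mapping.lookup (p + r) w) * act_word w)"
    by (rule eval_superset) (auto simp: Poly_Mapping.keys_add)
  then show ?thesis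
    using eval_superset[of ?K p] eval_superset[of ?K r]
    by (simp add: lookup_add SC_add distrib_right sum.distrib)
qed

lemma eval_0: "eval 0 = 0"
  by (simp add: eval_def)

lemma eval_uminus: "eval (- p) = - eval p"
  using eval_add[of p "- p"] by (simp add: eval_0 add_eq_0_iff)

lemma eval_diff: "eval (p - r) = eval p - eval r"
  using eval_add[of p "- r"] by (simp add: eval_uminus)

lemma eval_sum: "eval (sum f K) = (\<Sum>i\<in>K. eval (f i))"
  by (induction K rule: infinite_finite_induct) (simp_all add: eval_0 eval_add)

lemma eval_single: "eval (Poly_Mapping.single w c) = SC c * act_word w"
  using eval_superset[of "{w}" "Poly_Mapping.single w c"] by simp

lemma act_word_SC: "SC a * act_word w = act_word w * SC a"
proof -
  have "SC a * prod_list (map act l) = prod_list (map act l) * SC a" for l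
  proof (induction l)
    case (Cons g l)
    have "SC a * (act g * prod_list (map act l)) = act g * (SC a * prod_list (map act l))"
      by (simp add: mult.assoc[symmetric] SC_act)
    then show ?case using Cons by (simp add: mult.assoc)
  qed simp
  then show ?thesis by (simp add: act_word_def)
qed

lemma eval_mult: "eval (p * r) = eval p * eval r"
proof -
  have single: "eval (Poly_Mapping.single w c * Poly_Mapping.single w' c') = eval (Poly_Mapping.single w c) * eval (Poly_Mapping.single w' c')"
    for w w' c c'
  proof -
    have "eval (Poly_Mapping.single w c * Poly_Mapping.single w' c') = SC c * (SC c' * act_word w) * act_word w'"
      by (simp add: mult_single eval_single SC_mult act_word_def plus_word_def mult.assoc)
    also have "\<dots> = SC c * (act_word w * SC c') * act_word w'" by (simp only: act_word_SC[of c' w])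
    finally show ?thesis by (simp add: eval_single mult.assoc)
  qed
  let ?P = "\<lambda>w. Poly_Mapping.single w (Poly_Mapping.lookup p w)" and ?R = "\<lambda>w. Poly_Mapping.single w (Poly_Mapping.lookup r w)"
  have "p * r = (\<Sum>w\<in>Poly_Mapping.keys p. ?P w) * (\<Sum>w\<in>Poly_Mapping.keys r. ?R w)"
    by (simp only: poly_mapping_sum_single[symmetric])
  then have "eval (p * r) = (\<Sum>w\<in>Poly_Mapping.keys p. \<Sum>w'\<in>Poly_Mapping.keys r. eval (?P w) * eval (?R w'))"
    by (simp add: sum_product eval_sum single)
  also have "\<dots> = eval (\<Sum>w\<in>Poly_Mapping.keys p. ?P w) * eval (\<Sum>w\<in>Poly_Mapping.keys r. ?R w)"
    by (simp add: sum_product eval_sum)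
  finally show ?thesis by (simp only: poly_mapping_sum_single[symmetric])
qed

lemma eval_generator: "eval (generator g) = act g"
  by (simp add: generator_def eval_single SC_1 act_word_def)

lemma eval_scalar: "eval (scalar a) = SC a"
  by (simp add: scalar_def eval_single act_word_def zero_word_def)

lemma eval_1: "eval 1 = 1"
  using eval_scalar[of 1] by (simp add: SC_1 scalar_simps)

end

section \<open>The Clifford module\<close>

text \<open>A subset of the positive integers is encoded by its characteristic function \<open>S\<close>; a vector is a
  function of \<open>S\<close>, to be read as \<open>\<Sum>S. f S \<cdot> C\<^sub>S\<close> with \<open>C\<^sub>S\<close> the increasing product of Clifford generators.\<close>

type_synonym 'a clifford = "(nat \<Rightarrow> bool) \<Rightarrow> 'a"

definition left_sign :: "nat \<Rightarrow> (nat \<Rightarrow> bool) \<Rightarrow> 'a::field" where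
  "left_sign j S = (\<Prod>s<j. if S s then - 1 else 1)"

text \<open>The sign of moving \<open>C j\<close> in from the right past the factors of larger
  index. These are counted only up to \<open>n\<close>, whence the bound on \<open>i\<close> in
  \<open>c_r_comm\<close>.\<close>

definition right_sign :: "nat \<Rightarrow> nat \<Rightarrow> (nat \<Rightarrow> bool) \<Rightarrow> 'a::field" where
  "right_sign n j S = (\<Prod>s\<in>{j<..n}. if S s then - 1 else 1)"

definition c_op :: "nat \<Rightarrow> 'a::field clifford \<Rightarrow> 'a clifford" where
  "c_op j f S = left_sign j S * f (S(j := \<not> S j))"

definition r_op :: "nat \<Rightarrow> nat \<Rightarrow> 'a::field clifford \<Rightarrow> 'a clifford" where
  "r_op n j f S = right_sign n j S * f (S(j := \<not> S j))"

text \<open>Forced by \<open>T i\<close> acting as \<open>q\<close> on the vector 1: with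
  \<open>eps = q - inverse q\<close> the relations send \<open>C i\<close> to
  \<open>q C (i+1)\<close>, \<open>C (i+1)\<close> to \<open>inverse q C i + eps C (i+1)\<close>,
  and \<open>C i C (i+1)\<close> to \<open>eps - inverse q C i C (i+1)\<close>. The formula is the
  transpose of this, because it gives the coefficient at \<open>S\<close> of the image.\<close>

definition t_op :: "'a::field \<Rightarrow> nat \<Rightarrow> 'a clifford \<Rightarrow> 'a clifford" where
  "t_op q i f S = (if S i
     then (if S (Suc i) then - inverse q * f S else inverse q * f (S(i := False, Suc i := True)))
     else (if S (Suc i) then q * f (S(i := True, Suc i := False)) + (q - inverse q) * f S
        else q * f S + (q - inverse q) * f (S(i := True, Suc i := True))))"

lemma prod_sign_upd:
  assumes "finite K"
  shows "(\<Prod>s\<in>K. if (S(i := x)) s then - 1 else (1::'a::field)) =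
    (if i \<in> K \<and> x \<noteq> S i then - (\<Prod>s\<in>K. if S s then - 1 else 1) else (\<Prod>s\<in>K. if S s then - 1 else 1))"
proof (cases "i \<in> K")
  case True
  have "(\<Prod>s\<in>K - {i}. if (S(i := x)) s then - 1 else (1::'a)) = (\<Prod>s\<in>K - {i}. if S s then - 1 else 1)"
    by (rule prod.cong) auto
  then show ?thesis using True
    by (auto simp: prod.remove[OF assms True])
next
  case False
  then show ?thesis by (auto intro!: prod.cong)
qed

lemma left_sign_upd: "left_sign j (S(i := x)) = (if i < j \<and> x \<noteq> S i then - left_sign j S else left_sign j S)"
  unfolding left_sign_def by (subst prod_sign_upd) auto

lemma right_sign_upd: "right_sign n j (S(i := x)) = (if j < i \<and> i \<le> n \<and> x \<noteq> S i then - right_sign n j S else right_sign n j S)"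
  unfolding right_sign_def by (subst prod_sign_upd) auto

lemma left_sign_sq: "left_sign j S * left_sign j S = 1"
proof -
  have "left_sign j S * left_sign j S = (\<Prod>s<j. (if S s then - 1 else 1) * (if S s then - 1 else (1::'a)))"
    unfolding left_sign_def by (rule prod.distrib[symmetric])
  also have "\<dots> = 1" by (rule prod.neutral) auto
  finally show ?thesis .
qed

lemma left_sign_Suc: "left_sign (Suc i) S = left_sign i S * (if S i then - 1 else 1)"
  by (simp add: left_sign_def)

lemma right_sign_rec: "i < n \<Longrightarrow> right_sign n i S = right_sign n (Suc i) S * (if S (Suc i) then - 1 else 1)"
proof -
  assume "i < n"
  then have "{i<..n} = insert (Suc i) {Suc i<..n}" by auto
  then show ?thesis by (simp add: right_sign_def mult.commute)
qed

lemma upd_flip: "(S :: nat \<Rightarrow> bool) i = x \<Longrightarrow> S(i := x) = S"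
  by (rule fun_upd_idem)

lemmas sign_simps = left_sign_upd right_sign_upd

lemma c_op_sq: "c_op i (c_op i f) S = f S"
  by (simp add: c_op_def left_sign_upd mult.assoc[symmetric] left_sign_sq)

lemma c_op_anti: "i \<noteq> j \<Longrightarrow> c_op i (c_op j f) S = - c_op j (c_op i f) (S :: nat \<Rightarrow> bool)"
  by (cases i j rule: linorder_cases) (simp_all add: c_op_def left_sign_upd fun_upd_twist)

lemma c_r_comm: "\<lbrakk>i \<le> n\<rbrakk> \<Longrightarrow> c_op i (r_op n j f) S = r_op n j (c_op i f) S"
  by (cases i j rule: linorder_cases) (simp_all add: c_op_def r_op_def sign_simps fun_upd_twist)

lemma t_op_sq: "q \<noteq> 0 \<Longrightarrow> t_op q i (t_op q i f) S = (q - inverse q) * t_op q i f S + f S"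
  by (cases "S i"; cases "S (Suc i)") (simp_all add: t_op_def upd_flip fun_upd_twist[of i "Suc i"] field_simps)

lemma t_op_far: "Suc i < j \<Longrightarrow> t_op q i (t_op q j f) S = t_op q j (t_op q i f) S"
  by (cases "S i"; cases "S (Suc i)"; cases "S j"; cases "S (Suc j)")
    (simp_all add: t_op_def fun_upd_twist algebra_simps)

lemma t_op_braid: "q \<noteq> 0 \<Longrightarrow> t_op q i (t_op q (Suc i) (t_op q i f)) S = t_op q (Suc i) (t_op q i (t_op q (Suc i) f)) S"
  by (cases "S i"; cases "S (Suc i)"; cases "S (Suc (Suc i))")
    (simp_all add: t_op_def fun_upd_twist upd_flip field_simps)

lemma t_c: "t_op q i (c_op i f) S = c_op (Suc i) (t_op q i f) S"
  by (cases "S i"; cases "S (Suc i)")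
    (simp_all add: t_op_def c_op_def left_sign_upd left_sign_Suc fun_upd_twist upd_flip algebra_simps)

lemma t_c': "q \<noteq> 0 \<Longrightarrow> t_op q i (c_op (Suc i) f) S = c_op i (t_op q i f) S - (q - inverse q) * (c_op i f S - c_op (Suc i) f S)"
  by (cases "S i"; cases "S (Suc i)")
    (simp_all add: t_op_def c_op_def left_sign_upd left_sign_Suc fun_upd_twist upd_flip field_simps)

lemma t_c_far: "\<lbrakk>j \<noteq> i; j \<noteq> Suc i\<rbrakk> \<Longrightarrow> t_op q i (c_op j f) S = c_op j (t_op q i f) S"
  by (cases "S i"; cases "S (Suc i)"; cases "j < i")
    (simp_all add: t_op_def c_op_def left_sign_upd fun_upd_twist algebra_simps)

lemma t_r_far: "\<lbrakk>j \<noteq> i; j \<noteq> Suc i; i < n\<rbrakk> \<Longrightarrow> t_op q i (r_op n j f) S = r_op n j (t_op q i f) S"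
  by (cases "S i"; cases "S (Suc i)"; cases "j < i")
    (simp_all add: t_op_def r_op_def right_sign_upd fun_upd_twist algebra_simps)

text \<open>Right multiplication by an element is an endomorphism of the induced module when the
  \<open>T i\<close> act on that element by \<open>q\<close>. For one index \<open>i\<close> in
  degree one such an element is \<open>C i + q^2 C (i + 1)\<close>; this is the source of the
  weights \<open>(q\<^sup>2) ^ j\<close>.\<close>

lemma t_r: "\<lbrakk>q \<noteq> 0; i < n\<rbrakk> \<Longrightarrow> t_op q i (r_op n i f) S + q\<^sup>2 * t_op q i (r_op n (Suc i) f) S =
    r_op n i (t_op q i f) S + q\<^sup>2 * r_op n (Suc i) (t_op q i f) S"
  by (cases "S i"; cases "S (Suc i)")
    (simp_all add: t_op_def r_op_def right_sign_upd right_sign_rec fun_upd_twist upd_flip field_simps power2_eq_square)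

definition c_endo :: "nat \<Rightarrow> 'a::field clifford endo" where "c_endo j = Endo (c_op j)"
definition r_endo :: "nat \<Rightarrow> nat \<Rightarrow> 'a::field clifford endo" where "r_endo n j = Endo (r_op n j)"
definition t_endo :: "'a::field \<Rightarrow> nat \<Rightarrow> 'a clifford endo" where "t_endo q i = Endo (t_op q i)"
definition s_endo :: "'a::field \<Rightarrow> 'a clifford endo" where "s_endo a = Endo (\<lambda>f S. a * f S)"

lemma apply_clifford_endo:
  "apply_endo (c_endo j) f = c_op j f" "apply_endo (r_endo n j) f = r_op n j f"
  "apply_endo (t_endo q i) f = t_op q i f" "apply_endo (s_endo a) f = (\<lambda>S. a * f S)"
  unfolding c_endo_def r_endo_def t_endo_def s_endo_def
  by (subst apply_Endo; auto simp: fun_eq_iff c_op_def r_op_def t_op_def algebra_simps)+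

lemma clifford_endo_eqI:
  "(\<And>f S. apply_endo X f S = apply_endo Y f S) \<Longrightarrow> X = (Y :: 'a::field clifford endo)"
  by (rule endo_eqI) (simp add: fun_eq_iff)

primrec hc_act :: "'a::field \<Rightarrow> hc_generator \<Rightarrow> 'a clifford endo" where
  "hc_act q (HC_T i) = t_endo q i"
| "hc_act q (HC_C i) = c_endo i"

interpretation hc_eval: free_algebra_eval s_endo "hc_act q" for q :: "'a::field"
proof
  show "s_endo (a + b) = s_endo a + s_endo b" for a b :: 'a
    by (rule clifford_endo_eqI) (simp add: apply_clifford_endo distrib_right)
  show "s_endo (a * b) = s_endo a * s_endo b" for a b :: 'a
    by (rule clifford_endo_eqI) (simp add: apply_clifford_endo mult.assoc)
  show "s_endo (1::'a) = 1"
    by (rule clifford_endo_eqI) (simp add: apply_clifford_endo)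
  show "s_endo a * hc_act q g = hc_act q g * s_endo a" for a :: 'a and g
    by (cases g; rule clifford_endo_eqI)
      (simp_all add: apply_clifford_endo c_op_def t_op_def algebra_simps)
qed

abbreviation "hc_ev q \<equiv> hc_eval.eval q"

lemma hc_ev_relations:
  assumes "q \<noteq> 0" "r \<in> hc_relations n q"
  shows "hc_ev q r = 0"
proof -
  note ev = hc_eval.eval_mult hc_eval.eval_add hc_eval.eval_diff hc_eval.eval_uminus hc_eval.eval_1
    hc_eval.eval_generator hc_eval.eval_scalar
  have E1: "t_endo q i * t_endo q i = s_endo (q - inverse q) * t_endo q i + 1" for i
    by (rule clifford_endo_eqI) (simp add: apply_clifford_endo t_op_sq assms)
  have E2: "t_endo q i * t_endo q j = t_endo q j * t_endo q i" if "\<bar>int i - int j\<bar> > 1" for i j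
  proof -
    have "Suc i < j \<or> Suc j < i" using that by linarith
    then show ?thesis
      by (intro clifford_endo_eqI) (auto simp: apply_clifford_endo intro: t_op_far t_op_far[symmetric])
  qed
  have E3: "t_endo q i * t_endo q (Suc i) * t_endo q i = t_endo q (Suc i) * t_endo q i * t_endo q (Suc i)" for i
    by (rule clifford_endo_eqI) (simp add: apply_clifford_endo t_op_braid assms)
  have E4: "c_endo i * c_endo i = (1 :: 'a clifford endo)" for i
    by (rule clifford_endo_eqI) (simp add: apply_clifford_endo c_op_sq)
  have E5: "c_endo i * c_endo j = - (c_endo j * (c_endo i :: 'a clifford endo))" if "i \<noteq> j" for i j
    by (rule clifford_endo_eqI) (simp add: apply_clifford_endo c_op_anti[OF that])
  have E6: "t_endo q i * c_endo i = c_endo (Suc i) * t_endo q i" for i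
    by (rule clifford_endo_eqI) (simp add: apply_clifford_endo t_c)
  have E7: "t_endo q i * c_endo (Suc i) = c_endo i * t_endo q i - s_endo (q - inverse q) * (c_endo i - c_endo (Suc i))" for i
    by (rule clifford_endo_eqI) (simp add: apply_clifford_endo t_c' assms)
  have E8: "t_endo q i * c_endo j = c_endo j * t_endo q i" if "j \<noteq> i" "j \<noteq> Suc i" for i j
    by (rule clifford_endo_eqI) (simp add: apply_clifford_endo t_c_far that)
  from assms(2) show ?thesis
    unfolding hc_relations_def Let_def
    apply (elim UnE CollectE exE conjE)
    subgoal by (simp add: ev E1)
    subgoal for i j using E2[of i j] by (simp add: ev)
    subgoal by (simp add: ev E3)
    subgoal by (simp add: ev E4)
    subgoal for i j using E5[of i j] by (simp add: ev)
    subgoal by (simp add: ev E6)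
    subgoal by (simp add: ev E7)
    subgoal for i j using E8[of j i] by (simp add: ev)
    done
qed

lemma hc_ev_ideal:
  assumes "q \<noteq> 0" "a \<in> hc_ideal n q"
  shows "hc_ev q a = 0"
proof -
  interpret R: ring "hc_free n :: (hc_generator word \<Rightarrow>\<^sub>0 'a) ring" by (rule ring_free_algebra)
  let ?K = "{a \<in> carrier (hc_free n). hc_ev q a = 0}"
  note ev = hc_eval.eval_mult hc_eval.eval_add hc_eval.eval_0 hc_eval.eval_uminus
  have K: "left_ideal ?K (hc_free n)"
    by (rule R.left_idealI) (use R.zero_closed free_algebra_add_closed free_algebra_mult_closed in \<open>auto simp: free_algebra_simps ev\<close>)
  have "ideal ?K (hc_free n)"
  proof (rule idealI[OF R.ring_axioms])
    show "subgroup ?K (add_monoid (hc_free n))"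
      using K by (auto simp: left_ideal_def additive_subgroup_def)
  qed (use free_algebra_mult_closed in \<open>auto simp: free_algebra_simps ev\<close>)
  moreover have "hc_relations n q \<subseteq> ?K"
    using hc_ev_relations[OF assms(1)] hc_relations_subset_carrier[of n q] by blast
  ultimately have "hc_ideal n q \<subseteq> ?K" by (rule R.genideal_minimal)
  then show ?thesis using assms(2) by blast
qed

text \<open>\<open>d_endo\<close> is left and \<open>rd_endo\<close> right multiplication by \<open>\<Sum>j. q\<^sup>2\<^sup>j C\<^sub>j\<close>.\<close>

definition empty_vec :: "'a::field clifford" where
  "empty_vec S = (if S = (\<lambda>_. False) then 1 else 0)"

definition d_endo :: "'a::field \<Rightarrow> nat \<Rightarrow> 'a clifford endo" where
  "d_endo q n = (\<Sum>j\<in>{1..n}. s_endo ((q\<^sup>2) ^ j) * c_endo j)"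

definition rd_endo :: "'a::field \<Rightarrow> nat \<Rightarrow> 'a clifford endo" where
  "rd_endo q n = (\<Sum>j\<in>{1..n}. s_endo ((q\<^sup>2) ^ j) * r_endo n j)"

lemma t_empty_vec: "apply_endo (t_endo q i) empty_vec = apply_endo (s_endo q) empty_vec"
proof
  fix S
  have ne: "g \<noteq> (\<lambda>_. False)" if "g x" for g :: "nat \<Rightarrow> bool" and x using that by auto
  have "S(i := True, Suc i := True) \<noteq> (\<lambda>_. False)" "S(i := True, Suc i := False) \<noteq> (\<lambda>_. False)"
    by (rule ne[of _ i]; simp)+
  moreover have "S(i := False, Suc i := True) \<noteq> (\<lambda>_. False)"
    by (rule ne[of _ "Suc i"]) simp
  moreover have "S i \<or> S (Suc i) \<Longrightarrow> S \<noteq> (\<lambda>_. False)" by auto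
  ultimately show "apply_endo (t_endo q i) empty_vec S = apply_endo (s_endo q) empty_vec S"
    by (auto simp: apply_clifford_endo t_op_def empty_vec_def)
qed

lemma flip_eq_empty: "S(j := \<not> S j) = (\<lambda>_. False) \<longleftrightarrow> S = (\<lambda>s. s = j)"
  by (auto simp: fun_eq_iff)

lemma c_empty_vec: "c_op j empty_vec S = (if S = (\<lambda>s. s = j) then 1 else 0)"
  unfolding c_op_def empty_vec_def flip_eq_empty by (auto simp: left_sign_def intro!: prod.neutral)

lemma r_empty_vec: "r_op n j empty_vec S = (if S = (\<lambda>s. s = j) then 1 else 0)"
  unfolding r_op_def empty_vec_def flip_eq_empty by (auto simp: right_sign_def intro!: prod.neutral)

lemma apply_sum_endo: "apply_endo (sum f K) x = (\<Sum>i\<in>K. apply_endo (f i) x)"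
  by (induction K rule: infinite_finite_induct) auto

lemma apply_sum_fun: "(sum f K) S = (\<Sum>i\<in>K. f i S)"
  by (induction K rule: infinite_finite_induct) auto

lemma d_empty_vec:
  "apply_endo (d_endo q n) empty_vec S = (if \<exists>j. 0 < j \<and> j \<le> n \<and> S = (\<lambda>s. s = j) then (q\<^sup>2) ^ (THE j. S = (\<lambda>s. s = j)) else 0)"
proof -
  have eq: "apply_endo (d_endo q n) empty_vec S = (\<Sum>j\<in>{1..n}. if S = (\<lambda>s. s = j) then (q\<^sup>2) ^ j else 0)"
    unfolding d_endo_def apply_sum_endo apply_sum_fun
    by (rule sum.cong) (auto simp: apply_clifford_endo c_empty_vec)
  show ?thesis
  proof (cases "\<exists>j. 0 < j \<and> j \<le> n \<and> S = (\<lambda>s. s = j)")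
    case True
    then obtain j where j: "0 < j" "j \<le> n" "S = (\<lambda>s. s = j)" by blast
    have u: "S = (\<lambda>s. s = i) \<longleftrightarrow> i = j" for i using j(3) by (auto simp: fun_eq_iff)
    have "apply_endo (d_endo q n) empty_vec S = (\<Sum>i\<in>{1..n}. if i = j then (q\<^sup>2) ^ j else 0)"
      unfolding eq u by (rule sum.cong) auto
    also have "\<dots> = (q\<^sup>2) ^ j" using j by simp
    finally show ?thesis unfolding u using j by auto
  next
    case False
    then have "(\<Sum>j\<in>{1..n}. if S = (\<lambda>s. s = j) then (q\<^sup>2) ^ j else 0) = 0"
      by (intro sum.neutral) auto
    then show ?thesis unfolding if_not_P[OF False] eq .
  qed
qed

lemma rd_empty_vec: "apply_endo (rd_endo q n) empty_vec = apply_endo (d_endo q n) empty_vec"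
proof -
  have "apply_endo (s_endo ((q\<^sup>2) ^ j) * r_endo n j) empty_vec = apply_endo (s_endo ((q\<^sup>2) ^ j) * c_endo j) empty_vec" for j
    by (simp add: apply_clifford_endo r_empty_vec c_empty_vec)
  then show ?thesis unfolding rd_endo_def d_endo_def apply_sum_endo by simp
qed

lemma s_endo_comm: "s_endo a * c_endo j = c_endo j * s_endo a" "s_endo a * r_endo n j = r_endo n j * s_endo a"
  "s_endo a * t_endo q j = t_endo q j * s_endo a" "s_endo a * s_endo b = s_endo (a * b)"
  by (rule clifford_endo_eqI; simp add: apply_clifford_endo c_op_def r_op_def t_op_def algebra_simps)+

text \<open>Mixed terms cancel by anticommutation and the diagonal gives the assumed sum. Adding the
  transposed double sum treats all pairs uniformly at the cost of a factor 2, which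
  \<open>two\<close> allows to cancel.\<close>

lemma d_endo_sq:
  fixes q :: "'a::field"
  assumes two: "(2 :: 'a) \<noteq> 0" and "(\<Sum>j\<in>{1..n}. (q\<^sup>2) ^ (2 * j)) = 0"
  shows "d_endo q n * d_endo q n = 0"
proof -
  define x where "x i j = s_endo ((q\<^sup>2) ^ i * (q\<^sup>2) ^ j) * (c_endo i * c_endo j)" for i j
  have dd: "d_endo q n * d_endo q n = (\<Sum>i\<in>{1..n}. \<Sum>j\<in>{1..n}. x i j)"
    unfolding d_endo_def sum_product
  proof (intro sum.cong refl)
    fix i j
    have "s_endo ((q\<^sup>2) ^ i) * c_endo i * (s_endo ((q\<^sup>2) ^ j) * c_endo j)
      = s_endo ((q\<^sup>2) ^ i) * (c_endo i * s_endo ((q\<^sup>2) ^ j)) * c_endo j" by (simp add: mult.assoc)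
    also have "\<dots> = (s_endo ((q\<^sup>2) ^ i) * s_endo ((q\<^sup>2) ^ j)) * (c_endo i * c_endo j)"
      by (simp only: s_endo_comm(1)[symmetric] mult.assoc)
    finally show "s_endo ((q\<^sup>2) ^ i) * c_endo i * (s_endo ((q\<^sup>2) ^ j) * c_endo j) = x i j"
      by (simp only: x_def s_endo_comm(4))
  qed
  have sym: "x i j + x j i = (if i = j then s_endo (2 * (q\<^sup>2) ^ (2 * i)) else 0)" for i j
  proof (cases "i = j")
    case True
    have "c_endo i * c_endo i = (1 :: 'a clifford endo)"
      by (rule clifford_endo_eqI) (simp add: apply_clifford_endo c_op_sq)
    then have "x i i = s_endo ((q\<^sup>2) ^ (2 * i))" by (simp add: x_def power_add mult_2)
    moreover have "s_endo a + s_endo a = s_endo (2 * a)" for a :: 'a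
      by (rule clifford_endo_eqI) (simp add: apply_clifford_endo)
    ultimately show ?thesis using True by simp
  next
    case False
    have "c_endo i * c_endo j = - (c_endo j * (c_endo i :: 'a clifford endo))"
      by (rule clifford_endo_eqI) (simp add: apply_clifford_endo c_op_anti[OF False])
    then have "x i j = - x j i" by (simp add: x_def mult.commute[of "(q\<^sup>2) ^ i"])
    then show ?thesis using False by simp
  qed
  have "(\<Sum>i\<in>{1..n}. \<Sum>j\<in>{1..n}. x i j) = (\<Sum>i\<in>{1..n}. \<Sum>j\<in>{1..n}. x j i)" by (rule sum.swap)
  then have "d_endo q n * d_endo q n + d_endo q n * d_endo q n = (\<Sum>i\<in>{1..n}. \<Sum>j\<in>{1..n}. x i j + x j i)"
    unfolding dd sum.distrib by simp
  also have "\<dots> = (\<Sum>i\<in>{1..n}. s_endo (2 * (q\<^sup>2) ^ (2 * i)))"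
    unfolding sym by (simp add: sum.delta')
  also have "\<dots> = s_endo (2 * (\<Sum>j\<in>{1..n}. (q\<^sup>2) ^ (2 * j)))"
    by (rule clifford_endo_eqI) (simp add: apply_sum_endo apply_sum_fun apply_clifford_endo sum_distrib_left sum_distrib_right)
  finally have z: "d_endo q n * d_endo q n + d_endo q n * d_endo q n = s_endo 0" using assms(2) by simp
  show ?thesis
  proof (rule clifford_endo_eqI)
    fix f :: "'a clifford" and S
    have "apply_endo (d_endo q n * d_endo q n + d_endo q n * d_endo q n) f S = 0"
      unfolding z by (simp add: apply_clifford_endo)
    then have "2 * apply_endo (d_endo q n * d_endo q n) f S = 0" by simp
    then show "apply_endo (d_endo q n * d_endo q n) f S = apply_endo 0 f S" using two by simp
  qed
qed

lemma rd_comm: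
  assumes "q \<noteq> 0"
  shows "\<lbrakk>0 < i; i \<le> n\<rbrakk> \<Longrightarrow> rd_endo q n * c_endo i = c_endo i * rd_endo q n"
    and "\<lbrakk>0 < i; i < n\<rbrakk> \<Longrightarrow> rd_endo q n * t_endo q i = t_endo q i * rd_endo q n"
    and "rd_endo q n * s_endo a = s_endo a * rd_endo q n"
proof -
  show "rd_endo q n * c_endo i = c_endo i * rd_endo q n" if "0 < i" "i \<le> n"
    unfolding rd_endo_def sum_distrib_left sum_distrib_right
  proof (rule sum.cong[OF refl])
    fix j
    have "c_endo i * r_endo n j = r_endo n j * (c_endo i :: 'a clifford endo)"
      using that by (intro clifford_endo_eqI) (simp add: apply_clifford_endo c_r_comm)
    then show "s_endo ((q\<^sup>2) ^ j) * r_endo n j * c_endo i = c_endo i * (s_endo ((q\<^sup>2) ^ j) * r_endo n j)"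
      by (rule commute_mult[OF s_endo_comm(1)[symmetric], symmetric])
  qed
  show "rd_endo q n * s_endo a = s_endo a * rd_endo q n"
    unfolding rd_endo_def sum_distrib_left sum_distrib_right
    by (rule sum.cong[OF refl], rule clifford_endo_eqI) (simp add: apply_clifford_endo r_op_def)
  show "rd_endo q n * t_endo q i = t_endo q i * rd_endo q n" if i: "0 < i" "i < n"
  proof -
    let ?z = "\<lambda>j. s_endo ((q\<^sup>2) ^ j) * r_endo n j"
    have far: "?z j * t_endo q i = t_endo q i * ?z j" if "j \<noteq> i" "j \<noteq> Suc i" for j
    proof -
      have "t_endo q i * r_endo n j = r_endo n j * t_endo q i"
        using that i by (intro clifford_endo_eqI) (simp add: apply_clifford_endo t_r_far)
      then show ?thesis
        by (rule commute_mult[OF s_endo_comm(3)[symmetric], symmetric])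
    qed
    have near: "(?z i + ?z (Suc i)) * t_endo q i = t_endo q i * (?z i + ?z (Suc i))"
    proof (rule clifford_endo_eqI)
      fix f :: "'a clifford" and S
      have lin: "t_op q i (\<lambda>S. a * g S) S = a * t_op q i g S" for a g S
        by (simp add: t_op_def algebra_simps)
      have add: "t_op q i (g + g') S = t_op q i g S + t_op q i g' S" for g g' S
        by (simp add: t_op_def algebra_simps)
      have "apply_endo (t_endo q i * (?z i + ?z (Suc i))) f S = (q\<^sup>2) ^ i * (t_op q i (r_op n i f) S + q\<^sup>2 * t_op q i (r_op n (Suc i) f) S)"
        by (simp add: apply_clifford_endo lin add) (simp add: algebra_simps)
      also have "\<dots> = (q\<^sup>2) ^ i * (r_op n i (t_op q i f) S + q\<^sup>2 * r_op n (Suc i) (t_op q i f) S)"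
        using t_r[OF assms i(2)] by simp
      also have "\<dots> = apply_endo ((?z i + ?z (Suc i)) * t_endo q i) f S"
        by (simp add: apply_clifford_endo algebra_simps)
      finally show "apply_endo ((?z i + ?z (Suc i)) * t_endo q i) f S = apply_endo (t_endo q i * (?z i + ?z (Suc i))) f S" by simp
    qed
    have split: "{1..n} = insert i (insert (Suc i) ({1..n} - {i, Suc i}))" using i by auto
    have rd: "rd_endo q n = (?z i + ?z (Suc i)) + sum ?z ({1..n} - {i, Suc i})"
      unfolding rd_endo_def by (subst split) (simp add: add.assoc)
    have "sum ?z ({1..n} - {i, Suc i}) * t_endo q i = t_endo q i * sum ?z ({1..n} - {i, Suc i})"
      unfolding sum_distrib_left sum_distrib_right by (rule sum.cong) (use far in auto)
    then show ?thesis unfolding rd distrib_left[of "t_endo q i" "?z i + ?z (Suc i)"] distrib_right[of "?z i + ?z (Suc i)"] near by simp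
  qed
qed

text \<open>Two occupied positions can be moved next to each other, where the eigenvalue equation forces \<open>0\<close>.\<close>

lemma eigenvector_support:
  fixes v :: "'a::field clifford"
  assumes q: "q \<noteq> 0" "q\<^sup>2 \<noteq> - 1" and v: "\<And>i S. \<lbrakk>0 < i; i < n\<rbrakk> \<Longrightarrow> t_op q i v S = q * v S"
    and ab: "0 < a" "a < b" "b \<le> n" "S a" "S b"
  shows "v S = 0"
  using ab
proof (induction "b - a" arbitrary: b S rule: less_induct)
  case less
  show ?case
  proof (cases "\<exists>c. a < c \<and> c < b \<and> S c")
    case True
    then obtain c where "a < c" "c < b" "S c" by blast
    then show ?thesis using less.hyps[of c S] less.prems by simp
  next
    case False
    obtain i where i: "b = Suc i" using less.prems by (cases b) auto
    have i0: "0 < i" "i < n" using less.prems i by auto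
    show ?thesis
    proof (cases "i = a")
      case True
      then have "- inverse q * v S = q * v S" using v[OF i0, of S] less.prems i by (simp add: t_op_def)
      then have "q * (q * v S) = - v S" using q(1) by (simp add: field_simps)
      then have "(q\<^sup>2 + 1) * v S = 0" by (simp add: distrib_right power2_eq_square mult.assoc)
      moreover have "q\<^sup>2 + 1 \<noteq> 0" using q(2) by (simp add: eq_neg_iff_add_eq_0)
      ultimately show ?thesis by simp
    next
      case n: False
      then have ai: "a < i" "\<not> S i" using less.prems i False by auto
      let ?S = "S(i := True, Suc i := False)"
      have "v ?S = 0" using less.hyps[of i ?S] less.prems ai i by simp
      moreover have "?S(i := False, Suc i := True) = S" using ai less.prems i by (auto simp: fun_eq_iff)
      then have "inverse q * v S = q * v ?S" using v[OF i0, of ?S] by (simp add: t_op_def)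
      ultimately show ?thesis using q by simp
    qed
  qed
qed

lemma eigenvector_form:
  fixes v :: "'a::field clifford"
  assumes q: "q \<noteq> 0" "q\<^sup>2 \<noteq> - 1" and n: "0 < n" and v: "\<And>i S. \<lbrakk>0 < i; i < n\<rbrakk> \<Longrightarrow> t_op q i v S = q * v S"
    and supp: "\<And>S s. S s \<Longrightarrow> \<not> (0 < s \<and> s \<le> n) \<Longrightarrow> v S = 0"
  shows "\<exists>\<alpha> \<beta>. v = apply_endo (s_endo \<alpha>) empty_vec + apply_endo (s_endo \<beta>) (apply_endo (d_endo q n) empty_vec)"
proof (intro exI ext)
  \<comment> \<open>The vector \<open>d\<close> has coefficient \<open>q\<^sup>2\<close> at the
    one-element set containing 1, hence the division.\<close>
  let ?\<alpha> = "v (\<lambda>_. False)" and ?\<beta> = "v (\<lambda>s. s = 1) / q\<^sup>2"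
  have single: "0 < j \<Longrightarrow> j \<le> n \<Longrightarrow> v (\<lambda>s. s = j) = ?\<beta> * (q\<^sup>2) ^ j" for j
  proof (induction j rule: nat_induct_non_zero)
    case 1
    then show ?case using q by simp
  next
    case (Suc j)
    have j: "0 < j" "j < n" using Suc by auto
    have "(\<lambda>s. s = j)(j := False, Suc j := True) = (\<lambda>s. s = Suc j)" by (auto simp: fun_eq_iff)
    then have "inverse q * v (\<lambda>s. s = Suc j) = q * v (\<lambda>s. s = j)"
      using v[OF j, of "\<lambda>s. s = j"] by (simp add: t_op_def)
    then have "v (\<lambda>s. s = Suc j) = q\<^sup>2 * v (\<lambda>s. s = j)" using q(1) by (simp add: field_simps power2_eq_square)
    then show ?case using Suc j by simp
  qed
  fix S
  show "v S = (apply_endo (s_endo ?\<alpha>) empty_vec + apply_endo (s_endo ?\<beta>) (apply_endo (d_endo q n) empty_vec)) S"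
  proof (cases "\<exists>j. S = (\<lambda>s. s = j)")
    case True
    then obtain j where j: "S = (\<lambda>s. s = j)" by blast
    have ne: "S \<noteq> (\<lambda>_. False)" unfolding j by (metis (full_types))
    have u: "S = (\<lambda>s. s = i) \<longleftrightarrow> i = j" for i using j by (auto simp: fun_eq_iff)
    have "(\<exists>i. 0 < i \<and> i \<le> n \<and> S = (\<lambda>s. s = i)) \<longleftrightarrow> 0 < j \<and> j \<le> n" "(THE i. S = (\<lambda>s. s = i)) = j"
      unfolding u by auto
    then have d: "apply_endo (d_endo q n) empty_vec S = (if 0 < j \<and> j \<le> n then (q\<^sup>2) ^ j else 0)"
      unfolding d_empty_vec by simp
    have "v S = (if 0 < j \<and> j \<le> n then ?\<beta> * (q\<^sup>2) ^ j else 0)"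
      using single[of j] supp[of S j] j by auto
    then show ?thesis using ne d by (auto simp: apply_clifford_endo empty_vec_def)
  next
    case False
    have d: "apply_endo (d_endo q n) empty_vec S = 0" unfolding d_empty_vec using False by auto
    show ?thesis
    proof (cases "S = (\<lambda>_. False)")
      case True
      then show ?thesis using d by (auto simp: apply_clifford_endo empty_vec_def)
    next
      case ne: False
      then obtain a where a: "S a" by auto
      obtain b where b: "S b" "b \<noteq> a" using False a by (metis ext)
      have "v S = 0"
      proof (cases "(0 < a \<and> a \<le> n) \<and> (0 < b \<and> b \<le> n)")
        case True
        then show ?thesis
          using eigenvector_support[OF q v, of n a b S] eigenvector_support[OF q v, of n b a S] a b
          by (cases "a < b") auto
      qed (use supp a b in blast)
      then show ?thesis using ne d by (simp add: apply_clifford_endo empty_vec_def)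
    qed
  qed
qed

section \<open>The submodule generated by \<open>d\<close> and the missing complement\<close>

lemma rd_ev_comm:
  assumes "q \<noteq> 0" "b \<in> carrier (hc_free n)"
  shows "rd_endo q n * hc_ev q b = hc_ev q b * rd_endo q n"
proof -
  let ?S = "{b. rd_endo q n * hc_ev q b = hc_ev q b * rd_endo q n}"
  have gen: "rd_endo q n * hc_act q g = hc_act q g * rd_endo q n" if "g \<in> hc_generators n" for g
    using that rd_comm(1,2)[OF assms(1)] by (auto simp: hc_generators_def)
  have "b * 1 \<in> ?S"
  proof (rule mult_closed_if_generators[OF _ _ _ _ assms(2)])
    show "scalar a * x \<in> ?S" if "x \<in> ?S" for a x
      using commute_mult[OF rd_comm(3)[OF assms(1), of n a]] that
      by (simp add: hc_eval.eval_mult hc_eval.eval_scalar)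
    show "generator g * x \<in> ?S" if "g \<in> hc_generators n" "x \<in> ?S" for g x
      using commute_mult[OF gen[OF that(1)]] that(2) by (simp add: hc_eval.eval_mult hc_eval.eval_generator)
  qed (simp_all add: hc_eval.eval_0 hc_eval.eval_1 hc_eval.eval_add distrib_left distrib_right)
  then show ?thesis by simp
qed

text \<open>Generators of level \<open>n\<close> never change positions outside
  \<open>{1..n}\<close>. So the cyclic module of \<open>empty_vec\<close> is confined to subsets of
  \<open>{1..n}\<close>, although the vector type admits all positions.\<close>

lemma ev_support:
  assumes b: "b \<in> carrier (hc_free n)" and s: "S s" "\<not> (0 < s \<and> s \<le> n)"
  shows "apply_endo (hc_ev q b) empty_vec S = 0"
proof -
  let ?S = "{b. \<forall>S s. S s \<longrightarrow> \<not> (0 < s \<and> s \<le> n) \<longrightarrow> apply_endo (hc_ev q b) empty_vec S = 0}"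
  have "b * 1 \<in> ?S"
  proof (rule mult_closed_if_generators[OF _ _ _ _ b])
    show "generator g * x \<in> ?S" if g: "g \<in> hc_generators n" and x: "x \<in> ?S" for g x
    proof (intro CollectI allI impI)
      fix S s assume s: "S s" "\<not> (0 < s \<and> s \<le> n)"
      let ?f = "apply_endo (hc_ev q x) empty_vec"
      have f: "?f S' = 0" if "S' s" for S' using x s(2) that by blast
      from g consider i where "g = HC_T i" "0 < i" "i < n" | i where "g = HC_C i" "0 < i" "i \<le> n"
        by (auto simp: hc_generators_def)
      then have "apply_endo (hc_act q g) ?f S = 0"
      proof cases
        case 1
        then have "s \<noteq> i" "s \<noteq> Suc i" using s(2) by auto
        then show ?thesis using 1 s(1) by (simp add: apply_clifford_endo t_op_def f)
      next
        case 2
        then have "s \<noteq> i" using s(2) by auto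
        then show ?thesis using 2 s(1) by (simp add: apply_clifford_endo c_op_def f)
      qed
      then show "apply_endo (hc_ev q (generator g * x)) empty_vec S = 0"
        by (simp add: hc_eval.eval_mult hc_eval.eval_generator)
    qed
  qed (auto simp: hc_eval.eval_0 hc_eval.eval_1 hc_eval.eval_add hc_eval.eval_mult hc_eval.eval_scalar
      apply_clifford_endo empty_vec_def)
  then show ?thesis using s by auto
qed

text \<open>The module is pulled back along its action on \<open>empty_vec\<close>: \<open>N\<close>
  is the preimage of the submodule generated by \<open>d\<close>. A complement of \<open>N\<close>
  would provide an equivariant projection, whose value \<open>v\<close> at \<open>empty_vec\<close>
  is forced to be \<open>empty_vec\<close> plus a multiple of \<open>d\<close>. Right multiplication
  by \<open>d\<close> sends this \<open>v\<close> to \<open>d\<close>, but it kills the submodule in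
  which \<open>v\<close> lies.\<close>

lemma not_semisimple_hecke_clifford:
  fixes q :: "'a::field"
  assumes q: "q \<noteq> 0" "q\<^sup>2 \<noteq> - 1" and two: "(2::'a) \<noteq> 0" and n: "0 < n"
    and sum: "(\<Sum>j\<in>{1..n}. (q\<^sup>2) ^ (2 * j)) = 0"
  shows "\<not> semisimple_ring (hecke_clifford n q)"
proof
  assume ss: "semisimple_ring (hecke_clifford n q)"
  let ?V = "carrier (hc_free n) :: (hc_generator word \<Rightarrow>\<^sub>0 'a) set"
  define \<rho> where "\<rho> a = apply_endo (hc_ev q a)" for a
  let ?f = "empty_vec :: 'a clifford"
  define D where "D = (\<Sum>j\<in>{1..n}. scalar ((q\<^sup>2) ^ j) * generator (HC_C j) :: hc_generator word \<Rightarrow>\<^sub>0 'a)"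
  define d where "d = apply_endo (d_endo q n) ?f"
  interpret R: ring "hc_free n :: (hc_generator word \<Rightarrow>\<^sub>0 'a) ring" by (rule ring_free_algebra)
  note fs = free_algebra_simps
  note ev = hc_eval.eval_mult hc_eval.eval_add hc_eval.eval_diff hc_eval.eval_uminus hc_eval.eval_1
    hc_eval.eval_0 hc_eval.eval_sum hc_eval.eval_generator hc_eval.eval_scalar
  have rho: "\<rho> (a + b) v = \<rho> a v + \<rho> b v" "\<rho> (a - b) v = \<rho> a v - \<rho> b v" "\<rho> (a * b) v = \<rho> a (\<rho> b v)"
    "\<rho> (- a) v = - \<rho> a v" "\<rho> 0 v = 0" "\<rho> 1 v = v" "\<rho> a (v + w) = \<rho> a v + \<rho> a w" for a b v w
    by (simp_all add: \<rho>_def ev apply_endo_add)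
  have D_V: "D \<in> ?V"
  proof -
    have "(\<Sum>j\<in>K. scalar ((q\<^sup>2) ^ j) * generator (HC_C j)) \<in> ?V" if "finite K" "K \<subseteq> {1..n}" for K
      using that
    proof (induction rule: finite_induct)
      case (insert j K)
      then have "scalar ((q\<^sup>2) ^ j) * generator (HC_C j) \<in> ?V"
        by (intro free_algebra_mult_closed scalar_in_carrier hc_gen_in) auto
      then show ?case using insert by (simp add: free_algebra_add_closed)
    qed (use R.zero_closed in \<open>simp add: fs\<close>)
    then show ?thesis by (simp add: D_def)
  qed
  have rho_D: "\<rho> D v = apply_endo (d_endo q n) v" for v
    by (simp add: \<rho>_def D_def d_endo_def ev)
  have dd: "apply_endo (d_endo q n) d = 0"
    using arg_cong[OF d_endo_sq[OF two sum], of "\<lambda>x. apply_endo x ?f"] by (simp add: d_def)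
  have d0: "d \<noteq> 0"
  proof -
    have "(\<lambda>s. s = (1::nat)) = (\<lambda>s. s = j) \<longleftrightarrow> j = 1" for j by (auto simp: fun_eq_iff)
    then have "d (\<lambda>s. s = 1) = q\<^sup>2" using n unfolding d_def d_empty_vec by auto
    then show ?thesis using q(1) by auto
  qed
  define N where "N = {a \<in> ?V. \<exists>c\<in>?V. \<rho> a ?f = \<rho> c d}"
  have N: "left_ideal N (hc_free n)"
  proof (rule R.left_idealI)
    show "N \<subseteq> ?V" by (auto simp: N_def)
    show "\<zero>\<^bsub>hc_free n\<^esub> \<in> N"
      unfolding N_def using R.zero_closed by (auto simp: fs rho intro!: bexI[of _ 0])
    show "a \<oplus>\<^bsub>hc_free n\<^esub> b \<in> N" if "a \<in> N" "b \<in> N" for a b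
    proof -
      from that obtain c c' where c: "c \<in> ?V" "\<rho> a ?f = \<rho> c d" "c' \<in> ?V" "\<rho> b ?f = \<rho> c' d" and ab: "a \<in> ?V" "b \<in> ?V"
        by (auto simp: N_def)
      have "\<rho> (a + b) ?f = \<rho> (c + c') d" by (simp add: rho c)
      then show ?thesis using c ab free_algebra_add_closed unfolding N_def fs by blast
    qed
    show "a \<otimes>\<^bsub>hc_free n\<^esub> b \<in> N" if a: "a \<in> ?V" and "b \<in> N" for a b
    proof -
      from that obtain c where c: "c \<in> ?V" "\<rho> b ?f = \<rho> c d" and b: "b \<in> ?V"
        by (auto simp: N_def)
      have "\<rho> (a * b) ?f = \<rho> (a * c) d" by (simp add: rho c)
      then show ?thesis using c a b free_algebra_mult_closed unfolding N_def fs by blast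
    qed
  qed
  have IV: "hc_ideal n q \<subseteq> ?V"
    using additive_subgroup.a_subset[OF ideal.axioms(1)[OF hc_ideal]] .
  have IN: "hc_ideal n q \<subseteq> N"
  proof
    fix a assume a: "a \<in> hc_ideal n q"
    then have "\<rho> a ?f = \<rho> 0 d" by (simp add: \<rho>_def hc_ev_ideal[OF q(1) a] ev)
    moreover have "0 \<in> ?V" using R.zero_closed by (simp add: fs)
    ultimately show "a \<in> N" using a IV unfolding N_def by blast
  qed
  obtain M' where M': "left_ideal M' (hc_free n)" "N \<inter> M' \<subseteq> hc_ideal n q"
    "\<forall>x\<in>?V. \<exists>a\<in>N. \<exists>b\<in>M'. x = a \<oplus>\<^bsub>hc_free n\<^esub> b"
    using ideal.semisimple_quotientD[OF hc_ideal ss[unfolded hecke_clifford_def] N IN]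
    by (elim exE conjE) (rule that)
  obtain a b where ab: "a \<in> N" "b \<in> M'" "1 = a + b"
    using M'(3) free_algebra_one_closed unfolding fs by blast
  define v where "v = \<rho> a ?f"
  \<comment> \<open>The product \<open>c * b = c - c * a\<close> lies in both \<open>N\<close> and
    \<open>M'\<close>, hence acts as zero. So \<open>c\<close> acts alike on the generator and on
    its projection \<open>v\<close>.\<close>
  have key: "\<rho> c ?f = \<rho> c v" if c: "c \<in> N" for c
  proof -
    have cV: "c \<in> ?V" and aV: "a \<in> ?V" using c ab(1) by (auto simp: N_def)
    have "c * b = c - c * a" using ab(3) by (metis add_diff_cancel_left' mult.right_neutral right_diff_distrib)
    moreover have "c * a \<in> N" using R.left_idealD(4)[OF N cV ab(1)] by (simp add: fs)
    moreover have "c - c * a \<in> N"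
      using R.left_idealD(6)[OF N c \<open>c * a \<in> N\<close>] free_algebra_minus[OF cV free_algebra_mult_closed[OF cV aV]] by simp
    moreover have "c * b \<in> M'" using R.left_idealD(4)[OF M'(1) cV ab(2)] by (simp add: fs)
    ultimately have "c - c * a \<in> hc_ideal n q" using M'(2) by auto
    then have "\<rho> (c - c * a) ?f = 0" by (simp add: \<rho>_def hc_ev_ideal[OF q(1)])
    then show ?thesis by (simp add: rho v_def)
  qed
  \<comment> \<open>\<open>T i - q\<close> annihilates the generator and therefore lies in
    \<open>N\<close>; by \<open>key\<close> it annihilates \<open>v\<close> too.\<close>
  have v: "t_op q i v S = q * v S" if i: "0 < i" "i < n" for i S
  proof -
    define c where "c = generator (HC_T i) - (scalar q :: hc_generator word \<Rightarrow>\<^sub>0 'a)"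
    have cV: "c \<in> ?V" unfolding c_def
      by (intro free_algebra_diff_closed scalar_in_carrier hc_gen_in i)
    have app: "\<rho> c w = t_op q i w - (\<lambda>S. q * w S)" for w
      by (simp add: \<rho>_def c_def ev apply_clifford_endo)
    have 0: "\<rho> c ?f = 0" unfolding app using t_empty_vec[of q i] by (simp add: apply_clifford_endo)
    have "0 \<in> ?V" using R.zero_closed by (simp add: fs)
    then have "c \<in> N" using cV 0 unfolding N_def by (intro CollectI conjI bexI[of _ 0]) (simp_all add: rho)
    then have "\<rho> c v = 0" using key 0 by simp
    then show ?thesis unfolding app by (simp add: fun_eq_iff)
  qed
  have aV: "a \<in> ?V" using ab(1) by (simp add: N_def)
  have "\<exists>\<alpha> \<beta>. v = apply_endo (s_endo \<alpha>) ?f + apply_endo (s_endo \<beta>) (apply_endo (d_endo q n) ?f)"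
    by (rule eigenvector_form[OF q n v]) (use ev_support[OF aV] in \<open>auto simp: v_def \<rho>_def\<close>)
  then obtain \<alpha> \<beta> where v_eq: "v = apply_endo (s_endo \<alpha>) ?f + apply_endo (s_endo \<beta>) d"
    by (auto simp: d_def)
  have Ds: "apply_endo (d_endo q n) (apply_endo (s_endo \<gamma>) w) = apply_endo (s_endo \<gamma>) (apply_endo (d_endo q n) w)" for \<gamma> w
  proof -
    have "s_endo \<gamma> * hc_ev q D = hc_ev q D * s_endo \<gamma>"
    proof -
      have "s_endo \<gamma> * (s_endo ((q\<^sup>2) ^ j) * c_endo j) = s_endo ((q\<^sup>2) ^ j) * c_endo j * s_endo \<gamma>" for j
        by (rule commute_mult) (simp_all add: s_endo_comm mult.commute)
      then show ?thesis by (simp add: D_def ev sum_distrib_left sum_distrib_right)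
    qed
    then have "apply_endo (s_endo \<gamma> * hc_ev q D) w = apply_endo (hc_ev q D * s_endo \<gamma>) w" by (rule arg_cong)
    then show ?thesis using rho_D by (simp add: \<rho>_def)
  qed
  \<comment> \<open>Applying \<open>key\<close> to \<open>D\<close> isolates
    \<open>\<alpha>\<close>: since \<open>d\<close> squares to 0, the \<open>\<beta>\<close>-part of
    \<open>v\<close> disappears and \<open>d = \<alpha> d\<close> remains.\<close>
  have "D \<in> N"
    unfolding N_def using D_V free_algebra_one_closed by (auto simp: rho rho_D d_def intro!: bexI[of _ 1])
  then have "\<rho> D ?f = \<rho> D v" by (rule key)
  then have "d = apply_endo (d_endo q n) v" by (simp only: rho_D d_def)
  also have "\<dots> = apply_endo (s_endo \<alpha>) d"
    unfolding v_eq by (simp add: apply_endo_add Ds dd apply_endo_0 d_def[symmetric])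
  finally have "d = (\<lambda>S. \<alpha> * d S)" unfolding apply_clifford_endo .
  then have d_\<alpha>: "d S = \<alpha> * d S" for S by (rule fun_cong)
  obtain S where "d S \<noteq> 0" using d0 by (auto simp: fun_eq_iff)
  then have \<alpha>: "\<alpha> = 1" using d_\<alpha>[of S] by simp
  obtain c where c: "c \<in> ?V" "v = \<rho> c d" using ab(1) by (auto simp: N_def v_def)
  let ?r = "apply_endo (rd_endo q n)"
  have r_f: "?r ?f = d" using rd_empty_vec by (simp add: d_def)
  have r_\<rho>: "?r (\<rho> x w) = \<rho> x (?r w)" if "x \<in> ?V" for x w
    using arg_cong[OF rd_ev_comm[OF q(1) that], of "\<lambda>X. apply_endo X w"] by (simp add: \<rho>_def)
  have r_d: "?r d = 0" using r_\<rho>[OF D_V, of ?f] by (simp add: r_f rho_D dd flip: d_def)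
  have s1: "apply_endo (s_endo 1) w = w" for w :: "'a clifford" by (simp add: apply_clifford_endo)
  have r_s: "?r (apply_endo (s_endo \<beta>) w) = apply_endo (s_endo \<beta>) (?r w)" for w
    using arg_cong[OF rd_comm(3)[OF q(1), of n \<beta>], of "\<lambda>X. apply_endo X w"] by simp
  have "?r v = d" unfolding v_eq \<alpha> s1 by (simp add: apply_endo_add r_f r_s r_d apply_endo_0)
  moreover have "?r v = 0" unfolding c(2) r_\<rho>[OF c(1)] r_d by (simp add: \<rho>_def apply_endo_0)
  ultimately show False using d0 by simp
qed

section \<open>Eigenvalues and roots of unity\<close>

lemma primitive_root_power_eq_1:
  fixes q :: "'a::field"
  assumes "primitive_root_of_unity k q" "q ^ m = 1"
  shows "k dvd m"
proof -
  have "q ^ m = (q ^ k) ^ (m div k) * q ^ (m mod k)"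
    by (simp flip: power_mult power_add)
  then have "q ^ (m mod k) = 1" using assms by (simp add: primitive_root_of_unity_def)
  moreover have "m mod k < k" using assms(1) by (simp add: primitive_root_of_unity_def)
  ultimately have "m mod k = 0" using assms(1) by (auto simp: primitive_root_of_unity_def)
  then show ?thesis by auto
qed

lemma primitive_root_square:
  fixes q :: "'a::field"
  assumes "primitive_root_of_unity k q" "(odd k \<and> h = k) \<or> (\<exists>l. k = 4 * l \<and> h = 2 * l)"
  shows "primitive_root_of_unity h (q\<^sup>2)"
proof -
  have k: "0 < k" "q ^ k = 1" using assms(1) by (auto simp: primitive_root_of_unity_def)
  have h: "0 < h" "(q\<^sup>2) ^ h = 1"
  proof -
    from assms(2) show "0 < h" using k(1) by auto
    from assms(2) show "(q\<^sup>2) ^ h = 1"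
    proof
      assume "odd k \<and> h = k"
      then show ?thesis using k(2) by (simp add: power_mult[symmetric] mult.commute[of 2] power_mult)
    next
      assume "\<exists>l. k = 4 * l \<and> h = 2 * l"
      then show ?thesis using k(2) by (auto simp: power_mult[symmetric])
    qed
  qed
  have "(q\<^sup>2) ^ j \<noteq> 1" if j: "0 < j" "j < h" for j
  proof
    assume "(q\<^sup>2) ^ j = 1"
    then have "k dvd 2 * j" using primitive_root_power_eq_1[OF assms(1), of "2 * j"] by (simp add: power_mult)
    then have "h dvd j"
      using assms(2) by (auto simp: coprime_dvd_mult_right_iff dest: dvd_mult_cancel1)
    then show False using j by (auto dest: dvd_imp_le)
  qed
  then show ?thesis using h by (simp add: primitive_root_of_unity_def)
qed

lemma sum_even_powers_eq_0:
  fixes t :: "'a::field"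
  assumes "t ^ (2 * n) = 1" "t\<^sup>2 \<noteq> 1"
  shows "(\<Sum>j\<in>{1..n}. t ^ (2 * j)) = 0"
proof -
  have "(t\<^sup>2 - 1) * (\<Sum>j\<in>{1..n}. t ^ (2 * j)) = t\<^sup>2 * (t ^ (2 * n) - 1)"
    by (induction n) (simp_all add: algebra_simps power2_eq_square)
  then show ?thesis using assms by simp
qed

text \<open>The factor of the trace formula, cleared of denominators, as a polynomial in
  \<open>s\<close>. The sum of the roots is right because
  \<open>q^2 + q^(-2) = 2 + (q - inverse q)^2\<close>; their product because
  \<open>u (q + inverse q) = 2\<close>, which writes the constant \<open>4 (q - inverse q)^2\<close>
  as \<open>u^2 (q^2 - q^(-2))^2\<close>.\<close>

lemma shifted_pair_polynomial:
  fixes q z :: "'a::field"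
  defines "u \<equiv> 2 / (q + inverse q)"
  defines "\<phi> \<equiv> \<lambda>x. u * (x + inverse x)"
  assumes q: "q \<noteq> 0" "q\<^sup>2 \<noteq> - 1" and z: "z \<noteq> 0"
  shows "[:- \<phi> z, 1:]\<^sup>2 - smult ((q - inverse q)\<^sup>2) [:- 4, \<phi> z:] =
    [:- \<phi> (q\<^sup>2 * z), 1:] * [:- \<phi> (z / q\<^sup>2), 1:]"
proof -
  have "q * q + 1 \<noteq> 0" using q(2) by (simp add: eq_neg_iff_add_eq_0 power2_eq_square)
  then have uq: "u * (q * q + 1) = 2 * q" using q(1) by (simp add: u_def field_simps)
  define r where "r = inverse q"
  define w where "w = inverse z"
  have qr: "q * r = 1" "z * w = 1" using q(1) z by (simp_all add: r_def w_def)
  have ur: "u * (q + r) = 2" using uq q(1) by (simp add: r_def field_simps)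
  have phi: "\<phi> z = u * (z + w)" "\<phi> (q\<^sup>2 * z) = u * (q * q * z + r * r * w)" "\<phi> (z / q\<^sup>2) = u * (r * r * z + q * q * w)"
    using q z by (simp_all add: \<phi>_def r_def w_def field_simps power2_eq_square)
  have lin: "u * (q * q * z + r * r * w) + u * (r * r * z + q * q * w) = u * (z + w) * (2 + (q - r) * (q - r))"
  proof -
    have "2 + (q - r) * (q - r) = q * q + r * r" using qr by (simp add: algebra_simps)
    then show ?thesis by (simp only:) (simp add: algebra_simps)
  qed
  have const: "(u * (z + w)) * (u * (z + w)) + 4 * ((q - r) * (q - r)) = u * (q * q * z + r * r * w) * (u * (r * r * z + q * q * w))"
  proof -
    have "4 * ((q - r) * (q - r)) = (u * (q + r)) * (u * (q + r)) * ((q - r) * (q - r))" by (simp only: ur) simp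
    also have "\<dots> = u * u * (q * q * q * q + r * r * r * r - 2 * ((q * r) * (q * r)))" by (simp add: algebra_simps)
    finally have "(u * (z + w)) * (u * (z + w)) + 4 * ((q - r) * (q - r)) =
      u * u * (z * z + w * w + 2 * (z * w)) + u * u * (q * q * q * q + r * r * r * r - 2 * ((q * r) * (q * r)))"
      by (simp add: algebra_simps)
    also have "\<dots> = u * u * ((q * r) * (q * r) * (z * z + w * w) + (q * q * q * q + r * r * r * r) * (z * w))"
      unfolding qr by (simp add: algebra_simps)
    finally show ?thesis by (simp add: algebra_simps)
  qed
  show ?thesis
    unfolding phi r_def[symmetric] using lin const
    by (simp add: power2_eq_square) (simp add: algebra_simps)
qed

lemma no_residual_multiset:
  fixes q :: "'a::alg_closed_field"
  assumes q: "q \<noteq> 0" "q\<^sup>2 \<noteq> - 1" and two: "(2::'a) \<noteq> 0" and h: "primitive_root_of_unity h (q\<^sup>2)"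
    and m: "0 < m"
    and eq: "(\<Prod>k<m. [:- \<eta> k, 1:]\<^sup>2 - smult ((q - inverse q)\<^sup>2) [:- 4, \<eta> k:]) = (\<Prod>k<m. [:- \<eta> k, 1:]\<^sup>2)"
  shows "h \<le> 2 * m" "odd h \<Longrightarrow> h \<le> m"
proof -
  define u where "u = 2 / (q + inverse q)"
  have "q * q + 1 \<noteq> 0" using q(2) by (simp add: eq_neg_iff_add_eq_0 power2_eq_square)
  then have u: "u \<noteq> 0" using two q(1) by (simp add: u_def field_simps)
  \<comment> \<open>\<open>z\<close> is a root of \<open>X^2 - (\<eta> k / u) X + 1\<close>, nonzero
    because of the constant term 1.\<close>
  have "\<exists>z. z \<noteq> 0 \<and> \<eta> k = u * (z + inverse z)" for k
  proof -
    obtain z where "poly [:1, - \<eta> k / u, 1:] z = 0"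
      using alg_closed_imp_poly_has_root[of "[:1, - \<eta> k / u, 1:]"] by auto
    then have z: "1 - \<eta> k / u * z + z * z = 0" by (simp add: algebra_simps)
    then have z0: "z \<noteq> 0" by auto
    have "\<eta> k * z = u * (1 + z * z)" using z u by (simp add: field_simps)
    then have "\<eta> k = u * (z + inverse z)" using z0 by (simp add: field_simps)
    then show ?thesis using z0 by blast
  qed
  then obtain z where z: "\<And>k. z k \<noteq> 0" "\<And>k. \<eta> k = u * (z k + inverse (z k))" by metis
  have eq': "(\<Prod>k<m. [:- (u * (q\<^sup>2 * z k + inverse (q\<^sup>2 * z k))), 1:] * [:- (u * (z k / q\<^sup>2 + inverse (z k / q\<^sup>2))), 1:]) =
    (\<Prod>k<m. [:- (u * (z k + inverse (z k))), 1:] * [:- (u * (z k + inverse (z k))), 1:])"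
  proof -
    have "[:- (u * (q\<^sup>2 * z k + inverse (q\<^sup>2 * z k))), 1:] * [:- (u * (z k / q\<^sup>2 + inverse (z k / q\<^sup>2))), 1:] =
      [:- \<eta> k, 1:]\<^sup>2 - smult ((q - inverse q)\<^sup>2) [:- 4, \<eta> k:]" for k
      unfolding z(2) by (rule shifted_pair_polynomial[OF q z(1), folded u_def, symmetric])
    moreover have "[:- (u * (z k + inverse (z k))), 1:] * [:- (u * (z k + inverse (z k))), 1:] = [:- \<eta> k, 1:]\<^sup>2" for k
      by (simp only: z(2) power2_eq_square)
    ultimately show ?thesis using eq by (simp only:)
  qed
  have "0 < h" "(q\<^sup>2) ^ h = 1" "\<And>j. \<lbrakk>0 < j; j < h\<rbrakk> \<Longrightarrow> (q\<^sup>2) ^ j \<noteq> 1"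
    using h by (auto simp: primitive_root_of_unity_def)
  note b = residual_orbit_bound[OF m z(1) u this eq']
  show "h \<le> 2 * m" "odd h \<Longrightarrow> h \<le> m" using b by auto
qed

theorem proposition6p8:
  fixes q :: "'a::alg_closed_field" and n h k :: nat
  assumes "CHAR('a) \<noteq> 2"
    and "q \<noteq> 0" and "q \<noteq> 1" and "q \<noteq> -1"
    and "primitive_root_of_unity k q"
    and "(odd k \<and> h = k) \<or> (\<exists>l. k = 4 * l \<and> h = 2 * l)"
    and "n \<ge> 1" and "h \<ge> 3"
  shows "((odd h \<and> h = n \<longrightarrow> \<not> semisimple_ring (hecke_clifford n q)) \<and>
          (even h \<and> h = 2 * n \<longrightarrow> \<not> semisimple_ring (hecke_clifford n q))) \<and>
         ((odd h \<and> h > n) \<or> (even h \<and> h > 2 * n) \<longrightarrow> semisimple_ring (hecke_clifford n q))"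
proof -
  have two: "(2::'a) \<noteq> 0"
  proof
    assume "(2::'a) = 0"
    then have "CHAR('a) dvd 2" using of_nat_eq_0_iff_char_dvd[of 2, where 'a='a] by simp
    then have "CHAR('a) = 1 \<or> CHAR('a) = 2" using two_is_prime_nat by (auto simp: prime_nat_iff)
    then show False using assms(1) CHAR_not_1[where 'a='a] by auto
  qed
  have h: "primitive_root_of_unity h (q\<^sup>2)" by (rule primitive_root_square[OF assms(5,6)])
  \<comment> \<open>The bound \<open>h \<ge> 3\<close> enters here: it excludes
    \<open>q^4 = 1\<close> and with it \<open>q^2 = -1\<close>, so that \<open>q + inverse q\<close>
    is invertible.\<close>
  have t: "(q\<^sup>2)\<^sup>2 \<noteq> 1" using h assms(8) unfolding primitive_root_of_unity_def by (auto dest: spec[of _ 2])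
  then have q2: "q\<^sup>2 \<noteq> - 1" by (metis power2_eq_1_iff)
  \<comment> \<open>One argument serves both claims of non-semisimplicity: \<open>h = n\<close> and
    \<open>h = 2 * n\<close> each give \<open>(q\<^sup>2) ^ (2 * n) = 1\<close>, so the geometric
    sum for the square of \<open>d\<close> vanishes.\<close>
  have "\<not> semisimple_ring (hecke_clifford n q)" if "h = n \<or> h = 2 * n"
  proof (rule not_semisimple_hecke_clifford[OF assms(2) q2 two])
    have "(q\<^sup>2) ^ (2 * n) = 1"
      using that h by (auto simp: primitive_root_of_unity_def power_mult mult.commute[of 2])
    then show "(\<Sum>j\<in>{1..n}. (q\<^sup>2) ^ (2 * j)) = 0" using t by (rule sum_even_powers_eq_0)
  qed (use assms(7) in simp)
  moreover have "semisimple_ring (hecke_clifford n q)" if hn: "(odd h \<and> h > n) \<or> (even h \<and> h > 2 * n)"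
    unfolding hecke_clifford_def
  proof (rule ideal.semisimple_quotientI[OF hc_ideal complement_of_left_ideal])
    fix m and \<eta> :: "nat \<Rightarrow> 'a" assume m: "0 < m" "m \<le> n"
    show "(\<Prod>k<m. [:- \<eta> k, 1:]\<^sup>2 - smult ((q - inverse q)\<^sup>2) [:- 4, \<eta> k:]) \<noteq> (\<Prod>k<m. [:- \<eta> k, 1:]\<^sup>2)"
    proof
      assume "(\<Prod>k<m. [:- \<eta> k, 1:]\<^sup>2 - smult ((q - inverse q)\<^sup>2) [:- 4, \<eta> k:]) = (\<Prod>k<m. [:- \<eta> k, 1:]\<^sup>2)"
      from no_residual_multiset[OF assms(2) q2 two h m(1) this] show False using hn m by auto
    qed
  qed
  ultimately show ?thesis by blast
qed

end
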